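(* Assume the hypotheses below hold with some $q>4$, $p\in[1,4)$ and $\kappa\in(0,1/2]$. Let $b_n\to\infty$ be integers with $b_n/n^{2/(3\max(p,2))}\to0$ and $b_n/n^{(\kappa q-2)/(q+2)}\to0$. Then, as $n\to\infty$, $$Q_n(u)=\frac1n\sum_{t=\tau_n+L_n}^{\lfloor nu\rfloor-b_n}\frac1{b_n}\Big[Df(\hat\mu_{t-L_n,n})\sum_{i=1}^{b_n}(X_{t+i,n}-\hat\mu_{t-L_n,n})\Big]^2\ \to\ Q(u)=\int_0^uDf(\mu_v)\Sigma(v)Df(\mu_v)^T\,dv$$ in probability, uniformly in $u\in[0,1]$, where $\Sigma(v)=\sum_{h=-\infty}^\infty\operatorname{Cov}(G(v,\boldsymbol{\epsilon}_0),G(v,\boldsymbol{\epsilon}_h))$.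
   Context: Model: $(\epsilon_i)_{i\in\mathbb Z}$ i.i.d., $(\epsilon^*_i)$ an independent copy; $\boldsymbol{\epsilon}_t=(\epsilon_t,\epsilon_{t-1},\dots)$, $\tilde{\boldsymbol{\epsilon}}_{t,j}=(\epsilon_t,\dots,\epsilon_{t-j+1},\epsilon^*_{t-j},\epsilon_{t-j-1},\dots)$. Measurable kernels $G_n,G:\mathbb R\times\mathbb R^\infty\to\mathbb R^d$, $X_{t,n}=G_n(t/n,\boldsymbol{\epsilon}_t)$. $\|Y\|_{L_q}=(\mathbb E\|Y\|^q)^{1/q}$; $\|G_n\|_{p\text{-var}}=\sup_{0=u_0<\dots<u_m=1}(\sum_i\|G_n(u_i,\boldsymbol{\epsilon}_0)-G_n(u_{i-1},\boldsymbol{\epsilon}_0)\|_{L_q}^p)^{1/p}$. (A.1) $\sup_u\|G_n(u,\boldsymbol{\epsilon}_0)-G(u,\boldsymbol{\epsilon}_0)\|_{L_q}\to0$. (A.2) $\sup_n\sup_u\|G_n(u,\boldsymbol{\epsilon}_0)\|_{L_q}+\sup_n\|G_n\|_{p\text{-var}}\le C_G<\infty$. (A.3) for some $\rho\in(0,1)$, $\|G_n(u,\boldsymbol{\epsilon}_t)-G_n(u,\tilde{\boldsymbol{\epsilon}}_{t,j})\|_{L_q}\le C_G\rho^j$ for all $j,n,u$. $\mu^n_u=\mathbb EG_n(u,\boldsymbol{\epsilon}_0)$, $\mu_u=\mathbb EG(u,\boldsymbol{\epsilon}_0)$, $\mathcal M=\mathrm{conv}\{\mu_u\}$, $\mathcal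 M^\delta$ its open $\delta$-neighborhood. $f:\mathbb R^d\to\mathbb R$ twice differentiable, $Df\in\mathbb R^{1\times d}$, Hessian $D^2f$. (A.4) for some $\delta\in(0,\infty]$, $C_f$: $|f|+\|Df\|+\|D^2f\|\le C_f$ on $\mathcal M^\delta$. Pilot estimators $\hat\mu_{t,n}$ are $\sigma(\epsilon_t,\epsilon_{t-1},\dots)$-measurable; integers $\tau_n\ge1$, $L_n\to\infty$, $L_n/\tau_n\to0$. (C.5* ) $\sum_{t=\tau_n}^n\|\hat\mu_{t,n}-\mu^n_{t/n}\|^2=o_P(n^{1-\kappa})$. (A.6) $P(\hat\mu_{t,n}\in\mathcal M^\delta,\ t=\tau_n,\dots,n)\to1$. Further: $\tau_n/n\to0$, $\log(n)^{1+a}/L_n\to0$ for some $a\in(0,1)$, $L_n/n^{1/p-1/4}\to0$, $L_n/n^{1/(2p)}\to0$. *)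

theory Defs
  imports "HOL-Probability.Probability"
begin

definition eps_seq :: "(int \<Rightarrow> 'a \<Rightarrow> real) \<Rightarrow> int \<Rightarrow> 'a \<Rightarrow> (nat \<Rightarrow> real)" where
  "eps_seq \<epsilon> t \<omega> = (\<lambda>k. \<epsilon> (t - int k) \<omega>)"

definition eps_tilde :: "(int \<Rightarrow> 'a \<Rightarrow> real) \<Rightarrow> (int \<Rightarrow> 'a \<Rightarrow> real) \<Rightarrow> int \<Rightarrow> nat \<Rightarrow> 'a \<Rightarrow> (nat \<Rightarrow> real)" where
  "eps_tilde \<epsilon> \<epsilon>s t j \<omega> = (\<lambda>k. if k = j then \<epsilon>s (t - int j) \<omega> else \<epsilon> (t - int k) \<omega>)"

text \<open>q-th absolute moment (possibly infinite) and the L_q norm (meaningful when the moment is finite).\<close>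
definition Lq_moment :: "'a measure \<Rightarrow> real \<Rightarrow> ('a \<Rightarrow> 'b::real_normed_vector) \<Rightarrow> ennreal" where
  "Lq_moment M q Y = (\<integral>\<^sup>+ \<omega>. ennreal (norm (Y \<omega>) powr q) \<partial>M)"

definition Lq_norm :: "'a measure \<Rightarrow> real \<Rightarrow> ('a \<Rightarrow> 'b::real_normed_vector) \<Rightarrow> real" where
  "Lq_norm M q Y = enn2real (Lq_moment M q Y) powr (1 / q)"

text \<open>\<open>Lq_le M q Y c\<close> means \<open>\<parallel>Y\<parallel>_{L_q} \<le> c\<close> (for c \<ge> 0), including the case of an infinite moment.\<close>
definition Lq_le :: "'a measure \<Rightarrow> real \<Rightarrow> ('a \<Rightarrow> 'b::real_normed_vector) \<Rightarrow> real \<Rightarrow> bool" where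
  "Lq_le M q Y c \<longleftrightarrow> 0 \<le> c \<and> Lq_moment M q Y \<le> ennreal (c powr q)"

definition is_partition01 :: "(nat \<Rightarrow> real) \<Rightarrow> nat \<Rightarrow> bool" where
  "is_partition01 u m \<longleftrightarrow> 1 \<le> m \<and> u 0 = 0 \<and> u m = 1 \<and> (\<forall>i<m. u i < u (Suc i))"

definition past_sigma :: "'a measure \<Rightarrow> (int \<Rightarrow> 'a \<Rightarrow> real) \<Rightarrow> int \<Rightarrow> 'a measure" where
  "past_sigma M \<epsilon> t = sigma (space M)
     (\<Union>s\<in>{..t}. {\<epsilon> s -` B \<inter> space M | B. B \<in> sets borel})"

definition small_oP :: "'a measure \<Rightarrow> (nat \<Rightarrow> 'a \<Rightarrow> real) \<Rightarrow> (nat \<Rightarrow> real) \<Rightarrow> bool" where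
  "small_oP M S r \<longleftrightarrow> (\<forall>e>0. (\<lambda>n. measure M {\<omega> \<in> space M. e * r n < \<bar>S n \<omega>\<bar>}) \<longlonglongrightarrow> 0)"

end

theory Submission
  imports Defs
begin

text \<open>
  Up to negligible terms, the summand of \<open>Q\<^sub>n\<close> is \<open>Z\<^sub>t = (Df(\<mu>) \<bullet> S\<^sub>t)\<^sup>2 / b\<close> with a deterministic direction and
  the centered block sum \<open>S\<^sub>t\<close>. Replacing all innovations before some time by an independent copy changes
  a kernel by a geometrically small amount in \<open>L\<^sub>q\<close>; this gives geometric decay of covariances, and
  \<open>Var (\<Sum> Z\<^sub>t) = O(n b\<^sup>3)\<close> already from the trivial bound \<open>\<parallel>S\<^sub>t\<parallel>\<^sub>4 = O(b)\<close>, so that \<open>b\<^sup>3 / n \<rightarrow> 0\<close> yields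
  a law of large numbers without any moment inequality for sums.
  The expectations \<open>E Z\<^sub>t\<close> at \<open>t = \<lfloor>nv\<rfloor>\<close> converge at every continuity point \<open>v\<close> of \<open>G\<close> in \<open>L\<^sub>q\<close>, that is, for all but
  countably many \<open>v\<close> because the \<open>p\<close>-variation is finite, and dominated convergence gives their average.
  The pilot estimator only sees the past of the block, so the error in the direction is essentially independent
  of \<open>S\<^sub>t\<close>; the drift of the mean over a block is controlled by the \<open>p\<close>-variation. Uniformity in \<open>u\<close> follows from
  monotonicity of \<open>Q\<^sub>n\<close> and continuity of \<open>Q\<close>.
\<close>

section \<open>Moment bounds in terms of \<open>Lq_le\<close>\<close>

text \<open>Four quantities must vanish: b^3/n for the variance, b/n^\<kappa> for centering at the
  pilot value, b((L+b)/n)^(2/max(p,2)) for the drift of the mean, and 1/b for edge effects of a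
  block. The exponent 2/(3 max(p,2)) is at most 1/3, which settles the first; it is also at most
  1/max(p,2), and L and b are o(n^(1/2)), which settles the third. The second holds because
  (\<kappa> q - 2)/(q + 2) is at most \<kappa>. The obstacle in the pilot step is that the direction
  error W is random and converges only in probability. Hoelder's inequality with the trivial fourth
  moment of the block sum S would lose a factor b. After decoupling, the mean of (W . S)^2/b is of
  the order of the mean of |W|^2 plus 1/b, and cutting W off outside the neighbourhood of the convex
  hull turns convergence in probability into convergence of means. Cross terms are never estimated:
  (x+y)^2 - x^2 is bounded by \<theta> x^2 + (1 + 1/\<theta>) y^2 with a small fixed \<theta>, so
  that only averages of squares occur.\<close>

lemma Lq_le_nonneg: "Lq_le M q X a \<Longrightarrow> 0 \<le> a"
  by (simp add: Lq_le_def)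

lemma Lq_le_weaken:
  assumes "Lq_le M q X a" "a \<le> b" "0 \<le> q"
  shows "Lq_le M q X b"
proof -
  have "0 \<le> a" and m: "Lq_moment M q X \<le> ennreal (a powr q)"
    using assms(1) by (auto simp: Lq_le_def)
  moreover have "a powr q \<le> b powr q"
    using assms \<open>0 \<le> a\<close> by (intro powr_mono2) auto
  ultimately show ?thesis
    using assms(2) by (auto simp: Lq_le_def intro: order_trans ennreal_leI)
qed

lemma Lq_le_dominated:
  assumes "Lq_le M q Y a" "AE \<omega> in M. norm (X \<omega>) \<le> norm (Y \<omega>)" "0 \<le> q"
  shows "Lq_le M q X a"
proof -
  have "Lq_moment M q X \<le> Lq_moment M q Y"
    unfolding Lq_moment_def
    using assms(2) by (intro nn_integral_mono_AE) (auto intro!: ennreal_leI powr_mono2 assms(3))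
  then show ?thesis
    using assms(1) by (auto simp: Lq_le_def)
qed

text \<open>Several inequalities below divide by the bounds and are therefore proved for strictly
  positive ones; letting the slack tend to zero removes that restriction. Limits of kernels are
  handled in the same way.\<close>

lemma Lq_le_closed:
  assumes "\<And>e. e > 0 \<Longrightarrow> Lq_le M q X (a + e)" "0 \<le> a" "0 < q"
  shows "Lq_le M q X a"
proof -
  have "(\<lambda>n. ennreal ((a + 1 / real (Suc n)) powr q)) \<longlonglongrightarrow> ennreal ((a + 0) powr q)"
    by (intro tendsto_ennrealI tendsto_powr2 tendsto_intros LIMSEQ_Suc[OF lim_1_over_n])
       (use assms in auto)
  moreover have "Lq_moment M q X \<le> ennreal ((a + 1 / real (Suc n)) powr q)" for n
    using assms(1)[of "1 / real (Suc n)"] by (auto simp: Lq_le_def)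
  ultimately have "Lq_moment M q X \<le> ennreal ((a + 0) powr q)"
    by (intro LIMSEQ_le_const[where X = "\<lambda>n. ennreal ((a + 1 / real (Suc n)) powr q)"]) blast+
  then show ?thesis
    using assms by (auto simp: Lq_le_def)
qed

text \<open>For positive arguments this is convexity on the open half-line. If one argument is zero,
  the claim reduces to \<open>r powr q \<le> r\<close> for \<open>r\<close> between 0 and 1.\<close>

lemma convex_on_powr:
  assumes q: "1 \<le> (q::real)"
  shows "convex_on {0..} (\<lambda>x. x powr q)"
proof (rule convex_onI)
  fix s x y :: real assume s: "0 < s" "s < 1" and xy: "x \<in> {0..}" "y \<in> {0..}"
  have *: "(r * z) powr q \<le> r * z powr q" if "0 < r" "r < 1" "0 \<le> z" for r z
  proof -
    have "r powr q \<le> r powr 1" using that q by (intro powr_mono') auto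
    then show ?thesis using that by (simp add: powr_mult mult_right_mono)
  qed
  show "((1 - s) *\<^sub>R x + s *\<^sub>R y) powr q \<le> (1 - s) * x powr q + s * y powr q"
  proof (cases "x = 0 \<or> y = 0")
    case True
    then show ?thesis using *[of s y] *[of "1 - s" x] s xy q by auto
  next
    case False
    then show ?thesis using convex_onD[OF powr_convex[OF q], of s x y] s xy by auto
  qed
qed simp

text \<open>Minkowski's inequality from convexity: the norm of the sum is at most
  \<open>a + b\<close> times a convex combination of \<open>norm (X \<omega>) / a\<close> and
  \<open>norm (Y \<omega>) / b\<close>, with weights proportional to the two bounds.\<close>

lemma Lq_le_add_pos:
  fixes X Y :: "'a \<Rightarrow> 'b::{real_normed_vector,second_countable_topology}"
  assumes X: "Lq_le M q X a" and Y: "Lq_le M q Y b" and q: "1 \<le> q" and pos: "0 < a" "0 < b"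
    and [measurable]: "X \<in> borel_measurable M" "Y \<in> borel_measurable M"
  shows "Lq_le M q (\<lambda>\<omega>. X \<omega> + Y \<omega>) (a + b)"
proof -
  define s where "s = a / (a + b)"
  have s: "0 \<le> s" "s \<le> 1" "s * (a + b) = a" "(1 - s) * (a + b) = b"
    using pos by (auto simp: s_def field_simps)
  have conv: "convex_on {0..} (\<lambda>x::real. x powr q)"
    using convex_on_powr[OF q] .
  define c where "c = (a + b) powr q"
  have c0: "0 \<le> c" by (simp add: c_def)
  have pw: "norm (X \<omega> + Y \<omega>) powr q
      \<le> c * (s / a powr q) * norm (X \<omega>) powr q + c * ((1 - s) / b powr q) * norm (Y \<omega>) powr q" for \<omega>
  proof -
    let ?x = "norm (X \<omega>) / a" and ?y = "norm (Y \<omega>) / b"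
    have eq: "(a + b) * (s * ?x + (1 - s) * ?y) = norm (X \<omega>) + norm (Y \<omega>)"
    proof -
      have "(a + b) * (s * x + (1 - s) * y) = (s * (a + b)) * x + ((1 - s) * (a + b)) * y" for x y
        by (simp add: algebra_simps)
      from this[of ?x ?y] show ?thesis
        unfolding s(3,4) using pos by simp
    qed
    have "norm (X \<omega> + Y \<omega>) powr q \<le> ((a + b) * (s * ?x + (1 - s) * ?y)) powr q"
      unfolding eq using q by (intro powr_mono2 norm_triangle_ineq) auto
    also have "\<dots> = c * (s * ?x + (1 - s) * ?y) powr q"
      using pos s by (simp add: powr_mult c_def)
    also have "\<dots> \<le> c * (s * ?x powr q + (1 - s) * ?y powr q)"
      using convex_onD[OF conv, of "1 - s" ?x ?y] s pos c0
      by (intro mult_left_mono) auto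
    also have "\<dots> = c * (s / a powr q) * norm (X \<omega>) powr q + c * ((1 - s) / b powr q) * norm (Y \<omega>) powr q"
      using pos by (simp add: powr_divide algebra_simps)
    finally show ?thesis .
  qed
  have "Lq_moment M q (\<lambda>\<omega>. X \<omega> + Y \<omega>)
      \<le> (\<integral>\<^sup>+ \<omega>. ennreal (c * (s / a powr q)) * ennreal (norm (X \<omega>) powr q)
              + ennreal (c * ((1 - s) / b powr q)) * ennreal (norm (Y \<omega>) powr q) \<partial>M)"
    unfolding Lq_moment_def
    using pw s c0 by (intro nn_integral_mono) (simp flip: ennreal_plus ennreal_mult)
  also have "\<dots> = ennreal (c * (s / a powr q)) * Lq_moment M q X
      + ennreal (c * ((1 - s) / b powr q)) * Lq_moment M q Y"
    unfolding Lq_moment_def by (simp add: nn_integral_add nn_integral_cmult)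
  also have "\<dots> \<le> ennreal (c * (s / a powr q)) * ennreal (a powr q)
      + ennreal (c * ((1 - s) / b powr q)) * ennreal (b powr q)"
    using X Y by (intro add_mono mult_left_mono) (auto simp: Lq_le_def)
  also have "\<dots> = ennreal (c * s + c * (1 - s))"
    using pos s c0 by (simp flip: ennreal_plus ennreal_mult)
  also have "\<dots> = ennreal ((a + b) powr q)"
    by (simp add: c_def algebra_simps)
  finally show ?thesis
    using pos by (simp add: Lq_le_def)
qed

lemma Lq_le_add:
  fixes X Y :: "'a \<Rightarrow> 'b::{real_normed_vector,second_countable_topology}"
  assumes X: "Lq_le M q X a" and Y: "Lq_le M q Y b" and q: "1 \<le> q"
    and [measurable]: "X \<in> borel_measurable M" "Y \<in> borel_measurable M"
  shows "Lq_le M q (\<lambda>\<omega>. X \<omega> + Y \<omega>) (a + b)"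
proof (rule Lq_le_closed)
  fix e :: real assume e: "e > 0"
  have "Lq_le M q (\<lambda>\<omega>. X \<omega> + Y \<omega>) ((a + e / 2) + (b + e / 2))"
    using Lq_le_nonneg[OF X] Lq_le_nonneg[OF Y] q e
    by (intro Lq_le_add_pos Lq_le_weaken[OF X] Lq_le_weaken[OF Y]) auto
  then show "Lq_le M q (\<lambda>\<omega>. X \<omega> + Y \<omega>) (a + b + e)"
    by (simp add: algebra_simps)
qed (use q Lq_le_nonneg[OF X] Lq_le_nonneg[OF Y] in auto)

lemma Lq_le_uminus: "Lq_le M q X a \<Longrightarrow> Lq_le M q (\<lambda>\<omega>. - X \<omega>) a"
  by (simp add: Lq_le_def Lq_moment_def)

lemma Lq_le_diff:
  fixes X Y :: "'a \<Rightarrow> 'b::{real_normed_vector,second_countable_topology}"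
  assumes X: "Lq_le M q X a" and Y: "Lq_le M q Y b" and q: "1 \<le> q"
    and [measurable]: "X \<in> borel_measurable M" "Y \<in> borel_measurable M"
  shows "Lq_le M q (\<lambda>\<omega>. X \<omega> - Y \<omega>) (a + b)"
  using Lq_le_add[OF X Lq_le_uminus[OF Y] q] by simp

lemma Lq_le_zero: "0 < q \<Longrightarrow> Lq_le M q (\<lambda>_. 0) 0"
  by (simp add: Lq_le_def Lq_moment_def)

lemma Lq_le_sum:
  fixes X :: "'i \<Rightarrow> 'a \<Rightarrow> 'b::{real_normed_vector,second_countable_topology}"
  assumes "finite I" "\<And>i. i \<in> I \<Longrightarrow> Lq_le M q (X i) (a i)" "1 \<le> q"
    and "\<And>i. i \<in> I \<Longrightarrow> X i \<in> borel_measurable M"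
  shows "Lq_le M q (\<lambda>\<omega>. \<Sum>i\<in>I. X i \<omega>) (\<Sum>i\<in>I. a i)"
  using assms
proof (induction I rule: finite_induct)
  case empty
  then show ?case by (simp add: Lq_le_zero)
next
  case (insert x F)
  then show ?case by (simp add: Lq_le_add)
qed

lemma Lq_le_linear_bound:
  assumes X: "Lq_le M q X a" and "0 \<le> K" "0 < q"
    and [measurable]: "X \<in> borel_measurable M"
    and "AE \<omega> in M. norm (Y \<omega>) \<le> K * norm (X \<omega>)"
  shows "Lq_le M q Y (K * a)"
proof -
  have "Lq_moment M q Y \<le> (\<integral>\<^sup>+ \<omega>. ennreal (K powr q) * ennreal (norm (X \<omega>) powr q) \<partial>M)"
    unfolding Lq_moment_def
  proof (rule nn_integral_mono_AE, use assms(5) in eventually_elim)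
    case (elim \<omega>)
    then have "norm (Y \<omega>) powr q \<le> (K * norm (X \<omega>)) powr q"
      using assms by (intro powr_mono2) auto
    then show ?case
      using assms(2) by (simp add: powr_mult flip: ennreal_mult)
  qed
  also have "\<dots> = ennreal (K powr q) * Lq_moment M q X"
    unfolding Lq_moment_def by (simp add: nn_integral_cmult)
  also have "\<dots> \<le> ennreal (K powr q) * ennreal (a powr q)"
    using X by (intro mult_left_mono) (auto simp: Lq_le_def)
  also have "\<dots> = ennreal ((K * a) powr q)"
    using assms(2) Lq_le_nonneg[OF X] by (simp add: powr_mult flip: ennreal_mult)
  finally show ?thesis
    using assms(2) Lq_le_nonneg[OF X] by (simp add: Lq_le_def)
qed

lemma (in prob_space) Lq_le_const: "0 < q \<Longrightarrow> Lq_le M q (\<lambda>_. c) (norm c)"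
  by (simp add: Lq_le_def Lq_moment_def emeasure_space_1)

text \<open>Weighted inequality of arithmetic and geometric means for 1 and
  \<open>(x / c) powr q\<close>, sharp at \<open>x = c\<close>. Being affine in
  \<open>x powr q\<close>, it can be integrated or summed, and a suitable level \<open>c\<close>
  then replaces Jensen's inequality.\<close>

lemma powr_le_Young:
  fixes x :: real
  assumes "0 < c" "0 < r" "r \<le> q" "0 \<le> x"
  shows "x powr r \<le> c powr r * (1 - r / q) + c powr r * (r / q) / c powr q * x powr q"
proof -
  define s where "s = r / q"
  have s: "0 < s" "s \<le> 1" using assms by (auto simp: s_def)
  let ?x = "x / c"
  have "?x powr r \<le> (1 - s) + s * ?x powr q"
  proof (cases "x = 0")
    case False
    then have "?x powr r = 1 powr (1 - s) * (?x powr q) powr s"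
      using assms by (simp add: powr_powr s_def)
    also have "\<dots> \<le> (1 - s) * 1 + s * ?x powr q"
      using s False assms by (intro Youngs_inequality_0) auto
    finally show ?thesis by simp
  qed (use s in simp)
  then have "c powr r * (?x powr r) \<le> c powr r * ((1 - s) + s * ?x powr q)"
    by (intro mult_left_mono) auto
  then show ?thesis
    using assms by (simp add: powr_divide s_def[symmetric] algebra_simps)
qed

text \<open>With the level \<open>c\<close> equal to the bound on the \<open>q\<close>-norm, the two
  terms of \<open>powr_le_Young\<close> integrate to parts of \<open>c powr r\<close> with weights
  \<open>1 - s\<close> and \<open>s\<close>.\<close>

lemma (in prob_space) Lq_le_exponent_mono:
  assumes X: "Lq_le M q X a" and r: "0 < r" "r \<le> q"
    and [measurable]: "X \<in> borel_measurable M"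
  shows "Lq_le M r X a"
proof (rule Lq_le_closed)
  fix e :: real assume e: "e > 0"
  define c where "c = a + e"
  have c: "c > 0" and Xc: "Lq_le M q X c"
    using Lq_le_nonneg[OF X] e r by (auto simp: c_def intro!: Lq_le_weaken[OF X])
  define s where "s = r / q"
  have s: "0 < s" "s \<le> 1" using r by (auto simp: s_def)
  have pw: "norm (X \<omega>) powr r \<le> c powr r * (1 - s) + c powr r * s / c powr q * norm (X \<omega>) powr q" for \<omega>
    unfolding s_def by (rule powr_le_Young[OF c r]) simp
  have "Lq_moment M r X \<le> (\<integral>\<^sup>+ \<omega>. ennreal (c powr r * (1 - s))
      + ennreal (c powr r * s / c powr q) * ennreal (norm (X \<omega>) powr q) \<partial>M)"
    unfolding Lq_moment_def
    using pw s by (intro nn_integral_mono) (simp flip: ennreal_plus ennreal_mult)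
  also have "\<dots> = ennreal (c powr r * (1 - s)) + ennreal (c powr r * s / c powr q) * Lq_moment M q X"
    unfolding Lq_moment_def by (simp add: nn_integral_add nn_integral_cmult emeasure_space_1)
  also have "\<dots> \<le> ennreal (c powr r * (1 - s)) + ennreal (c powr r * s / c powr q) * ennreal (c powr q)"
    using Xc by (intro add_mono mult_left_mono) (auto simp: Lq_le_def)
  also have "\<dots> = ennreal (c powr r * (1 - s) + c powr r * s)"
    using c s by (simp flip: ennreal_plus ennreal_mult)
  also have "\<dots> = ennreal (c powr r)"
    by (simp add: algebra_simps)
  finally show "Lq_le M r X (a + e)"
    using c by (simp add: Lq_le_def c_def)
qed (use r Lq_le_nonneg[OF X] in auto)

text \<open>Cauchy-Schwarz by integrating 2xy \<le> x^2 + y^2 for the factors normalised by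
  \<open>a\<close> and \<open>b\<close>; each square contributes one half of
  \<open>(a * b) powr q\<close>.\<close>

lemma Lq_le_mult_pos:
  fixes X Y :: "'a \<Rightarrow> real"
  assumes X: "Lq_le M (2 * q) X a" and Y: "Lq_le M (2 * q) Y b" and q: "0 < q" and pos: "0 < a" "0 < b"
    and [measurable]: "X \<in> borel_measurable M" "Y \<in> borel_measurable M"
  shows "Lq_le M q (\<lambda>\<omega>. X \<omega> * Y \<omega>) (a * b)"
proof -
  define c where "c = (a * b) powr q / 2"
  have c: "0 \<le> c" by (simp add: c_def)
  have pw: "norm (X \<omega> * Y \<omega>) powr q \<le> (c / a powr (2 * q)) * norm (X \<omega>) powr (2 * q)
      + (c / b powr (2 * q)) * norm (Y \<omega>) powr (2 * q)" for \<omega>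
  proof -
    define x where "x = (\<bar>X \<omega>\<bar> / a) powr q"
    define y where "y = (\<bar>Y \<omega>\<bar> / b) powr q"
    have 0: "0 \<le> (x - y)\<^sup>2" by simp
    have sq: "z powr (2 * q) = (z powr q)\<^sup>2" if "0 \<le> z" for z :: real
      using that by (cases "z = 0") (auto simp: powr_powr power2_eq_square simp flip: powr_add)
    have "norm (X \<omega> * Y \<omega>) powr q = (a * b) powr q * (x * y)"
      using pos by (simp add: x_def y_def abs_mult powr_mult powr_divide field_simps)
    also have "\<dots> \<le> (a * b) powr q * ((x\<^sup>2 + y\<^sup>2) / 2)"
      using 0 by (intro mult_left_mono) (auto simp: power2_eq_square algebra_simps)
    also have "\<dots> = c * x\<^sup>2 + c * y\<^sup>2"
      by (simp add: c_def field_simps)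
    also have "x\<^sup>2 = \<bar>X \<omega>\<bar> powr (2 * q) / a powr (2 * q)"
      using pos by (simp add: x_def powr_divide power_divide sq)
    also have "y\<^sup>2 = \<bar>Y \<omega>\<bar> powr (2 * q) / b powr (2 * q)"
      using pos by (simp add: y_def powr_divide power_divide sq)
    finally show ?thesis by simp
  qed
  have "Lq_moment M q (\<lambda>\<omega>. X \<omega> * Y \<omega>)
      \<le> (\<integral>\<^sup>+ \<omega>. ennreal (c / a powr (2 * q)) * ennreal (norm (X \<omega>) powr (2 * q))
              + ennreal (c / b powr (2 * q)) * ennreal (norm (Y \<omega>) powr (2 * q)) \<partial>M)"
    unfolding Lq_moment_def
    using pw c by (intro nn_integral_mono) (simp flip: ennreal_plus ennreal_mult)
  also have "\<dots> = ennreal (c / a powr (2 * q)) * Lq_moment M (2 * q) X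
      + ennreal (c / b powr (2 * q)) * Lq_moment M (2 * q) Y"
    unfolding Lq_moment_def by (simp add: nn_integral_add nn_integral_cmult)
  also have "\<dots> \<le> ennreal (c / a powr (2 * q)) * ennreal (a powr (2 * q))
      + ennreal (c / b powr (2 * q)) * ennreal (b powr (2 * q))"
    using X Y by (intro add_mono mult_left_mono) (auto simp: Lq_le_def)
  also have "\<dots> = ennreal (c + c)"
    using pos c by (simp flip: ennreal_plus ennreal_mult)
  also have "\<dots> = ennreal ((a * b) powr q)"
    by (simp add: c_def)
  finally show ?thesis
    using pos by (simp add: Lq_le_def)
qed

lemma Lq_le_mult:
  fixes X Y :: "'a \<Rightarrow> real"
  assumes X: "Lq_le M (2 * q) X a" and Y: "Lq_le M (2 * q) Y b" and q: "0 < q"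
    and [measurable]: "X \<in> borel_measurable M" "Y \<in> borel_measurable M"
  shows "Lq_le M q (\<lambda>\<omega>. X \<omega> * Y \<omega>) (a * b)"
proof (rule Lq_le_closed)
  fix e :: real assume e: "e > 0"
  have ab: "0 \<le> a" "0 \<le> b"
    using Lq_le_nonneg[OF X] Lq_le_nonneg[OF Y] by auto
  \<comment> \<open>The excess of \<open>(a + d) * (b + d)\<close> over \<open>a * b\<close> is
    \<open>d * (a + b + d)\<close>, which is at most \<open>e\<close> because
    \<open>d \<le> 1\<close>.\<close>
  define d where "d = min 1 (e / (a + b + 1))"
  have d: "0 < d" "d \<le> 1" "d * (a + b + 1) \<le> e"
  proof -
    have "d * (a + b + 1) \<le> (e / (a + b + 1)) * (a + b + 1)"
      using ab by (intro mult_right_mono) (auto simp: d_def)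
    then show "d * (a + b + 1) \<le> e" using ab by simp
  qed (use e ab in \<open>auto simp: d_def\<close>)
  have "Lq_le M q (\<lambda>\<omega>. X \<omega> * Y \<omega>) ((a + d) * (b + d))"
    using ab q d by (intro Lq_le_mult_pos Lq_le_weaken[OF X] Lq_le_weaken[OF Y]) auto
  moreover have "(a + d) * (b + d) \<le> a * b + e"
  proof -
    have "(a + d) * (b + d) = a * b + d * (a + b + d)"
      by (simp add: algebra_simps)
    also have "d * (a + b + d) \<le> d * (a + b + 1)"
      using d by (intro mult_left_mono) auto
    finally show ?thesis using d by linarith
  qed
  ultimately show "Lq_le M q (\<lambda>\<omega>. X \<omega> * Y \<omega>) (a * b + e)"
    using q by (auto intro: Lq_le_weaken)
qed (use q Lq_le_nonneg[OF X] Lq_le_nonneg[OF Y] in auto)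

section \<open>Expectations, second moments, the norm itself, and limits\<close>

lemma Lq_le_1_expectation:
  fixes X :: "'a \<Rightarrow> 'b::{banach, second_countable_topology}"
  assumes "Lq_le M 1 X a" and [measurable]: "X \<in> borel_measurable M"
  shows "integrable M X" "norm (integral\<^sup>L M X) \<le> a" "(\<integral>\<omega>. norm (X \<omega>) \<partial>M) \<le> a"
proof -
  have a: "0 \<le> a" and le: "(\<integral>\<^sup>+ \<omega>. ennreal (norm (X \<omega>)) \<partial>M) \<le> ennreal a"
    using assms by (auto simp: Lq_le_def Lq_moment_def)
  show int: "integrable M X"
    using le by (auto simp: integrable_iff_bounded top_unique less_top[symmetric])
  have "ennreal (\<integral>\<omega>. norm (X \<omega>) \<partial>M) = (\<integral>\<^sup>+ \<omega>. ennreal (norm (X \<omega>)) \<partial>M)"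
    using int by (intro nn_integral_eq_integral[symmetric]) auto
  then show le': "(\<integral>\<omega>. norm (X \<omega>) \<partial>M) \<le> a"
    using le a by (metis ennreal_le_iff)
  then show "norm (integral\<^sup>L M X) \<le> a"
    using integral_norm_bound[of M X] by linarith
qed

lemma Lq_le_2_square:
  fixes X :: "'a \<Rightarrow> 'b::{banach, second_countable_topology}"
  assumes "Lq_le M 2 X a" and [measurable]: "X \<in> borel_measurable M"
  shows "integrable M (\<lambda>\<omega>. (norm (X \<omega>))\<^sup>2)" "(\<integral>\<omega>. (norm (X \<omega>))\<^sup>2 \<partial>M) \<le> a\<^sup>2"
proof -
  have "Lq_le M 1 (\<lambda>\<omega>. (norm (X \<omega>))\<^sup>2) (a\<^sup>2)"
    using assms(1) powr_numeral[OF Lq_le_nonneg[OF assms(1)], of "num.Bit0 num.One"]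
    by (simp add: Lq_le_def Lq_moment_def)
  from Lq_le_1_expectation(1,3)[OF this]
  show "integrable M (\<lambda>\<omega>. (norm (X \<omega>))\<^sup>2)" "(\<integral>\<omega>. (norm (X \<omega>))\<^sup>2 \<partial>M) \<le> a\<^sup>2"
    by auto
qed

lemma Lq_le_2_I:
  fixes X :: "'a \<Rightarrow> 'b::{banach, second_countable_topology}"
  assumes "integrable M (\<lambda>\<omega>. (norm (X \<omega>))\<^sup>2)" "(\<integral>\<omega>. (norm (X \<omega>))\<^sup>2 \<partial>M) \<le> a\<^sup>2" "0 \<le> a"
  shows "Lq_le M 2 X a"
  using assms by (simp add: Lq_le_def Lq_moment_def nn_integral_eq_integral)

lemma (in prob_space) Lq_le_expectation:
  fixes X :: "'a \<Rightarrow> 'b::{banach, second_countable_topology}"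
  assumes "Lq_le M q X a" "1 \<le> q" and [measurable]: "X \<in> borel_measurable M"
  shows "integrable M X" "norm (expectation X) \<le> a"
  using Lq_le_1_expectation[OF Lq_le_exponent_mono[of q X a 1]] assms by auto

lemma (in prob_space) Lq_le_centered:
  fixes X :: "'a \<Rightarrow> 'b::{banach, second_countable_topology}"
  assumes X: "Lq_le M q X a" "1 \<le> q" and [measurable]: "X \<in> borel_measurable M"
  shows "Lq_le M q (\<lambda>\<omega>. X \<omega> - expectation X) (2 * a)"
proof -
  have "Lq_le M q (\<lambda>_. expectation X) a"
    using Lq_le_expectation(2)[OF assms] X by (intro Lq_le_weaken[OF Lq_le_const]) auto
  from Lq_le_diff[OF X(1) this X(2)] show ?thesis by simp
qed

text \<open>Finiteness matters: \<open>enn2real\<close> sends an infinite moment to 0, and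
  \<open>Lq_norm\<close> would then bound nothing.\<close>

lemma Lq_le_Lq_norm:
  assumes "Lq_moment M q X < \<infinity>" "0 < q"
  shows "Lq_le M q X (Lq_norm M q X)"
  using assms by (simp add: Lq_le_def Lq_norm_def powr_powr)

lemma Lq_norm_le:
  assumes "Lq_le M q X a" "0 < q"
  shows "Lq_norm M q X \<le> a"
proof -
  have "enn2real (Lq_moment M q X) \<le> a powr q"
    using assms by (intro enn2real_leI) (auto simp: Lq_le_def)
  then have "Lq_norm M q X \<le> (a powr q) powr (1 / q)"
    unfolding Lq_norm_def using assms by (intro powr_mono2) auto
  then show ?thesis
    using assms Lq_le_nonneg[OF assms(1)] by (simp add: powr_powr)
qed

lemma Lq_le_finite: "Lq_le M q X a \<Longrightarrow> Lq_moment M q X < \<infinity>"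
  by (auto simp: Lq_le_def intro: le_less_trans)

lemma Lq_le_Fatou:
  fixes X :: "nat \<Rightarrow> 'a \<Rightarrow> 'b::{real_normed_vector,second_countable_topology}"
  assumes X: "\<And>n. Lq_le M q (X n) a" and "0 < q"
    and [measurable]: "\<And>n. X n \<in> borel_measurable M"
    and conv: "AE \<omega> in M. (\<lambda>n. X n \<omega>) \<longlonglongrightarrow> Y \<omega>"
  shows "Lq_le M q Y a"
proof -
  have "Lq_moment M q Y \<le> (\<integral>\<^sup>+ \<omega>. liminf (\<lambda>n. ennreal (norm (X n \<omega>) powr q)) \<partial>M)"
    unfolding Lq_moment_def
  proof (rule nn_integral_mono_AE, use conv in eventually_elim)
    case (elim \<omega>)
    then have "(\<lambda>n. ennreal (norm (X n \<omega>) powr q)) \<longlonglongrightarrow> ennreal (norm (Y \<omega>) powr q)"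
      using assms(2) by (intro tendsto_ennrealI tendsto_powr2 tendsto_norm) auto
    then show ?case
      by (metis lim_imp_Liminf order_refl trivial_limit_sequentially)
  qed
  also have "\<dots> \<le> liminf (\<lambda>n. \<integral>\<^sup>+ \<omega>. ennreal (norm (X n \<omega>) powr q) \<partial>M)"
    by (intro nn_integral_liminf) measurable
  also have "\<dots> \<le> liminf (\<lambda>n. ennreal (a powr q))"
    using X by (intro Liminf_mono) (auto simp: Lq_le_def Lq_moment_def)
  also have "\<dots> = ennreal (a powr q)"
    by (simp add: Liminf_const)
  finally show ?thesis
    using X[of 0] by (simp add: Lq_le_def)
qed

section \<open>Innovations and coupling\<close>

text \<open>The index type is arbitrary so that the innovations and their copy form a single family
  over \<open>int + int\<close>, with \<open>Inl\<close> for the originals and \<open>Inr\<close>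
  for the copy.\<close>

definition innov_sigma :: "'a measure \<Rightarrow> ('i \<Rightarrow> 'a \<Rightarrow> real) \<Rightarrow> 'i set \<Rightarrow> 'a measure" where
  "innov_sigma M e I = sigma (space M) (\<Union>i\<in>I. {e i -` B \<inter> space M | B. B \<in> sets borel})"

lemma space_innov_sigma[simp]: "space (innov_sigma M e I) = space M"
  by (simp add: innov_sigma_def space_measure_of_conv)

lemma sets_innov_sigma:
  "sets (innov_sigma M e I) = sigma_sets (space M) (\<Union>i\<in>I. {e i -` B \<inter> space M | B. B \<in> sets borel})"
  unfolding innov_sigma_def by (rule sets_measure_of) auto

lemma innov_sigma_mono: "I \<subseteq> J \<Longrightarrow> sets (innov_sigma M e I) \<subseteq> sets (innov_sigma M e J)"
  unfolding sets_innov_sigma by (rule sigma_sets_mono') blast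

lemma measurable_innov_sigma: "i \<in> I \<Longrightarrow> e i \<in> borel_measurable (innov_sigma M e I)"
  by (rule measurableI) (auto simp: sets_innov_sigma intro!: sigma_sets.Basic)

lemma past_sigma_eq: "past_sigma M \<epsilon> t = innov_sigma M (case_sum \<epsilon> \<epsilon>s) (Inl ` {..t})"
  by (simp add: past_sigma_def innov_sigma_def)

text \<open>Coordinate \<open>k\<close> belongs to time \<open>t - k\<close>, so everything at time
  \<open>t - m\<close> and earlier comes from the copy. A kernel evaluated here keeps its law but is
  independent of the original innovations up to time \<open>t - m\<close>.\<close>

definition eps_cpl :: "(int \<Rightarrow> 'a \<Rightarrow> real) \<Rightarrow> (int \<Rightarrow> 'a \<Rightarrow> real) \<Rightarrow> int \<Rightarrow> nat \<Rightarrow> 'a \<Rightarrow> (nat \<Rightarrow> real)" where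
  "eps_cpl \<epsilon> \<epsilon>s t m \<omega> = (\<lambda>k. if k < m then \<epsilon> (t - int k) \<omega> else \<epsilon>s (t - int k) \<omega>)"

text \<open>Finite stages between \<open>eps_seq\<close>, which is the case \<open>r = 0\<close>,
  and \<open>eps_cpl\<close>, which is approached as \<open>r\<close> grows. The assumption on
  single replacements reaches only these stages directly.\<close>

definition eps_mid :: "(int \<Rightarrow> 'a \<Rightarrow> real) \<Rightarrow> (int \<Rightarrow> 'a \<Rightarrow> real) \<Rightarrow> int \<Rightarrow> nat \<Rightarrow> nat \<Rightarrow> 'a \<Rightarrow> (nat \<Rightarrow> real)" where
  "eps_mid \<epsilon> \<epsilon>s t m r \<omega> = (\<lambda>k. if m \<le> k \<and> k < m + r then \<epsilon>s (t - int k) \<omega> else \<epsilon> (t - int k) \<omega>)"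

locale innovations = prob_space M for M :: "'a measure" +
  fixes \<epsilon> \<epsilon>s :: "int \<Rightarrow> 'a \<Rightarrow> real"
  assumes iid: "indep_vars (\<lambda>_. borel) (case_sum \<epsilon> \<epsilon>s) UNIV"
    and ident: "\<forall>i. distr M borel (\<epsilon> i) = distr M borel (\<epsilon> 0) \<and> distr M borel (\<epsilon>s i) = distr M borel (\<epsilon> 0)"
begin

abbreviation "e \<equiv> case_sum \<epsilon> \<epsilon>s"
abbreviation "\<nu> \<equiv> distr M borel (\<epsilon> 0)"
abbreviation "seqM \<equiv> (\<Pi>\<^sub>M k\<in>(UNIV::nat set). (borel :: real measure))"

lemma e_measurable[measurable]: "e i \<in> borel_measurable M"
  using iid by (auto simp: indep_vars_def2)

lemma eps_measurable[measurable]: "\<epsilon> i \<in> borel_measurable M" "\<epsilon>s i \<in> borel_measurable M"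
  using e_measurable[of "Inl i"] e_measurable[of "Inr i"] by auto

lemma distr_e: "distr M borel (e i) = \<nu>"
  using ident by (cases i) auto

lemma prob_space_\<nu>: "prob_space \<nu>"
  by (rule prob_space_distr) simp

text \<open>The common source of all equalities in law below: time shifts, replacement by the copy,
  and exchange of the two families are injective relabellings of one i.i.d. family.\<close>

lemma law_reindex:
  fixes \<sigma> :: "'k \<Rightarrow> int + int"
  assumes "inj \<sigma>"
  shows "distr M (\<Pi>\<^sub>M k\<in>UNIV. borel) (\<lambda>\<omega> k. e (\<sigma> k) \<omega>) = (\<Pi>\<^sub>M k\<in>UNIV. \<nu>)"
proof -
  have 1: "distr M (\<Pi>\<^sub>M k\<in>UNIV. borel) (\<lambda>\<omega> k. e k \<omega>) = (\<Pi>\<^sub>M k\<in>UNIV. \<nu>)"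
    using indep_vars_iff_distr_eq_PiM[of UNIV e "\<lambda>_. borel"] iid by (simp add: distr_e restrict_UNIV)
  have s: "sets (\<Pi>\<^sub>M k\<in>(UNIV::'i set). \<nu>) = sets (\<Pi>\<^sub>M k\<in>UNIV. borel)"
    by (rule sets_PiM_cong) auto
  have "distr M (\<Pi>\<^sub>M k\<in>UNIV. borel) (\<lambda>\<omega> k. e (\<sigma> k) \<omega>)
     = distr (distr M (\<Pi>\<^sub>M k\<in>UNIV. borel) (\<lambda>\<omega> k. e k \<omega>)) (\<Pi>\<^sub>M k\<in>UNIV. borel) (\<lambda>w k. w (\<sigma> k))"
    by (subst distr_distr)
       (auto simp: comp_def intro!: measurable_PiM_single' measurable_component_singleton)
  also have "\<dots> = distr (\<Pi>\<^sub>M k\<in>UNIV. \<nu>) (\<Pi>\<^sub>M k\<in>UNIV. \<nu>) (\<lambda>w. \<lambda>k\<in>UNIV. w (\<sigma> k))"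
    unfolding 1 by (rule distr_cong) (auto simp: s[symmetric])
  also have "\<dots> = (\<Pi>\<^sub>M k\<in>UNIV. \<nu>)"
    by (rule distr_PiM_reindex) (use assms prob_space_\<nu> in auto)
  finally show ?thesis .
qed

lemma env_measurable[measurable]:
  "(\<lambda>\<omega> k. e (\<sigma> k) \<omega>) \<in> measurable M (\<Pi>\<^sub>M k\<in>UNIV. borel)"
  by (intro measurable_PiM_single') auto

lemma distr_reindex_eq:
  fixes \<sigma> \<sigma>' :: "'k \<Rightarrow> int + int"
  assumes "inj \<sigma>" "inj \<sigma>'" and [measurable]: "h \<in> borel_measurable (\<Pi>\<^sub>M k\<in>UNIV. borel)"
  shows "distr M borel (\<lambda>\<omega>. h (\<lambda>k. e (\<sigma> k) \<omega>)) = distr M borel (\<lambda>\<omega>. h (\<lambda>k. e (\<sigma>' k) \<omega>))"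
proof -
  have "distr M borel (\<lambda>\<omega>. h (\<lambda>k. e (\<sigma> k) \<omega>))
     = distr (distr M (\<Pi>\<^sub>M k\<in>UNIV. borel) (\<lambda>\<omega> k. e (\<sigma> k) \<omega>)) borel h" if "inj \<sigma>" for \<sigma> :: "'k \<Rightarrow> int + int"
    by (subst distr_distr) (auto simp: comp_def)
  then show ?thesis
    using assms by (simp add: law_reindex)
qed

lemma Lq_le_distr_eq:
  fixes X Y :: "'a \<Rightarrow> 'b::{real_normed_vector,second_countable_topology}"
  assumes "distr M borel X = distr M borel Y"
    and [measurable]: "X \<in> borel_measurable M" "Y \<in> borel_measurable M"
  shows "Lq_le M q X a \<longleftrightarrow> Lq_le M q Y a"
proof -
  have "Lq_moment M q Z = (\<integral>\<^sup>+ z. ennreal (norm z powr q) \<partial>distr M borel Z)"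
    if [measurable]: "Z \<in> borel_measurable M" for Z :: "'a \<Rightarrow> 'b"
    unfolding Lq_moment_def by (subst nn_integral_distr) auto
  then show ?thesis
    using assms by (simp add: Lq_le_def)
qed

lemma integral_distr_eq:
  fixes X Y :: "'a \<Rightarrow> 'b::{banach,second_countable_topology}"
  assumes "distr M borel X = distr M borel Y"
    and [measurable]: "X \<in> borel_measurable M" "Y \<in> borel_measurable M"
  shows "expectation X = expectation Y"
proof -
  have "expectation Z = (\<integral> z. z \<partial>distr M borel Z)"
    if [measurable]: "Z \<in> borel_measurable M" for Z :: "'a \<Rightarrow> 'b"
    by (subst integral_distr) auto
  then show ?thesis
    using assms by simp
qed

lemma eps_seq_eq: "eps_seq \<epsilon> t \<omega> = (\<lambda>k. e (Inl (t - int k)) \<omega>)"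
  by (simp add: eps_seq_def)

lemma eps_cpl_eq: "eps_cpl \<epsilon> \<epsilon>s t m \<omega> = (\<lambda>k. e (if k < m then Inl (t - int k) else Inr (t - int k)) \<omega>)"
  by (auto simp: eps_cpl_def)

lemma eps_mid_eq:
  "eps_mid \<epsilon> \<epsilon>s t m r \<omega> = (\<lambda>k. e (if m \<le> k \<and> k < m + r then Inr (t - int k) else Inl (t - int k)) \<omega>)"
  by (auto simp: eps_mid_def)

lemma eps_seq_measurable[measurable]: "eps_seq \<epsilon> t \<in> measurable M seqM"
  unfolding eps_seq_eq[abs_def] by measurable

lemma eps_cpl_measurable[measurable]: "eps_cpl \<epsilon> \<epsilon>s t m \<in> measurable M seqM"
  unfolding eps_cpl_eq[abs_def] by measurable

lemma eps_mid_measurable[measurable]: "eps_mid \<epsilon> \<epsilon>s t m r \<in> measurable M seqM"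
  unfolding eps_mid_eq[abs_def] by measurable

lemma eps_seq_law: "distr M seqM (eps_seq \<epsilon> t) = (\<Pi>\<^sub>M k\<in>UNIV. \<nu>)"
  unfolding eps_seq_eq[abs_def] by (rule law_reindex) (auto simp: inj_def)

lemma eps_cpl_law: "distr M seqM (eps_cpl \<epsilon> \<epsilon>s t m) = (\<Pi>\<^sub>M k\<in>UNIV. \<nu>)"
  unfolding eps_cpl_eq[abs_def] by (rule law_reindex) (auto simp: inj_def)

lemma eps_mid_law: "distr M seqM (eps_mid \<epsilon> \<epsilon>s t m r) = (\<Pi>\<^sub>M k\<in>UNIV. \<nu>)"
  unfolding eps_mid_eq[abs_def] by (rule law_reindex) (auto simp: inj_def)

lemma distr_kernel_eq:
  fixes g :: "(nat \<Rightarrow> real) \<Rightarrow> 'b::{real_normed_vector,second_countable_topology}"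
  assumes [measurable]: "g \<in> borel_measurable seqM"
  shows "distr M borel (\<lambda>\<omega>. g (eps_seq \<epsilon> t \<omega>)) = distr M borel (\<lambda>\<omega>. g (eps_seq \<epsilon> s \<omega>))"
    and "distr M borel (\<lambda>\<omega>. g (eps_cpl \<epsilon> \<epsilon>s t m \<omega>)) = distr M borel (\<lambda>\<omega>. g (eps_seq \<epsilon> s \<omega>))"
proof -
  have "distr M borel (\<lambda>\<omega>. g (Z \<omega>)) = distr (\<Pi>\<^sub>M k\<in>UNIV. \<nu>) borel g"
    if "distr M seqM Z = (\<Pi>\<^sub>M k\<in>UNIV. \<nu>)" and [measurable]: "Z \<in> measurable M seqM" for Z
    unfolding that(1)[symmetric] by (subst distr_distr) (auto simp: comp_def)
  then show "distr M borel (\<lambda>\<omega>. g (eps_seq \<epsilon> t \<omega>)) = distr M borel (\<lambda>\<omega>. g (eps_seq \<epsilon> s \<omega>))"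
    and "distr M borel (\<lambda>\<omega>. g (eps_cpl \<epsilon> \<epsilon>s t m \<omega>)) = distr M borel (\<lambda>\<omega>. g (eps_seq \<epsilon> s \<omega>))"
    by (simp_all add: eps_seq_law eps_cpl_law)
qed

section \<open>Independence of disjoint groups of innovations\<close>

lemma innov_sigma_sets_M: "sets (innov_sigma M e I) \<subseteq> sets M"
proof -
  have "(\<Union>i\<in>I. {e i -` B \<inter> space M | B. B \<in> sets borel}) \<subseteq> sets M"
    by (auto intro: measurable_sets)
  then show ?thesis
    unfolding sets_innov_sigma by (rule sets.sigma_sets_subset)
qed

lemma borel_measurable_innov_sigma_M:
  "X \<in> borel_measurable (innov_sigma M e I) \<Longrightarrow> X \<in> borel_measurable M"
  using innov_sigma_sets_M[of I] by (auto simp: measurable_def)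

text \<open>Preimages of Borel sets under a single innovation are closed under intersection, so
  independence of these generators passes to the sigma-algebras of disjoint index blocks.\<close>

lemma indep_var_innov_sigma:
  assumes "I \<inter> J = {}" and A: "A \<in> borel_measurable (innov_sigma M e I)"
    and B: "B \<in> borel_measurable (innov_sigma M e J)"
  shows "indep_var borel A borel B"
proof -
  let ?E = "\<lambda>i. {e i -` B \<inter> space M | B. B \<in> sets borel}"
  have ind_e: "indep_sets ?E UNIV"
    using iid by (simp add: indep_vars_def2)
  have "indep_sets (\<lambda>j. sigma_sets (space M) (\<Union>i\<in>case_bool I J j. ?E i)) UNIV"
  proof (rule indep_sets_collect_sigma)
    show "indep_sets ?E (\<Union>j\<in>UNIV. case_bool I J j)"
      by (rule indep_sets_mono_index[OF _ ind_e]) simp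
    show "Int_stable (?E i)" for i
    proof (rule Int_stableI)
      fix a b assume "a \<in> ?E i" "b \<in> ?E i"
      then obtain A B where "A \<in> sets borel" "B \<in> sets borel" "a = e i -` A \<inter> space M" "b = e i -` B \<inter> space M"
        by auto
      then show "a \<inter> b \<in> ?E i"
        by (intro CollectI exI[of _ "A \<inter> B"]) auto
    qed
    show "disjoint_family_on (case_bool I J) UNIV"
      using assms(1) by (auto simp: disjoint_family_on_def split: bool.splits)
  qed
  then have ind: "indep_sets (case_bool (sets (innov_sigma M e I)) (sets (innov_sigma M e J))) UNIV"
    by (rule indep_sets_mono_sets) (auto simp: sets_innov_sigma split: bool.splits)
  have sub: "sigma_sets (space M) {X -` D \<inter> space M |D. D \<in> sets borel} \<subseteq> sets (innov_sigma M e K)"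
    if "X \<in> borel_measurable (innov_sigma M e K)" for X :: "'a \<Rightarrow> 'z::topological_space" and K
  proof -
    have "{X -` D \<inter> space M |D. D \<in> sets borel} \<subseteq> sets (innov_sigma M e K)"
      using measurable_sets[OF that] by auto
    from sets.sigma_sets_subset[OF this] show ?thesis by simp
  qed
  show ?thesis
    unfolding indep_var_eq indep_set_def
  proof (intro conjI indep_sets_mono_sets[OF ind])
    fix j :: bool
    show "case_bool (sigma_sets (space M) {A -` D \<inter> space M |D. D \<in> sets borel})
        (sigma_sets (space M) {B -` D \<inter> space M |D. D \<in> sets borel}) j
      \<subseteq> case_bool (sets (innov_sigma M e I)) (sets (innov_sigma M e J)) j"
      using sub[OF A] sub[OF B] by (cases j) simp_all
  qed (rule borel_measurable_innov_sigma_M[OF A] borel_measurable_innov_sigma_M[OF B])+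
qed

lemma eps_cpl_measurable_innov:
  assumes "\<And>k. k < m \<Longrightarrow> Inl (t - int k) \<in> I" "\<And>k. m \<le> k \<Longrightarrow> Inr (t - int k) \<in> I"
  shows "eps_cpl \<epsilon> \<epsilon>s t m \<in> measurable (innov_sigma M e I) seqM"
  unfolding eps_cpl_eq[abs_def]
  by (intro measurable_PiM_single' measurable_innov_sigma) (use assms in auto)

lemma eps_seq_measurable_innov:
  assumes "\<And>k. Inl (t - int k) \<in> I"
  shows "eps_seq \<epsilon> t \<in> measurable (innov_sigma M e I) seqM"
  unfolding eps_seq_eq[abs_def]
  by (intro measurable_PiM_single' measurable_innov_sigma) (use assms in auto)

text \<open>Kernels are merely measurable, so coordinatewise convergence says nothing about them
  directly. For a cylinder over one coordinate the two memberships agree as soon as \<open>r\<close>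
  exceeds that coordinate. Countable unions are reached because every \<open>eps_mid\<close> has the
  same law, which makes the tail of a union small uniformly in \<open>r\<close>.\<close>

lemma eps_mid_converges_in_probability:
  assumes "A \<in> sets seqM"
  shows "(\<lambda>r. prob {\<omega>\<in>space M. (eps_mid \<epsilon> \<epsilon>s t m r \<omega> \<in> A) \<noteq> (eps_cpl \<epsilon> \<epsilon>s t m \<omega> \<in> A)}) \<longlonglongrightarrow> 0"
proof -
  let ?Z = "eps_mid \<epsilon> \<epsilon>s t m" and ?Y = "eps_cpl \<epsilon> \<epsilon>s t m"
  let ?\<Omega> = "\<Pi>\<^sub>E i\<in>(UNIV::nat set). space (borel :: real measure)"
  let ?G = "{{f\<in>?\<Omega>. f i \<in> A} | i A. i \<in> (UNIV::nat set) \<and> A \<in> sets (borel :: real measure)}"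
  have sets_eq: "sets seqM = sigma_sets ?\<Omega> ?G"
    by (rule sets_PiM_single)
  have \<Omega>: "?\<Omega> = UNIV" by auto
  have "A \<in> sigma_sets ?\<Omega> ?G"
    using assms unfolding sets_eq .
  then show ?thesis
  proof (induction rule: sigma_sets.induct)
    case (Basic A)
    then obtain i B where A: "A = {f. f i \<in> B}" by auto
    have "(?Z r \<omega> \<in> A) = (?Y \<omega> \<in> A)" if "i < r" for r \<omega>
      using that by (auto simp: A eps_mid_def eps_cpl_def)
    then have "eventually (\<lambda>r. prob {\<omega>\<in>space M. (?Z r \<omega> \<in> A) \<noteq> (?Y \<omega> \<in> A)} = 0) sequentially"
      by (intro eventually_mono[OF eventually_gt_at_top[of i]]) auto
    then show ?case
      by (rule tendsto_eventually)
  next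
    case Empty
    then show ?case by simp
  next
    case (Compl A)
    then show ?case by (simp add: \<Omega>)
  next
    case (Union A)
    have A[measurable]: "A i \<in> sets seqM" for i
      using Union.hyps unfolding sets_eq by auto
    \<comment> \<open>The part of the union missed by the first \<open>k\<close> sets; it decreases
      to the empty set.\<close>
    define B where "B k = (\<Union>i. A i) - (\<Union>i<k. A i)" for k :: nat
    have B[measurable]: "B k \<in> sets seqM" for k
      unfolding B_def by auto
    define N where "N = (\<Pi>\<^sub>M k\<in>(UNIV::nat set). \<nu>)"
    have pN: "prob_space N"
      unfolding N_def by (rule prob_space_PiM) (rule prob_space_\<nu>)
    interpret N: prob_space N by (rule pN)
    have setsN: "sets N = sets seqM"
      unfolding N_def by (rule sets_PiM_cong) auto
    have "(\<lambda>k. measure N (B k)) \<longlonglongrightarrow> measure N (\<Inter>k. B k)"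
      by (rule N.finite_Lim_measure_decseq) (auto simp: setsN decseq_def B_def)
    moreover have "(\<Inter>k. B k) = {}"
      by (auto simp: B_def)
    ultimately have Blim: "(\<lambda>k. measure N (B k)) \<longlonglongrightarrow> 0" by simp
    have law: "prob {\<omega>\<in>space M. Z \<omega> \<in> B k} = measure N (B k)"
      if "distr M seqM Z = N" and [measurable]: "Z \<in> measurable M seqM" for Z k
      unfolding that(1)[symmetric] by (subst measure_distr) (auto intro!: arg_cong[where f = prob])
    show ?case
    proof (rule LIMSEQ_I)
      fix c :: real assume c: "0 < c"
      then have "eventually (\<lambda>k. measure N (B k) < c / 4) sequentially"
        using order_tendstoD(2)[OF Blim, of "c / 4"] by auto
      then obtain k where k: "measure N (B k) < c / 4"
        by (auto simp: eventually_sequentially)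
      have "(\<lambda>r. \<Sum>i<k. prob {\<omega>\<in>space M. (?Z r \<omega> \<in> A i) \<noteq> (?Y \<omega> \<in> A i)}) \<longlonglongrightarrow> 0"
        by (rule tendsto_null_sum) (rule Union.IH)
      then have "eventually (\<lambda>r. (\<Sum>i<k. prob {\<omega>\<in>space M. (?Z r \<omega> \<in> A i) \<noteq> (?Y \<omega> \<in> A i)}) < c / 4) sequentially"
        using order_tendstoD(2)[of _ 0 _ "c / 4"] c by auto
      then obtain R where R: "\<And>r. r \<ge> R \<Longrightarrow> (\<Sum>i<k. prob {\<omega>\<in>space M. (?Z r \<omega> \<in> A i) \<noteq> (?Y \<omega> \<in> A i)}) < c / 4"
        by (auto simp: eventually_sequentially)
      have "norm (prob {\<omega>\<in>space M. (?Z r \<omega> \<in> \<Union> (range A)) \<noteq> (?Y \<omega> \<in> \<Union> (range A))} - 0) < c" if "r \<ge> R" for r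
      proof -
        have "prob {\<omega>\<in>space M. (?Z r \<omega> \<in> \<Union> (range A)) \<noteq> (?Y \<omega> \<in> \<Union> (range A))}
          \<le> prob ((\<Union>i<k. {\<omega>\<in>space M. (?Z r \<omega> \<in> A i) \<noteq> (?Y \<omega> \<in> A i)})
             \<union> ({\<omega>\<in>space M. ?Z r \<omega> \<in> B k} \<union> {\<omega>\<in>space M. ?Y \<omega> \<in> B k}))"
          by (intro finite_measure_mono) (auto simp: B_def)
        also have "\<dots> \<le> prob (\<Union>i<k. {\<omega>\<in>space M. (?Z r \<omega> \<in> A i) \<noteq> (?Y \<omega> \<in> A i)})
             + prob ({\<omega>\<in>space M. ?Z r \<omega> \<in> B k} \<union> {\<omega>\<in>space M. ?Y \<omega> \<in> B k})"
          by (intro measure_Un_le) auto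
        also have "prob (\<Union>i<k. {\<omega>\<in>space M. (?Z r \<omega> \<in> A i) \<noteq> (?Y \<omega> \<in> A i)})
             \<le> (\<Sum>i<k. prob {\<omega>\<in>space M. (?Z r \<omega> \<in> A i) \<noteq> (?Y \<omega> \<in> A i)})"
          by (intro measure_UNION_le) auto
        also have "prob ({\<omega>\<in>space M. ?Z r \<omega> \<in> B k} \<union> {\<omega>\<in>space M. ?Y \<omega> \<in> B k})
             \<le> prob {\<omega>\<in>space M. ?Z r \<omega> \<in> B k} + prob {\<omega>\<in>space M. ?Y \<omega> \<in> B k}"
          by (intro measure_Un_le) auto
        also have "prob {\<omega>\<in>space M. ?Z r \<omega> \<in> B k} = measure N (B k)"
          by (rule law) (auto simp: eps_mid_law N_def)
        also have "prob {\<omega>\<in>space M. ?Y \<omega> \<in> B k} = measure N (B k)"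
          by (rule law) (auto simp: eps_cpl_law N_def)
        finally show ?thesis
          unfolding real_norm_def diff_0_right abs_of_nonneg[OF measure_nonneg]
          using R[OF that] k c by linarith
      qed
      then show "\<exists>no. \<forall>r\<ge>no. norm (prob {\<omega>\<in>space M. (?Z r \<omega> \<in> \<Union> (range A)) \<noteq> (?Y \<omega> \<in> \<Union> (range A))} - 0) < c"
        by blast
    qed
  qed
qed

text \<open>Since all stages and the limit share one law, an approximation of \<open>g\<close> in
  mean is equally good at each of them; this extends the convergence from indicators to integrable
  functions.\<close>

lemma eps_mid_converges_L1:
  fixes g :: "(nat \<Rightarrow> real) \<Rightarrow> 'b::{banach,second_countable_topology}"
  assumes "integrable (\<Pi>\<^sub>M k\<in>UNIV. \<nu>) g"
  shows "(\<lambda>r. expectation (\<lambda>\<omega>. norm (g (eps_mid \<epsilon> \<epsilon>s t m r \<omega>) - g (eps_cpl \<epsilon> \<epsilon>s t m \<omega>)))) \<longlonglongrightarrow> 0"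
proof -
  let ?Z = "eps_mid \<epsilon> \<epsilon>s t m" and ?Y = "eps_cpl \<epsilon> \<epsilon>s t m"
  define N where "N = (\<Pi>\<^sub>M k\<in>(UNIV::nat set). \<nu>)"
  have setsN[measurable_cong]: "sets N = sets seqM"
    unfolding N_def by (rule sets_PiM_cong) auto
  have int: "integrable M (\<lambda>\<omega>. f (?Z r \<omega>))" "integrable M (\<lambda>\<omega>. f (?Y \<omega>))"
     if "integrable N f" for r and f :: "_ \<Rightarrow> 'c::{banach,second_countable_topology}"
    using that eps_mid_law[of t m r] eps_cpl_law[of t m]
      integrable_distr_eq[of "?Z r" M seqM f] integrable_distr_eq[of ?Y M seqM f]
    by (auto simp: N_def[symmetric] dest: borel_measurable_integrable simp: measurable_cong_sets[OF setsN refl])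
  have inteq: "expectation (\<lambda>\<omega>. f (?Z r \<omega>)) = integral\<^sup>L N f" "expectation (\<lambda>\<omega>. f (?Y \<omega>)) = integral\<^sup>L N f"
     if "integrable N f" for r and f :: "_ \<Rightarrow> 'c::{banach,second_countable_topology}"
    using that eps_mid_law[of t m r] eps_cpl_law[of t m]
      integral_distr[of "?Z r" M seqM f] integral_distr[of ?Y M seqM f]
    by (auto simp: N_def[symmetric] dest: borel_measurable_integrable simp: measurable_cong_sets[OF setsN refl])
  have "integrable N g" using assms by (simp add: N_def)
  then show ?thesis
  proof (induction rule: integrable_induct)
    case (base A c)
    then have [measurable]: "A \<in> sets seqM" by (simp add: setsN)
    have "expectation (\<lambda>\<omega>. norm (indicator A (?Z r \<omega>) *\<^sub>R c - indicator A (?Y \<omega>) *\<^sub>R c))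
        = prob {\<omega>\<in>space M. (?Z r \<omega> \<in> A) \<noteq> (?Y \<omega> \<in> A)} * norm c" for r
    proof -
      have "expectation (\<lambda>\<omega>. norm (indicator A (?Z r \<omega>) *\<^sub>R c - indicator A (?Y \<omega>) *\<^sub>R c))
         = expectation (\<lambda>\<omega>. indicator {\<omega>\<in>space M. (?Z r \<omega> \<in> A) \<noteq> (?Y \<omega> \<in> A)} \<omega> * norm c)"
        by (intro Bochner_Integration.integral_cong) (auto simp: indicator_def)
      then show ?thesis by simp
    qed
    then show ?case
      using tendsto_mult_left_zero[OF eps_mid_converges_in_probability[of A t m], of "norm c"] base
      by (simp add: setsN)
  next
    case (add f g)
    have "(\<lambda>r. expectation (\<lambda>\<omega>. norm (f (?Z r \<omega>) - f (?Y \<omega>))) + expectation (\<lambda>\<omega>. norm (g (?Z r \<omega>) - g (?Y \<omega>)))) \<longlonglongrightarrow> 0"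
      using tendsto_add[OF add.IH] by simp
    then show ?case
    proof (rule tendsto_0_le[where K = 1], intro always_eventually allI)
      fix r
      have "expectation (\<lambda>\<omega>. norm (f (?Z r \<omega>) + g (?Z r \<omega>) - (f (?Y \<omega>) + g (?Y \<omega>))))
         \<le> expectation (\<lambda>\<omega>. norm (f (?Z r \<omega>) - f (?Y \<omega>)) + norm (g (?Z r \<omega>) - g (?Y \<omega>)))"
        using int[OF add.hyps(1)] int[OF add.hyps(2)]
        by (intro integral_mono) (auto simp: add_diff_add intro: norm_triangle_ineq)
      also have "\<dots> = expectation (\<lambda>\<omega>. norm (f (?Z r \<omega>) - f (?Y \<omega>))) + expectation (\<lambda>\<omega>. norm (g (?Z r \<omega>) - g (?Y \<omega>)))"
        using int[OF add.hyps(1)] int[OF add.hyps(2)]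
        by (intro Bochner_Integration.integral_add) auto
      finally show "norm (expectation (\<lambda>\<omega>. norm (f (?Z r \<omega>) + g (?Z r \<omega>) - (f (?Y \<omega>) + g (?Y \<omega>)))))
          \<le> norm (expectation (\<lambda>\<omega>. norm (f (?Z r \<omega>) - f (?Y \<omega>))) + expectation (\<lambda>\<omega>. norm (g (?Z r \<omega>) - g (?Y \<omega>)))) * 1"
        by simp
    qed
  next
    case (lim f s)
    have "(\<lambda>i. integral\<^sup>L N (\<lambda>x. norm (s i x - f x))) \<longlonglongrightarrow> integral\<^sup>L N (\<lambda>x. 0)"
    proof (rule integral_dominated_convergence[where w = "\<lambda>x. 3 * norm (f x)"])
      show "AE x in N. (\<lambda>i. norm (s i x - f x)) \<longlonglongrightarrow> 0"
        using lim.hyps(2) by (intro AE_I2) (auto intro: tendsto_norm_zero simp: LIM_zero)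
      \<comment> \<open>The approximating functions are bounded by \<open>2 * norm (f x)\<close>,
        whence the factor 3.\<close>
      show "AE x in N. norm (norm (s i x - f x)) \<le> 3 * norm (f x)" for i
      proof (intro AE_I2)
        fix x assume "x \<in> space N"
        then show "norm (norm (s i x - f x)) \<le> 3 * norm (f x)"
          using lim.hyps(3)[of x i] norm_triangle_ineq4[of "s i x" "f x"] by auto
      qed
    qed (use lim.hyps in auto)
    then have sl: "(\<lambda>i. integral\<^sup>L N (\<lambda>x. norm (s i x - f x))) \<longlonglongrightarrow> 0" by simp
    show ?case
    proof (rule LIMSEQ_I)
      fix c :: real assume c: "0 < c"
      obtain i where i: "integral\<^sup>L N (\<lambda>x. norm (s i x - f x)) < c / 4"
        using order_tendstoD(2)[OF sl, of "c / 4"] c by (auto simp: eventually_sequentially)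
      obtain R where R: "\<And>r. r \<ge> R \<Longrightarrow> expectation (\<lambda>\<omega>. norm (s i (?Z r \<omega>) - s i (?Y \<omega>))) < c / 4"
        using order_tendstoD(2)[OF lim.IH, of "c / 4" i] c by (auto simp: eventually_sequentially)
      have "norm (expectation (\<lambda>\<omega>. norm (f (?Z r \<omega>) - f (?Y \<omega>))) - 0) < c" if "r \<ge> R" for r
      proof -
        let ?h = "\<lambda>x. norm (s i x - f x)"
        have h: "integrable N ?h" using lim.hyps by auto
        have "expectation (\<lambda>\<omega>. norm (f (?Z r \<omega>) - f (?Y \<omega>)))
          \<le> expectation (\<lambda>\<omega>. ?h (?Z r \<omega>) + norm (s i (?Z r \<omega>) - s i (?Y \<omega>)) + ?h (?Y \<omega>))"
        proof (rule integral_mono)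
          fix \<omega>
          have eq: "f (?Z r \<omega>) - f (?Y \<omega>) = - (s i (?Z r \<omega>) - f (?Z r \<omega>)) + (s i (?Z r \<omega>) - s i (?Y \<omega>)) + (s i (?Y \<omega>) - f (?Y \<omega>))"
            by simp
          show "norm (f (?Z r \<omega>) - f (?Y \<omega>)) \<le> ?h (?Z r \<omega>) + norm (s i (?Z r \<omega>) - s i (?Y \<omega>)) + ?h (?Y \<omega>)"
            unfolding eq using norm_triangle_ineq[of "- (s i (?Z r \<omega>) - f (?Z r \<omega>)) + (s i (?Z r \<omega>) - s i (?Y \<omega>))" "s i (?Y \<omega>) - f (?Y \<omega>)"]
              norm_triangle_ineq[of "- (s i (?Z r \<omega>) - f (?Z r \<omega>))" "s i (?Z r \<omega>) - s i (?Y \<omega>)"]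
              norm_minus_cancel[of "s i (?Z r \<omega>) - f (?Z r \<omega>)"] by linarith
        qed (use int[OF lim.hyps(4)] int[OF lim.hyps(1)] int[OF h] in auto)
        also have "\<dots> = expectation (\<lambda>\<omega>. ?h (?Z r \<omega>)) + expectation (\<lambda>\<omega>. norm (s i (?Z r \<omega>) - s i (?Y \<omega>)))
            + expectation (\<lambda>\<omega>. ?h (?Y \<omega>))"
          using int[OF lim.hyps(1)] int[OF h] by simp
        also have "\<dots> < c / 4 + c / 4 + c / 4"
          using R[OF that] i by (simp only: inteq[OF h])
        finally show ?thesis using c by simp
      qed
      then show "\<exists>no. \<forall>r\<ge>no. norm (expectation (\<lambda>\<omega>. norm (f (?Z r \<omega>) - f (?Y \<omega>))) - 0) < c"
        by blast
    qed
  qed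
qed

text \<open>The coordinates are replaced one at a time: exchanging \<open>\<epsilon>\<close> and \<open>\<epsilon>s\<close> at the coordinates already
  replaced preserves the joint law and reduces each step to the assumption. Fatou's lemma along an almost surely
  convergent subsequence then passes to infinitely many replacements.\<close>
lemma coupling_Lq_le:
  fixes g :: "(nat \<Rightarrow> real) \<Rightarrow> 'b::{banach,second_countable_topology}"
  assumes [measurable]: "g \<in> borel_measurable seqM" and q: "1 \<le> q"
    and int: "integrable M (\<lambda>\<omega>. g (eps_seq \<epsilon> t \<omega>))"
    and C: "\<And>j. Lq_le M q (\<lambda>\<omega>. g (eps_seq \<epsilon> t \<omega>) - g (eps_tilde \<epsilon> \<epsilon>s t j \<omega>)) (C * \<rho> ^ j)"
    and \<rho>: "0 < \<rho>" "\<rho> < 1"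
  shows "Lq_le M q (\<lambda>\<omega>. g (eps_seq \<epsilon> t \<omega>) - g (eps_cpl \<epsilon> \<epsilon>s t m \<omega>)) (C * \<rho> ^ m / (1 - \<rho>))"
proof -
  let ?S = "eps_seq \<epsilon> t" and ?Z = "eps_mid \<epsilon> \<epsilon>s t m" and ?Y = "eps_cpl \<epsilon> \<epsilon>s t m"
  have C0: "0 \<le> C" using Lq_le_nonneg[OF C[of 0]] by simp
  have step: "Lq_le M q (\<lambda>\<omega>. g (?Z r \<omega>) - g (?Z (Suc r) \<omega>)) (C * \<rho> ^ (m + r))" for r
  proof -
    define H where "H w = g (\<lambda>k. w (Inl (t - int k)))
        - g (\<lambda>k. w (if k = m + r then Inr (t - int k) else Inl (t - int k)))" for w :: "int + int \<Rightarrow> real"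
    have [measurable]: "H \<in> borel_measurable (\<Pi>\<^sub>M k\<in>UNIV. borel)"
      unfolding H_def
      by (intro borel_measurable_diff measurable_compose[OF _ assms(1)] measurable_PiM_single' measurable_component_singleton) auto
    \<comment> \<open>The times concerned are \<open>t - k\<close> with
      \<open>m \<le> k < m + r\<close>; coordinate \<open>m + r\<close>, the one replaced next,
      stays fixed.\<close>
    define \<sigma> where "\<sigma> i = (case i of Inl s \<Rightarrow> if t - int (m + r) < s \<and> s \<le> t - int m then Inr s else Inl s
       | Inr s \<Rightarrow> if t - int (m + r) < s \<and> s \<le> t - int m then Inl s else Inr s)" for i :: "int + int"
    have inj: "inj \<sigma>"
      by (auto simp: inj_def \<sigma>_def split: sum.splits if_splits)
    have "distr M borel (\<lambda>\<omega>. H (\<lambda>k. e (\<sigma> k) \<omega>)) = distr M borel (\<lambda>\<omega>. H (\<lambda>k. e (id k) \<omega>))"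
      by (rule distr_reindex_eq) (use inj in auto)
    moreover have Hid: "H (\<lambda>k. e (id k) \<omega>) = g (?S \<omega>) - g (eps_tilde \<epsilon> \<epsilon>s t (m + r) \<omega>)" for \<omega>
      unfolding H_def eps_seq_def eps_tilde_def by (auto intro!: arg_cong2[where f = "(-)"] arg_cong[where f = g])
    moreover have "H (\<lambda>k. e (\<sigma> k) \<omega>) = g (?Z r \<omega>) - g (?Z (Suc r) \<omega>)" for \<omega>
      unfolding H_def eps_mid_def
      by (intro arg_cong2[where f = "(-)"] arg_cong[where f = g]) (auto simp: \<sigma>_def fun_eq_iff)
    ultimately have "distr M borel (\<lambda>\<omega>. g (?Z r \<omega>) - g (?Z (Suc r) \<omega>))
        = distr M borel (\<lambda>\<omega>. g (?S \<omega>) - g (eps_tilde \<epsilon> \<epsilon>s t (m + r) \<omega>))"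
      by simp
    moreover have "(\<lambda>\<omega>. g (?S \<omega>) - g (eps_tilde \<epsilon> \<epsilon>s t (m + r) \<omega>)) \<in> borel_measurable M"
      using measurable_compose[OF env_measurable[of id] \<open>H \<in> _\<close>] unfolding Hid .
    ultimately show ?thesis
      using C[of "m + r"] by (subst Lq_le_distr_eq) auto
  qed
  have fin: "Lq_le M q (\<lambda>\<omega>. g (?S \<omega>) - g (?Z r \<omega>)) (C * \<rho> ^ m / (1 - \<rho>))" for r
  proof -
    have "Lq_le M q (\<lambda>\<omega>. \<Sum>j<r. g (?Z j \<omega>) - g (?Z (Suc j) \<omega>)) (\<Sum>j<r. C * \<rho> ^ (m + j))"
      by (intro Lq_le_sum step q) auto
    moreover have "(\<Sum>j<r. g (?Z j \<omega>) - g (?Z (Suc j) \<omega>)) = g (?S \<omega>) - g (?Z r \<omega>)" for \<omega>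
    proof -
      have "?Z 0 \<omega> = ?S \<omega>" by (auto simp: eps_mid_def eps_seq_def)
      then show ?thesis using sum_lessThan_telescope'[of "\<lambda>j. g (?Z j \<omega>)" r] by simp
    qed
    moreover have "(\<Sum>j<r. C * \<rho> ^ (m + j)) \<le> C * \<rho> ^ m / (1 - \<rho>)"
    proof -
      have "(\<Sum>j<r. C * \<rho> ^ (m + j)) = C * \<rho> ^ m * (\<Sum>j<r. \<rho> ^ j)"
        by (simp add: power_add sum_distrib_left mult.assoc)
      also have "(\<Sum>j<r. \<rho> ^ j) \<le> 1 / (1 - \<rho>)"
        using \<rho> by (simp add: sum_gp_strict divide_right_mono)
      finally show ?thesis
        using C0 \<rho> by (simp add: mult_left_mono)
    qed
    ultimately show ?thesis
      using q by (auto intro: Lq_le_weaken)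
  qed
  have intN: "integrable (\<Pi>\<^sub>M k\<in>UNIV. \<nu>) g"
    using int unfolding eps_seq_law[of t, symmetric] by (subst integrable_distr_eq) auto
  have intZ: "integrable M (\<lambda>\<omega>. g (?Z r \<omega>))" for r
    using intN unfolding eps_mid_law[of t m r, symmetric] by (subst (asm) integrable_distr_eq) auto
  have intY: "integrable M (\<lambda>\<omega>. g (?Y \<omega>))"
    using intN unfolding eps_cpl_law[of t m, symmetric] by (subst (asm) integrable_distr_eq) auto
  obtain s where "strict_mono s" and AE: "AE \<omega> in M. (\<lambda>r. g (?Z (s r) \<omega>) - g (?Y \<omega>)) \<longlonglongrightarrow> 0"
    using tendsto_L1_AE_subseq[OF _ eps_mid_converges_L1[OF intN, of t m]] intZ intY by auto
  show ?thesis
  proof (rule Lq_le_Fatou)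
    show "AE \<omega> in M. (\<lambda>r. g (?S \<omega>) - g (?Z (s r) \<omega>)) \<longlonglongrightarrow> g (?S \<omega>) - g (?Y \<omega>)"
      using AE by eventually_elim (auto intro!: tendsto_diff simp: LIM_zero_iff)
  qed (use fin q in auto)
qed

end

section \<open>Geometric sums and block averages of autocovariances\<close>

lemma sum_power_inj_le:
  fixes \<rho> :: real and h :: "'i \<Rightarrow> nat"
  assumes "finite A" "inj_on h A" "0 < \<rho>" "\<rho> < 1"
  shows "(\<Sum>x\<in>A. \<rho> ^ h x) \<le> 1 / (1 - \<rho>)"
proof -
  have "(\<Sum>x\<in>A. \<rho> ^ h x) = (\<Sum>k\<in>h ` A. \<rho> ^ k)"
    using assms by (simp add: sum.reindex)
  also have "\<dots> \<le> (\<Sum>k. \<rho> ^ k)"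
    using assms by (intro sum_le_suminf) (auto intro: summable_geometric)
  also have "\<dots> = 1 / (1 - \<rho>)"
    using assms by (intro suminf_geometric) auto
  finally show ?thesis .
qed

lemma sum_power_inj_tail_le:
  fixes \<rho> :: real and h :: "'i \<Rightarrow> nat"
  assumes "finite A" "inj_on h A" "0 < \<rho>" "\<rho> < 1" "\<And>x. x \<in> A \<Longrightarrow> N \<le> h x"
  shows "(\<Sum>x\<in>A. \<rho> ^ h x) \<le> \<rho> ^ N / (1 - \<rho>)"
proof -
  have "(\<Sum>x\<in>A. \<rho> ^ h x) = \<rho> ^ N * (\<Sum>x\<in>A. \<rho> ^ (h x - N))"
    using assms(5) by (auto simp: sum_distrib_left simp flip: power_add intro!: sum.cong)
  also have "(\<Sum>x\<in>A. \<rho> ^ (h x - N)) \<le> 1 / (1 - \<rho>)"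
  proof (intro sum_power_inj_le)
    show "inj_on (\<lambda>x. h x - N) A"
      using assms(2) by (auto simp: inj_on_def eq_diff_iff[OF assms(5) assms(5)])
  qed (use assms in auto)
  finally show ?thesis
    using assms by (simp add: mult_left_mono)
qed

text \<open>On either side of \<open>i\<close> the distance to \<open>i\<close> is injective, so
  each side is a geometric tail; this is the factor 2.\<close>

lemma sum_power_abs_tail_le:
  fixes \<rho> :: real and i :: int
  assumes "finite A" "0 < \<rho>" "\<rho> < 1" "\<And>j. j \<in> A \<Longrightarrow> N \<le> nat \<bar>i - j\<bar>"
  shows "(\<Sum>j\<in>A. \<rho> ^ nat \<bar>i - j\<bar>) \<le> 2 * \<rho> ^ N / (1 - \<rho>)"
proof -
  have "(\<Sum>j\<in>A. \<rho> ^ nat \<bar>i - j\<bar>)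
     = (\<Sum>j\<in>A \<inter> {..i}. \<rho> ^ nat \<bar>i - j\<bar>) + (\<Sum>j\<in>A \<inter> {i<..}. \<rho> ^ nat \<bar>i - j\<bar>)"
    using assms(1) by (subst sum.union_disjoint[symmetric]) (auto intro!: sum.cong)
  also have "\<dots> \<le> \<rho> ^ N / (1 - \<rho>) + \<rho> ^ N / (1 - \<rho>)"
    using assms(1-3) by (intro add_mono sum_power_inj_tail_le) (auto simp: inj_on_def dest!: assms(4))
  finally show ?thesis by simp
qed

lemma sum_power_abs_le:
  fixes \<rho> :: real and i :: int
  assumes "finite A" "0 < \<rho>" "\<rho> < 1"
  shows "(\<Sum>j\<in>A. \<rho> ^ nat \<bar>i - j\<bar>) \<le> 2 / (1 - \<rho>)"
  using sum_power_abs_tail_le[OF assms, of 0 i] by simp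

text \<open>All lags shorter than \<open>N\<close> lie in \<open>A\<close>, so what is missing is a
  two-sided geometric tail.\<close>

lemma infsum_tail_le:
  fixes \<gamma> :: "int \<Rightarrow> real"
  assumes \<gamma>: "\<And>h. \<bar>\<gamma> h\<bar> \<le> C * \<rho> ^ nat \<bar>h\<bar>" and \<rho>: "0 < \<rho>" "\<rho> < 1" and N: "\<And>h. h \<notin> A \<Longrightarrow> N \<le> nat \<bar>h\<bar>"
    and "finite A"
  shows "\<gamma> summable_on UNIV" "\<bar>(\<Sum>\<^sub>\<infinity>h. \<gamma> h) - (\<Sum>h\<in>A. \<gamma> h)\<bar> \<le> C * (2 * \<rho> ^ N / (1 - \<rho>))"
proof -
  have C0: "0 \<le> C" using \<gamma>[of 0] by simp
  have fin: "(\<Sum>h\<in>F. \<bar>\<gamma> h\<bar>) \<le> C * (2 * \<rho> ^ N' / (1 - \<rho>))"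
    if "finite F" "\<And>h. h \<in> F \<Longrightarrow> N' \<le> nat \<bar>h\<bar>" for F N'
  proof -
    have "(\<Sum>h\<in>F. \<bar>\<gamma> h\<bar>) \<le> C * (\<Sum>h\<in>F. \<rho> ^ nat \<bar>0 - h\<bar>)"
      unfolding sum_distrib_left using \<gamma> by (intro sum_mono) auto
    also have "\<dots> \<le> C * (2 * \<rho> ^ N' / (1 - \<rho>))"
      using C0 \<rho> that by (intro mult_left_mono sum_power_abs_tail_le) auto
    finally show ?thesis .
  qed
  have abs: "(\<lambda>h. \<bar>\<gamma> h\<bar>) summable_on B" for B
    using fin[of _ 0] by (intro nonneg_bdd_above_summable_on bdd_aboveI2[where M = "C * (2 * \<rho> ^ 0 / (1 - \<rho>))"]) auto
  have sm: "\<gamma> summable_on B" for B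
    by (rule abs_summable_summable) (simp only: real_norm_def abs)
  then show "\<gamma> summable_on UNIV" .
  have "(\<Sum>\<^sub>\<infinity>h. \<gamma> h) = (\<Sum>\<^sub>\<infinity>h\<in>A. \<gamma> h) + (\<Sum>\<^sub>\<infinity>h\<in>-A. \<gamma> h)"
    using infsum_Un_disjoint[OF sm sm, of A "- A"] by simp
  then have "\<bar>(\<Sum>\<^sub>\<infinity>h. \<gamma> h) - (\<Sum>h\<in>A. \<gamma> h)\<bar> = norm (\<Sum>\<^sub>\<infinity>h\<in>-A. \<gamma> h)"
    using \<open>finite A\<close> by simp
  also have "\<dots> \<le> (\<Sum>\<^sub>\<infinity>h\<in>-A. \<bar>\<gamma> h\<bar>)"
    using norm_infsum_bound[of \<gamma> "- A"] abs[of "- A"] by simp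
  also have "\<dots> \<le> C * (2 * \<rho> ^ N / (1 - \<rho>))"
  proof (intro infsum_le_finite_sums abs)
    show "(\<Sum>h\<in>F. \<bar>\<gamma> h\<bar>) \<le> C * (2 * \<rho> ^ N / (1 - \<rho>))" if "finite F" "F \<subseteq> - A" for F
      by (rule fin) (use N that in auto)
  qed
  finally show "\<bar>(\<Sum>\<^sub>\<infinity>h. \<gamma> h) - (\<Sum>h\<in>A. \<gamma> h)\<bar> \<le> C * (2 * \<rho> ^ N / (1 - \<rho>))" .
qed

text \<open>Here \<open>c\<close> stands for the covariances inside a block and
  \<open>\<gamma>\<close> for their stationary limit. Lags up to \<open>H\<close> are compared term
  by term, longer ones are removed by the decay. The last summand is the edge effect: positions near
  an end of the block miss part of the two-sided series, but the total loss stays bounded before the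
  division by \<open>b\<close>.\<close>

lemma block_average_bound:
  fixes \<gamma> :: "int \<Rightarrow> real" and c :: "int \<Rightarrow> int \<Rightarrow> real"
  assumes \<gamma>: "\<And>h. \<bar>\<gamma> h\<bar> \<le> C * \<rho> ^ nat \<bar>h\<bar>" and \<rho>: "0 < \<rho>" "\<rho> < 1"
    and c: "\<And>i j. i \<in> {1..int b} \<Longrightarrow> j \<in> {1..int b} \<Longrightarrow> \<bar>c i j\<bar> \<le> C * \<rho> ^ nat \<bar>i - j\<bar>"
    and \<eta>: "\<And>i j. i \<in> {1..int b} \<Longrightarrow> j \<in> {1..int b} \<Longrightarrow> \<bar>c i j - \<gamma> (j - i)\<bar> \<le> \<eta>"
    and b: "1 \<le> b"
  shows "\<bar>(\<Sum>i\<in>{1..int b}. \<Sum>j\<in>{1..int b}. c i j) / real b - (\<Sum>\<^sub>\<infinity>h. \<gamma> h)\<bar>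
     \<le> real (2 * H + 1) * \<eta> + 4 * C * \<rho> ^ H / (1 - \<rho>) + 4 * C / (1 - \<rho>)\<^sup>2 / real b"
proof -
  let ?B = "{1..int b}"
  have C0: "0 \<le> C" using \<gamma>[of 0] by simp
  have \<eta>0: "0 \<le> \<eta>" using \<eta>[of 1 1] b by auto
  have 1: "(\<Sum>j\<in>?B. \<bar>c i j - \<gamma> (j - i)\<bar>) \<le> real (2 * H + 1) * \<eta> + 4 * C * \<rho> ^ H / (1 - \<rho>)" if i: "i \<in> ?B" for i
  proof -
    let ?N = "?B \<inter> {j. nat \<bar>i - j\<bar> \<le> H}" and ?F = "?B \<inter> {j. H < nat \<bar>i - j\<bar>}"
    have "(\<Sum>j\<in>?B. \<bar>c i j - \<gamma> (j - i)\<bar>) = (\<Sum>j\<in>?N. \<bar>c i j - \<gamma> (j - i)\<bar>) + (\<Sum>j\<in>?F. \<bar>c i j - \<gamma> (j - i)\<bar>)"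
      by (subst sum.union_disjoint[symmetric]) (auto intro!: sum.cong)
    also have "(\<Sum>j\<in>?N. \<bar>c i j - \<gamma> (j - i)\<bar>) \<le> real (card ?N) * \<eta>"
      using \<eta> i by (intro sum_bounded_above) auto
    also have "real (card ?N) * \<eta> \<le> real (2 * H + 1) * \<eta>"
    proof -
      have "card ?N \<le> card {i - int H .. i + int H}"
        by (intro card_mono) auto
      then show ?thesis using \<eta>0 by (intro mult_right_mono) auto
    qed
    also have "(\<Sum>j\<in>?F. \<bar>c i j - \<gamma> (j - i)\<bar>) \<le> (\<Sum>j\<in>?F. 2 * C * \<rho> ^ nat \<bar>i - j\<bar>)"
    proof (rule sum_mono)
      fix j assume "j \<in> ?F"
      then show "\<bar>c i j - \<gamma> (j - i)\<bar> \<le> 2 * C * \<rho> ^ nat \<bar>i - j\<bar>"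
        using c[OF i, of j] \<gamma>[of "j - i"] by (auto simp: abs_minus_commute)
    qed
    also have "\<dots> = 2 * C * (\<Sum>j\<in>?F. \<rho> ^ nat \<bar>i - j\<bar>)"
      by (simp add: sum_distrib_left)
    also have "\<dots> \<le> 2 * C * (2 * \<rho> ^ H / (1 - \<rho>))"
      using C0 \<rho> by (intro mult_left_mono sum_power_abs_tail_le) auto
    finally show ?thesis by (simp add: algebra_simps)
  qed
  have 2: "\<bar>(\<Sum>\<^sub>\<infinity>h. \<gamma> h) - (\<Sum>j\<in>?B. \<gamma> (j - i))\<bar> \<le> C * (2 / (1 - \<rho>)) * (\<rho> ^ nat (i - 1) + \<rho> ^ nat (int b - i))"
    if i: "i \<in> ?B" for i
  proof -
    \<comment> \<open>From position \<open>i\<close> every lag up to the distance to the nearer end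
      of the block occurs. Replacing the power of the minimum by the sum of the powers for both ends
      makes the total over \<open>i\<close> geometric.\<close>
    let ?m = "nat (min (i - 1) (int b - i))"
    have "(\<Sum>j\<in>?B. \<gamma> (j - i)) = (\<Sum>h\<in>{1 - i..int b - i}. \<gamma> h)"
      by (rule sum.reindex_bij_witness[of _ "\<lambda>h. h + i" "\<lambda>j. j - i"]) auto
    moreover have "\<bar>(\<Sum>\<^sub>\<infinity>h. \<gamma> h) - (\<Sum>h\<in>{1 - i..int b - i}. \<gamma> h)\<bar> \<le> C * (2 * \<rho> ^ ?m / (1 - \<rho>))"
    proof (rule infsum_tail_le(2)[OF \<gamma> \<rho>])
      show "?m \<le> nat \<bar>h\<bar>" if "h \<notin> {1 - i..int b - i}" for h
        using that i by (auto simp: min_def)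
    qed simp
    ultimately have "\<bar>(\<Sum>\<^sub>\<infinity>h. \<gamma> h) - (\<Sum>j\<in>?B. \<gamma> (j - i))\<bar> \<le> C * (2 * \<rho> ^ ?m / (1 - \<rho>))"
      by simp
    also have "\<rho> ^ ?m \<le> \<rho> ^ nat (i - 1) + \<rho> ^ nat (int b - i)"
      using \<rho> by (auto simp: min_def)
    finally show ?thesis
      using C0 \<rho> by (simp add: mult_left_mono divide_right_mono mult.assoc)
  qed
  have 3: "(\<Sum>i\<in>?B. \<rho> ^ nat (i - 1) + \<rho> ^ nat (int b - i)) \<le> 1 / (1 - \<rho>) + 1 / (1 - \<rho>)"
    unfolding sum.distrib using \<rho> by (intro add_mono sum_power_inj_le) (auto simp: inj_on_def)
  let ?R = "real (2 * H + 1) * \<eta> + 4 * C * \<rho> ^ H / (1 - \<rho>)"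
  have "\<bar>(\<Sum>i\<in>?B. \<Sum>j\<in>?B. c i j) - real b * (\<Sum>\<^sub>\<infinity>h. \<gamma> h)\<bar> = \<bar>\<Sum>i\<in>?B. (\<Sum>j\<in>?B. c i j) - (\<Sum>\<^sub>\<infinity>h. \<gamma> h)\<bar>"
    by (simp add: sum_subtractf)
  also have "\<dots> \<le> (\<Sum>i\<in>?B. ?R + C * (2 / (1 - \<rho>)) * (\<rho> ^ nat (i - 1) + \<rho> ^ nat (int b - i)))"
  proof (intro order_trans[OF sum_abs] sum_mono)
    fix i assume i: "i \<in> ?B"
    have "\<bar>(\<Sum>j\<in>?B. c i j) - (\<Sum>j\<in>?B. \<gamma> (j - i))\<bar> \<le> (\<Sum>j\<in>?B. \<bar>c i j - \<gamma> (j - i)\<bar>)"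
      unfolding sum_subtractf[symmetric] by (rule sum_abs)
    with 1[OF i] 2[OF i] show "\<bar>(\<Sum>j\<in>?B. c i j) - (\<Sum>\<^sub>\<infinity>h. \<gamma> h)\<bar>
        \<le> ?R + C * (2 / (1 - \<rho>)) * (\<rho> ^ nat (i - 1) + \<rho> ^ nat (int b - i))"
      by linarith
  qed
  also have "\<dots> = real b * ?R + C * (2 / (1 - \<rho>)) * (\<Sum>i\<in>?B. \<rho> ^ nat (i - 1) + \<rho> ^ nat (int b - i))"
    by (subst sum.distrib, subst sum_distrib_left[symmetric]) simp
  also have "\<dots> \<le> real b * ?R + C * (2 / (1 - \<rho>)) * (1 / (1 - \<rho>) + 1 / (1 - \<rho>))"
    using 3 C0 \<rho> by (intro add_left_mono mult_left_mono) auto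
  also have "\<dots> = real b * ?R + 4 * C / (1 - \<rho>)\<^sup>2"
    using \<rho> by (simp add: power2_eq_square field_simps)
  finally have *: "\<bar>(\<Sum>i\<in>?B. \<Sum>j\<in>?B. c i j) - real b * (\<Sum>\<^sub>\<infinity>h. \<gamma> h)\<bar> \<le> real b * ?R + 4 * C / (1 - \<rho>)\<^sup>2" .
  have b0: "0 < real b" using b by simp
  have "(\<Sum>i\<in>?B. \<Sum>j\<in>?B. c i j) / real b - (\<Sum>\<^sub>\<infinity>h. \<gamma> h) = ((\<Sum>i\<in>?B. \<Sum>j\<in>?B. c i j) - real b * (\<Sum>\<^sub>\<infinity>h. \<gamma> h)) / real b"
    using b0 by (simp add: field_simps)
  then have "\<bar>(\<Sum>i\<in>?B. \<Sum>j\<in>?B. c i j) / real b - (\<Sum>\<^sub>\<infinity>h. \<gamma> h)\<bar>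
      = \<bar>(\<Sum>i\<in>?B. \<Sum>j\<in>?B. c i j) - real b * (\<Sum>\<^sub>\<infinity>h. \<gamma> h)\<bar> / real b"
    using b0 by simp
  also have "\<dots> \<le> (real b * ?R + 4 * C / (1 - \<rho>)\<^sup>2) / real b"
    using * b0 by (intro divide_right_mono) auto
  also have "\<dots> = ?R + 4 * C / (1 - \<rho>)\<^sup>2 / real b"
    using b0 by (simp add: add_divide_distrib)
  finally show ?thesis .
qed

section \<open>Block sums of weakly dependent arrays\<close>

lemma (in prob_space) expectation_mult_bound:
  fixes X Y :: "'a \<Rightarrow> real"
  assumes "Lq_le M 2 X a" "Lq_le M 2 Y b" and [measurable]: "X \<in> borel_measurable M" "Y \<in> borel_measurable M"
  shows "integrable M (\<lambda>\<omega>. X \<omega> * Y \<omega>)" "\<bar>expectation (\<lambda>\<omega>. X \<omega> * Y \<omega>)\<bar> \<le> a * b"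
proof -
  have "Lq_le M 1 (\<lambda>\<omega>. X \<omega> * Y \<omega>) (a * b)"
    using assms by (intro Lq_le_mult) auto
  from Lq_le_1_expectation(1,2)[OF this]
  show "integrable M (\<lambda>\<omega>. X \<omega> * Y \<omega>)" "\<bar>expectation (\<lambda>\<omega>. X \<omega> * Y \<omega>)\<bar> \<le> a * b"
    by auto
qed

lemma Lq_le_inner:
  fixes X :: "'a \<Rightarrow> 'b::euclidean_space"
  assumes "Lq_le M q X a" "0 < q" "norm c \<le> B" and [measurable]: "X \<in> borel_measurable M"
  shows "Lq_le M q (\<lambda>\<omega>. c \<bullet> X \<omega>) (B * a)"
proof (rule Lq_le_linear_bound[OF assms(1)])
  show "AE \<omega> in M. norm (c \<bullet> X \<omega>) \<le> B * norm (X \<omega>)"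
  proof (intro AE_I2)
    fix \<omega>
    have "norm (c \<bullet> X \<omega>) \<le> norm c * norm (X \<omega>)"
      using Cauchy_Schwarz_ineq2[of c "X \<omega>"] by simp
    also have "\<dots> \<le> B * norm (X \<omega>)"
      using assms(3) by (rule mult_right_mono) simp
    finally show "norm (c \<bullet> X \<omega>) \<le> B * norm (X \<omega>)" .
  qed
qed (use assms norm_ge_zero[of c] in \<open>auto simp del: norm_ge_zero\<close>)

text \<open>Used twice: for the centered kernels \<open>Gn n (t / n)\<close> at times
  \<open>{0..int n}\<close>, and for a kernel \<open>G v\<close> frozen at one \<open>v\<close> on
  all integers. Fourth moments are the right scale because covariances of squared block sums are
  estimated.\<close>

locale innov_array = innovations M \<epsilon> \<epsilon>s for M :: "'a measure" and \<epsilon> \<epsilon>s +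
  fixes g :: "int \<Rightarrow> (nat \<Rightarrow> real) \<Rightarrow> 'b::euclidean_space" and T :: "int set" and K \<rho> :: real
  assumes g_measurable: "t \<in> T \<Longrightarrow> g t \<in> borel_measurable seqM"
    and centered: "t \<in> T \<Longrightarrow> expectation (\<lambda>\<omega>. g t (eps_seq \<epsilon> 0 \<omega>)) = 0"
    and moment: "t \<in> T \<Longrightarrow> Lq_le M 4 (\<lambda>\<omega>. g t (eps_seq \<epsilon> 0 \<omega>)) K"
    and decay: "t \<in> T \<Longrightarrow> Lq_le M 4 (\<lambda>\<omega>. g t (eps_seq \<epsilon> t \<omega>) - g t (eps_cpl \<epsilon> \<epsilon>s t m \<omega>)) (K * \<rho> ^ m)"
    and \<rho>: "0 < \<rho>" "\<rho> < 1" and K: "0 \<le> K"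
begin

text \<open>The past up to \<open>s\<close>, and in \<open>H s\<close> all later innovations
  together with the whole copy. The two are independent, and \<open>Yc t m\<close> is measurable for
  \<open>H s\<close> when \<open>s = t - int m\<close>.\<close>

definition "F s = innov_sigma M e (Inl ` {..s})"
definition "H s = innov_sigma M e (Inl ` {s<..} \<union> range Inr)"
definition "Y t \<omega> = g t (eps_seq \<epsilon> t \<omega>)"
definition "Yc t m \<omega> = g t (eps_cpl \<epsilon> \<epsilon>s t m \<omega>)"

lemma indep_F_H:
  "A \<in> borel_measurable (F s) \<Longrightarrow> B \<in> borel_measurable (H s) \<Longrightarrow> indep_var borel A borel B"
  unfolding F_def H_def by (rule indep_var_innov_sigma) auto

lemma F_imp_M: "A \<in> borel_measurable (F s) \<Longrightarrow> A \<in> borel_measurable M"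
  unfolding F_def by (rule borel_measurable_innov_sigma_M)

lemma H_imp_M: "A \<in> borel_measurable (H s) \<Longrightarrow> A \<in> borel_measurable M"
  unfolding H_def by (rule borel_measurable_innov_sigma_M)

lemma F_mono: "A \<in> borel_measurable (F s) \<Longrightarrow> s \<le> t \<Longrightarrow> A \<in> borel_measurable (F t)"
  unfolding F_def by (rule subsetD[OF measurable_mono[OF _ _ innov_sigma_mono]]) auto

lemma Y_F: "t \<in> T \<Longrightarrow> t \<le> s \<Longrightarrow> Y t \<in> borel_measurable (F s)"
  unfolding Y_def F_def
  by (rule measurable_compose[OF eps_seq_measurable_innov g_measurable]) auto

lemma Yc_H: "t \<in> T \<Longrightarrow> s = t - int m \<Longrightarrow> Yc t m \<in> borel_measurable (H s)"
  unfolding Yc_def H_def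
  by (rule measurable_compose[OF eps_cpl_measurable_innov g_measurable]) auto

lemma Y_measurable: "t \<in> T \<Longrightarrow> Y t \<in> borel_measurable M"
  using Y_F F_imp_M by blast

lemma Yc_measurable: "t \<in> T \<Longrightarrow> Yc t m \<in> borel_measurable M"
  using Yc_H H_imp_M by blast

lemma kernel_comp_measurable[measurable (raw)]:
  "t \<in> T \<Longrightarrow> Z \<in> measurable M seqM \<Longrightarrow> (\<lambda>\<omega>. g t (Z \<omega>)) \<in> borel_measurable M"
  by (rule measurable_compose[OF _ g_measurable])

lemma Y_moment: "t \<in> T \<Longrightarrow> Lq_le M 4 (Y t) K"
  using Lq_le_distr_eq[OF distr_kernel_eq(1)[OF g_measurable, of t t 0]] moment[of t]
  by (simp add: Y_def[abs_def])

lemma Yc_moment: "t \<in> T \<Longrightarrow> Lq_le M 4 (Yc t m) K"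
  using Lq_le_distr_eq[OF distr_kernel_eq(2)[OF g_measurable, of t t m 0]] moment[of t]
  by (simp add: Yc_def[abs_def])

lemma Yc_centered: "t \<in> T \<Longrightarrow> expectation (Yc t m) = 0"
  using integral_distr_eq[OF distr_kernel_eq(2)[OF g_measurable, of t t m 0]] centered[of t]
  by (simp add: Yc_def[abs_def])

lemma Y_decay: "t \<in> T \<Longrightarrow> Lq_le M 4 (\<lambda>\<omega>. Y t \<omega> - Yc t m \<omega>) (K * \<rho> ^ m)"
  using decay by (simp add: Y_def Yc_def)

lemma Lq_le_2_of_4:
  fixes X :: "'a \<Rightarrow> 'c::{banach,second_countable_topology}"
  shows "Lq_le M 4 X a \<Longrightarrow> X \<in> borel_measurable M \<Longrightarrow> Lq_le M 2 X a"
  by (rule Lq_le_exponent_mono) auto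

text \<open>Coupling at depth \<open>t - s\<close> makes the later variable independent of
  \<open>Y s\<close> while it stays centered. Only the coupling error contributes to the covariance,
  and it is geometrically small.\<close>

lemma covariance_decay_ordered:
  assumes "s \<in> T" "t \<in> T" "s \<le> t"
  shows "\<bar>expectation (\<lambda>\<omega>. (a \<bullet> Y s \<omega>) * (c \<bullet> Y t \<omega>))\<bar> \<le> norm a * norm c * K\<^sup>2 * \<rho> ^ nat (t - s)"
proof -
  let ?m = "nat (t - s)"
  have Y[measurable]: "Y s \<in> borel_measurable M" "Y t \<in> borel_measurable M" "Yc t ?m \<in> borel_measurable M"
    using assms by (auto intro: Y_measurable Yc_measurable)
  have s2: "Lq_le M 2 (\<lambda>\<omega>. a \<bullet> Y s \<omega>) (norm a * K)"
    using Lq_le_2_of_4[OF Y_moment] assms by (intro Lq_le_inner) auto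
  have c2: "Lq_le M 2 (\<lambda>\<omega>. c \<bullet> Yc t ?m \<omega>) (norm c * K)"
    using Lq_le_2_of_4[OF Yc_moment] assms by (intro Lq_le_inner) auto
  have d2: "Lq_le M 2 (\<lambda>\<omega>. c \<bullet> (Y t \<omega> - Yc t ?m \<omega>)) (norm c * (K * \<rho> ^ ?m))"
    using Lq_le_2_of_4[OF Y_decay] assms by (intro Lq_le_inner) auto
  have ind: "indep_var borel (\<lambda>\<omega>. a \<bullet> Y s \<omega>) borel (\<lambda>\<omega>. c \<bullet> Yc t ?m \<omega>)"
  proof (rule indep_F_H[of _ s])
    have [measurable]: "Y s \<in> borel_measurable (F s)" "Yc t ?m \<in> borel_measurable (H s)"
      using assms by (auto intro!: Y_F Yc_H)
    show "(\<lambda>\<omega>. a \<bullet> Y s \<omega>) \<in> borel_measurable (F s)" "(\<lambda>\<omega>. c \<bullet> Yc t ?m \<omega>) \<in> borel_measurable (H s)"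
      by measurable
  qed
  have intYc: "integrable M (Yc t ?m)"
    by (rule Lq_le_expectation(1)[OF Yc_moment]) (use assms in auto)
  have "expectation (\<lambda>\<omega>. (a \<bullet> Y s \<omega>) * (c \<bullet> Yc t ?m \<omega>)) = expectation (\<lambda>\<omega>. a \<bullet> Y s \<omega>) * expectation (\<lambda>\<omega>. c \<bullet> Yc t ?m \<omega>)"
    using Lq_le_expectation(1)[OF s2] Lq_le_expectation(1)[OF c2]
    by (intro indep_var_lebesgue_integral ind) auto
  also have "expectation (\<lambda>\<omega>. c \<bullet> Yc t ?m \<omega>) = 0"
    using intYc Yc_centered assms by simp
  finally have 0: "expectation (\<lambda>\<omega>. (a \<bullet> Y s \<omega>) * (c \<bullet> Yc t ?m \<omega>)) = 0" by simp
  have "expectation (\<lambda>\<omega>. (a \<bullet> Y s \<omega>) * (c \<bullet> Y t \<omega>))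
     = expectation (\<lambda>\<omega>. (a \<bullet> Y s \<omega>) * (c \<bullet> Yc t ?m \<omega>) + (a \<bullet> Y s \<omega>) * (c \<bullet> (Y t \<omega> - Yc t ?m \<omega>)))"
    by (simp add: algebra_simps)
  also have "\<dots> = expectation (\<lambda>\<omega>. (a \<bullet> Y s \<omega>) * (c \<bullet> (Y t \<omega> - Yc t ?m \<omega>)))"
    using expectation_mult_bound(1)[OF s2 c2] expectation_mult_bound(1)[OF s2 d2] 0
    by (subst Bochner_Integration.integral_add) auto
  also have "\<bar>\<dots>\<bar> \<le> (norm a * K) * (norm c * (K * \<rho> ^ ?m))"
    by (rule expectation_mult_bound(2)[OF s2 d2]) auto
  finally show ?thesis by (simp add: power2_eq_square algebra_simps)
qed

lemma covariance_decay:
  assumes "s \<in> T" "t \<in> T"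
  shows "\<bar>expectation (\<lambda>\<omega>. (a \<bullet> Y s \<omega>) * (c \<bullet> Y t \<omega>))\<bar> \<le> norm a * norm c * K\<^sup>2 * \<rho> ^ nat \<bar>s - t\<bar>"
proof (cases "s \<le> t")
  case True
  then show ?thesis using covariance_decay_ordered[of s t a c] assms by simp
next
  case False
  then show ?thesis using covariance_decay_ordered[of t s c a] assms by (simp add: mult.commute mult.left_commute)
qed

lemma inner_Y_mult_integrable:
  assumes "s \<in> T" "t \<in> T"
  shows "integrable M (\<lambda>\<omega>. (a \<bullet> Y s \<omega>) * (c \<bullet> Y t \<omega>))"
proof -
  have [measurable]: "Y s \<in> borel_measurable M" "Y t \<in> borel_measurable M"
    using assms by (auto intro: Y_measurable)
  have "Lq_le M 2 (\<lambda>\<omega>. a \<bullet> Y s \<omega>) (norm a * K)" "Lq_le M 2 (\<lambda>\<omega>. c \<bullet> Y t \<omega>) (norm c * K)"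
    using Lq_le_2_of_4[OF Y_moment] assms by (auto intro!: Lq_le_inner)
  from expectation_mult_bound(1)[OF this] show ?thesis by auto
qed

section \<open>Moments and coupling of a single block sum\<close>

definition "S b t \<omega> = (\<Sum>i\<in>{1..b}. Y (t + int i) \<omega>)"

lemma S_reindex: "S b t \<omega> = (\<Sum>i\<in>{1..int b}. Y (t + i) \<omega>)"
  unfolding S_def by (rule sum.reindex_bij_witness[of _ nat int]) auto

text \<open>The square is \<open>K\<^sup>2\<close> times the bound for a row sum of the powers
  \<open>\<rho> ^ nat \<bar>i - j\<bar>\<close>; with it, \<open>A0 * sqrt (real b)\<close> bounds a
  unit projection of the block sum in mean square.\<close>

definition "A0 = sqrt (2 / (1 - \<rho>)) * K"

lemma A0_nonneg: "0 \<le> A0"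
  using K \<rho> by (simp add: A0_def)

context
  fixes b :: nat and t :: int
  assumes bT: "{t + 1..t + int b} \<subseteq> T"
begin

lemma in_block: "i \<in> {1..b} \<Longrightarrow> t + int i \<in> T"
  using bT by auto

lemma in_block_int: "i \<in> {1..int b} \<Longrightarrow> t + i \<in> T"
  using bT by auto

lemma S_measurable: "S b t \<in> borel_measurable M"
  unfolding S_def by (intro borel_measurable_sum Y_measurable in_block)

lemma S_square_expand:
  "expectation (\<lambda>\<omega>. (a \<bullet> S b t \<omega>)\<^sup>2)
    = (\<Sum>i\<in>{1..int b}. \<Sum>j\<in>{1..int b}. expectation (\<lambda>\<omega>. (a \<bullet> Y (t + i) \<omega>) * (a \<bullet> Y (t + j) \<omega>)))"
  "integrable M (\<lambda>\<omega>. (a \<bullet> S b t \<omega>)\<^sup>2)"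
proof -
  have eq: "(a \<bullet> S b t \<omega>)\<^sup>2 = (\<Sum>i\<in>{1..int b}. \<Sum>j\<in>{1..int b}. (a \<bullet> Y (t + i) \<omega>) * (a \<bullet> Y (t + j) \<omega>))" for \<omega>
    unfolding S_reindex power2_eq_square by (simp add: inner_sum_right sum_product)
  have int: "integrable M (\<lambda>\<omega>. (a \<bullet> Y (t + i) \<omega>) * (a \<bullet> Y (t + j) \<omega>))" if "i \<in> {1..int b}" "j \<in> {1..int b}" for i j
    by (rule inner_Y_mult_integrable[OF in_block_int[OF that(1)] in_block_int[OF that(2)]])
  show "expectation (\<lambda>\<omega>. (a \<bullet> S b t \<omega>)\<^sup>2)
    = (\<Sum>i\<in>{1..int b}. \<Sum>j\<in>{1..int b}. expectation (\<lambda>\<omega>. (a \<bullet> Y (t + i) \<omega>) * (a \<bullet> Y (t + j) \<omega>)))"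
    unfolding eq
    by (subst Bochner_Integration.integral_sum)
       (auto intro!: sum.cong Bochner_Integration.integral_sum Bochner_Integration.integrable_sum int)
  show "integrable M (\<lambda>\<omega>. (a \<bullet> S b t \<omega>)\<^sup>2)"
    unfolding eq by (intro Bochner_Integration.integrable_sum int)
qed

lemma S_inner_L2: "Lq_le M 2 (\<lambda>\<omega>. a \<bullet> S b t \<omega>) (norm a * A0 * sqrt (real b))"
proof (rule Lq_le_2_I)
  have "expectation (\<lambda>\<omega>. (a \<bullet> S b t \<omega>)\<^sup>2)
     \<le> (\<Sum>i\<in>{1..int b}. \<Sum>j\<in>{1..int b}. norm a * norm a * K\<^sup>2 * \<rho> ^ nat \<bar>i - j\<bar>)"
    unfolding S_square_expand(1)
  proof (intro sum_mono)
    fix i j assume "i \<in> {1..int b}" "j \<in> {1..int b}"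
    then show "expectation (\<lambda>\<omega>. (a \<bullet> Y (t + i) \<omega>) * (a \<bullet> Y (t + j) \<omega>)) \<le> norm a * norm a * K\<^sup>2 * \<rho> ^ nat \<bar>i - j\<bar>"
      using covariance_decay[of "t + i" "t + j" a a] in_block_int by (simp add: abs_le_iff)
  qed
  also have "\<dots> = (\<Sum>i\<in>{1..int b}. norm a * norm a * K\<^sup>2 * (\<Sum>j\<in>{1..int b}. \<rho> ^ nat \<bar>i - j\<bar>))"
    by (simp add: sum_distrib_left)
  also have "\<dots> \<le> (\<Sum>i\<in>{1..int b}. norm a * norm a * K\<^sup>2 * (2 / (1 - \<rho>)))"
    using \<rho> by (intro sum_mono mult_left_mono sum_power_abs_le) auto
  also have "\<dots> = (norm a * A0 * sqrt (real b))\<^sup>2"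
    using \<rho> K by (simp add: A0_def power_mult_distrib power2_eq_square[of "norm a"])
  finally show "expectation (\<lambda>\<omega>. (norm (a \<bullet> S b t \<omega>))\<^sup>2) \<le> (norm a * A0 * sqrt (real b))\<^sup>2"
    by simp
qed (use S_square_expand(2) A0_nonneg in simp_all)

lemma S_L2: "Lq_le M 2 (S b t) (real DIM('b) * A0 * sqrt (real b))"
proof -
  have [measurable]: "S b t \<in> borel_measurable M" by (rule S_measurable)
  have "Lq_le M 2 (\<lambda>\<omega>. \<Sum>k\<in>Basis. \<bar>k \<bullet> S b t \<omega>\<bar>) (\<Sum>k\<in>(Basis::'b set). A0 * sqrt (real b))"
  proof (intro Lq_le_sum)
    fix k :: 'b assume "k \<in> Basis"
    then have "Lq_le M 2 (\<lambda>\<omega>. k \<bullet> S b t \<omega>) (A0 * sqrt (real b))"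
      using S_inner_L2[of k] by simp
    then show "Lq_le M 2 (\<lambda>\<omega>. \<bar>k \<bullet> S b t \<omega>\<bar>) (A0 * sqrt (real b))"
      by (rule Lq_le_dominated) auto
  qed auto
  then have "Lq_le M 2 (S b t) (\<Sum>k\<in>(Basis::'b set). A0 * sqrt (real b))"
  proof (rule Lq_le_dominated)
    have "norm (S b t \<omega>) \<le> norm (\<Sum>k\<in>Basis. \<bar>k \<bullet> S b t \<omega>\<bar>)" for \<omega>
      using norm_le_l1[of "S b t \<omega>"] by (simp add: inner_commute)
    then show "AE \<omega> in M. norm (S b t \<omega>) \<le> norm (\<Sum>k\<in>Basis. \<bar>k \<bullet> S b t \<omega>\<bar>)" by simp
  qed auto
  then show ?thesis by (simp add: mult.assoc)
qed

lemma S_L4: "Lq_le M 4 (S b t) (real b * K)"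
proof -
  have "Lq_le M 4 (S b t) (\<Sum>i\<in>{1..b}. K)"
    unfolding S_def by (intro Lq_le_sum Y_moment Y_measurable in_block) auto
  then show ?thesis by simp
qed

text \<open>The depth grows with \<open>i\<close> so that all terms are cut at the same time
  \<open>t - r\<close>; the sum as a whole is then independent of the innovations up to that
  time.\<close>

definition "Sc r \<omega> = (\<Sum>i\<in>{1..b}. Yc (t + int i) (r + i) \<omega>)"

lemma Sc_H: "Sc r \<in> borel_measurable (H (t - int r))"
  unfolding Sc_def by (intro borel_measurable_sum Yc_H in_block) auto

lemma Sc_L4: "Lq_le M 4 (Sc r) (real b * K)"
proof -
  have "Lq_le M 4 (Sc r) (\<Sum>i\<in>{1..b}. K)"
    unfolding Sc_def by (intro Lq_le_sum Yc_moment Yc_measurable in_block) auto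
  then show ?thesis by simp
qed

text \<open>The depths \<open>r + i\<close> are distinct, so the coupling errors add up to a
  geometric tail and the bound does not grow with the block length.\<close>

lemma S_diff_L4: "Lq_le M 4 (\<lambda>\<omega>. S b t \<omega> - Sc r \<omega>) (K / (1 - \<rho>) * \<rho> ^ r)"
proof -
  have "Lq_le M 4 (\<lambda>\<omega>. \<Sum>i\<in>{1..b}. Y (t + int i) \<omega> - Yc (t + int i) (r + i) \<omega>) (\<Sum>i\<in>{1..b}. K * \<rho> ^ (r + i))"
    by (intro Lq_le_sum Y_decay borel_measurable_diff Yc_measurable Y_measurable in_block) auto
  then have "Lq_le M 4 (\<lambda>\<omega>. S b t \<omega> - Sc r \<omega>) (\<Sum>i\<in>{1..b}. K * \<rho> ^ (r + i))"
    by (simp add: S_def Sc_def sum_subtractf)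
  moreover have "(\<Sum>i\<in>{1..b}. K * \<rho> ^ (r + i)) = K * (\<Sum>i\<in>{1..b}. \<rho> ^ (r + i))"
    by (simp add: sum_distrib_left)
  moreover have "\<dots> \<le> K * (\<rho> ^ r / (1 - \<rho>))"
    using K \<rho> by (intro mult_left_mono sum_power_inj_tail_le) (auto simp: inj_on_def)
  ultimately show ?thesis
    by (auto intro: Lq_le_weaken simp: field_simps)
qed

text \<open>The estimated direction \<open>W\<close> depends only on the past of the block, so replacing the block sum
  by its coupled version makes it independent of \<open>W\<close>.\<close>
lemma predictable_direction_L2:
  assumes W: "W \<in> borel_measurable (F t)" and WB: "\<And>\<omega>. norm (W \<omega>) \<le> B" and b: "1 \<le> b"
  shows "integrable M (\<lambda>\<omega>. (W \<omega> \<bullet> S b t \<omega>)\<^sup>2)"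
    "expectation (\<lambda>\<omega>. (W \<omega> \<bullet> S b t \<omega>)\<^sup>2)
      \<le> 2 * (real DIM('b) * A0 + K / (1 - \<rho>))\<^sup>2 * (real b * expectation (\<lambda>\<omega>. (norm (W \<omega>))\<^sup>2) + B\<^sup>2)"
proof -
  have B: "0 \<le> B" using WB order_trans norm_ge_zero by blast
  have Wm[measurable]: "W \<in> borel_measurable M" by (rule F_imp_M[OF W])
  have Sm[measurable]: "S b t \<in> borel_measurable M" by (rule S_measurable)
  have ScH: "Sc 0 \<in> borel_measurable (H t)" using Sc_H[of 0] by simp
  then have Scm[measurable]: "Sc 0 \<in> borel_measurable M" by (rule H_imp_M)
  let ?a = "real DIM('b) * A0 * sqrt (real b)" and ?k = "K / (1 - \<rho>)"
  have k0: "0 \<le> ?k" using K \<rho> by simp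
  have sd2: "Lq_le M 2 (\<lambda>\<omega>. S b t \<omega> - Sc 0 \<omega>) ?k"
    using Lq_le_2_of_4[OF S_diff_L4[of 0]] by simp
  have "Lq_le M 2 (\<lambda>\<omega>. S b t \<omega> - (S b t \<omega> - Sc 0 \<omega>)) (?a + ?k)"
    by (intro Lq_le_diff S_L2 sd2) auto
  then have sc2: "Lq_le M 2 (Sc 0) (?a + ?k)" by simp
  note sc = Lq_le_2_square[OF sc2 Scm]
  note sd = Lq_le_2_square[OF sd2]
  have intW: "integrable M (\<lambda>\<omega>. (norm (W \<omega>))\<^sup>2)"
    by (rule integrable_const_bound[where B = "B\<^sup>2"]) (auto intro!: power_mono WB)
  have ind: "indep_var borel (\<lambda>\<omega>. (norm (W \<omega>))\<^sup>2) borel (\<lambda>\<omega>. (norm (Sc 0 \<omega>))\<^sup>2)"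
  proof (rule indep_F_H[of _ t])
    note [measurable] = W ScH
    show "(\<lambda>\<omega>. (norm (W \<omega>))\<^sup>2) \<in> borel_measurable (F t)" by measurable
    show "(\<lambda>\<omega>. (norm (Sc 0 \<omega>))\<^sup>2) \<in> borel_measurable (H t)" by measurable
  qed
  have intWS: "integrable M (\<lambda>\<omega>. (norm (W \<omega>))\<^sup>2 * (norm (Sc 0 \<omega>))\<^sup>2)"
    by (rule indep_var_integrable[OF ind intW sc(1)])
  have eWS: "expectation (\<lambda>\<omega>. (norm (W \<omega>))\<^sup>2 * (norm (Sc 0 \<omega>))\<^sup>2)
     = expectation (\<lambda>\<omega>. (norm (W \<omega>))\<^sup>2) * expectation (\<lambda>\<omega>. (norm (Sc 0 \<omega>))\<^sup>2)"
    by (rule indep_var_lebesgue_integral[OF ind intW sc(1)])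
  \<comment> \<open>The decoupled part will give a product of expectations. In the remainder
    \<open>W\<close> is only bounded by \<open>B\<close>, which is affordable because the coupling
    error has a bound free of \<open>b\<close>.\<close>
  have pw: "(W \<omega> \<bullet> S b t \<omega>)\<^sup>2 \<le> 2 * ((norm (W \<omega>))\<^sup>2 * (norm (Sc 0 \<omega>))\<^sup>2) + 2 * B\<^sup>2 * (norm (S b t \<omega> - Sc 0 \<omega>))\<^sup>2" for \<omega>
  proof -
    let ?x = "W \<omega> \<bullet> Sc 0 \<omega>" and ?y = "W \<omega> \<bullet> (S b t \<omega> - Sc 0 \<omega>)"
    have "W \<omega> \<bullet> S b t \<omega> = ?x + ?y" by (simp add: inner_diff_right)
    moreover have "(?x + ?y)\<^sup>2 \<le> 2 * ?x\<^sup>2 + 2 * ?y\<^sup>2"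
      using sum_squares_bound[of ?x ?y] by (simp add: power2_sum)
    moreover have "?x\<^sup>2 \<le> (norm (W \<omega>))\<^sup>2 * (norm (Sc 0 \<omega>))\<^sup>2"
      using Cauchy_Schwarz_ineq2[of "W \<omega>" "Sc 0 \<omega>"] by (metis abs_le_square_iff abs_mult abs_norm_cancel power_mult_distrib)
    moreover have "?y\<^sup>2 \<le> B\<^sup>2 * (norm (S b t \<omega> - Sc 0 \<omega>))\<^sup>2"
    proof -
      have "\<bar>?y\<bar> \<le> norm (W \<omega>) * norm (S b t \<omega> - Sc 0 \<omega>)" by (rule Cauchy_Schwarz_ineq2)
      also have "\<dots> \<le> B * norm (S b t \<omega> - Sc 0 \<omega>)" by (intro mult_right_mono WB) auto
      finally have "\<bar>?y\<bar>\<^sup>2 \<le> (B * norm (S b t \<omega> - Sc 0 \<omega>))\<^sup>2" by (intro power_mono) auto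
      then show ?thesis by (simp add: power_mult_distrib)
    qed
    ultimately show ?thesis by simp
  qed
  have intR: "integrable M (\<lambda>\<omega>. 2 * ((norm (W \<omega>))\<^sup>2 * (norm (Sc 0 \<omega>))\<^sup>2) + 2 * B\<^sup>2 * (norm (S b t \<omega> - Sc 0 \<omega>))\<^sup>2)"
    using intWS sd(1) by auto
  show int: "integrable M (\<lambda>\<omega>. (W \<omega> \<bullet> S b t \<omega>)\<^sup>2)"
    by (rule Bochner_Integration.integrable_bound[OF intR]) (use pw in \<open>auto intro!: AE_I2 order_trans[OF _ abs_ge_self]\<close>)
  have "expectation (\<lambda>\<omega>. (W \<omega> \<bullet> S b t \<omega>)\<^sup>2)
    \<le> expectation (\<lambda>\<omega>. 2 * ((norm (W \<omega>))\<^sup>2 * (norm (Sc 0 \<omega>))\<^sup>2) + 2 * B\<^sup>2 * (norm (S b t \<omega> - Sc 0 \<omega>))\<^sup>2)"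
    by (intro integral_mono int intR pw)
  also have "\<dots> = 2 * (expectation (\<lambda>\<omega>. (norm (W \<omega>))\<^sup>2) * expectation (\<lambda>\<omega>. (norm (Sc 0 \<omega>))\<^sup>2))
      + 2 * B\<^sup>2 * expectation (\<lambda>\<omega>. (norm (S b t \<omega> - Sc 0 \<omega>))\<^sup>2)"
    using intWS sd(1) eWS by simp
  also have "\<dots> \<le> 2 * (expectation (\<lambda>\<omega>. (norm (W \<omega>))\<^sup>2) * (?a + ?k)\<^sup>2) + 2 * B\<^sup>2 * ?k\<^sup>2"
    using sc(2) sd(2) by (intro add_mono mult_left_mono) auto
  also have "\<dots> \<le> 2 * (expectation (\<lambda>\<omega>. (norm (W \<omega>))\<^sup>2) * ((real DIM('b) * A0 + ?k)\<^sup>2 * real b)) + 2 * B\<^sup>2 * (real DIM('b) * A0 + ?k)\<^sup>2"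
  proof (intro add_mono mult_left_mono)
    have "1 \<le> sqrt (real b)" using b by simp
    then have "?a + ?k \<le> (real DIM('b) * A0 + ?k) * sqrt (real b)"
      using k0 mult_left_mono[of 1 "sqrt (real b)" ?k] by (simp add: algebra_simps)
    then have "(?a + ?k)\<^sup>2 \<le> ((real DIM('b) * A0 + ?k) * sqrt (real b))\<^sup>2"
      using k0 A0_nonneg by (intro power_mono) auto
    then show "(?a + ?k)\<^sup>2 \<le> (real DIM('b) * A0 + ?k)\<^sup>2 * real b"
      by (simp add: power_mult_distrib)
    show "?k\<^sup>2 \<le> (real DIM('b) * A0 + ?k)\<^sup>2"
      using k0 A0_nonneg by (intro power_mono) auto
  qed auto
  finally show "expectation (\<lambda>\<omega>. (W \<omega> \<bullet> S b t \<omega>)\<^sup>2)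
      \<le> 2 * (real DIM('b) * A0 + K / (1 - \<rho>))\<^sup>2 * (real b * expectation (\<lambda>\<omega>. (norm (W \<omega>))\<^sup>2) + B\<^sup>2)"
    by (simp add: algebra_simps)
qed

end

end

section \<open>Covariances of squared block sums\<close>

context innov_array
begin

definition "Z b d t \<omega> = (d \<bullet> S b t \<omega>)\<^sup>2 / real b"
definition "Zc b r d t \<omega> = (d \<bullet> Sc b t r \<omega>)\<^sup>2 / real b"

context
  fixes b :: nat and B :: real
  assumes b: "1 \<le> b" and B: "0 \<le> B"
begin

lemma Z_F:
  assumes "{t + 1..t + int b} \<subseteq> T"
  shows "Z b d t \<in> borel_measurable (F (t + int b))"
proof -
  have [measurable]: "S b t \<in> borel_measurable (F (t + int b))"
    unfolding S_def by (intro borel_measurable_sum Y_F) (use assms in auto)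
  show ?thesis unfolding Z_def by measurable
qed

lemma Z_L2:
  assumes "{t + 1..t + int b} \<subseteq> T" "norm d \<le> B"
  shows "Lq_le M 2 (Z b d t) (B\<^sup>2 * K\<^sup>2 * real b)"
proof -
  have [measurable]: "S b t \<in> borel_measurable M" by (rule S_measurable[OF assms(1)])
  have "Lq_le M 4 (\<lambda>\<omega>. d \<bullet> S b t \<omega>) (B * (real b * K))"
    by (intro Lq_le_inner S_L4 assms) auto
  then have "Lq_le M 2 (\<lambda>\<omega>. (d \<bullet> S b t \<omega>) * (d \<bullet> S b t \<omega>)) (B * (real b * K) * (B * (real b * K)))"
    by (intro Lq_le_mult) auto
  then have "Lq_le M 2 (Z b d t) (1 / real b * (B * (real b * K) * (B * (real b * K))))"
    by (rule Lq_le_linear_bound) (auto simp: Z_def power2_eq_square)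
  then show ?thesis
    using b by (simp add: power2_eq_square field_simps)
qed

text \<open>For overlapping blocks the truncated exponent is zero and Cauchy-Schwarz suffices. For
  blocks separated by a gap, the later one is coupled at the last time of the earlier one, which
  makes it independent of the centered variable \<open>U\<close>.\<close>

lemma Z_covariance_ordered:
  assumes t: "{t + 1..t + int b} \<subseteq> T" and s: "{s + 1..s + int b} \<subseteq> T" and ts: "t \<le> s"
    and d: "norm d \<le> B" "norm d' \<le> B"
  shows "\<bar>expectation (\<lambda>\<omega>. (Z b d t \<omega> - expectation (Z b d t)) * (Z b d' s \<omega> - expectation (Z b d' s)))\<bar>
    \<le> 4 * B ^ 4 * K ^ 4 / (1 - \<rho>) * (real b)\<^sup>2 * \<rho> ^ nat (s - t - int b)"
proof -
  define U where "U \<omega> = Z b d t \<omega> - expectation (Z b d t)" for \<omega>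
  have ZtF: "Z b d t \<in> borel_measurable (F (t + int b))" by (rule Z_F[OF t])
  have Zt[measurable]: "Z b d t \<in> borel_measurable M" by (rule F_imp_M[OF ZtF])
  have Zs[measurable]: "Z b d' s \<in> borel_measurable M" by (rule F_imp_M[OF Z_F[OF s]])
  have [measurable]: "S b s \<in> borel_measurable M" by (rule S_measurable[OF s])
  have UF: "U \<in> borel_measurable (F (t + int b))"
    unfolding U_def using ZtF by measurable
  have Um[measurable]: "U \<in> borel_measurable M" by (rule F_imp_M[OF UF])
  have U2: "Lq_le M 2 U (2 * (B\<^sup>2 * K\<^sup>2 * real b))"
    unfolding U_def by (intro Lq_le_centered Z_L2 t d) auto
  have Ui: "integrable M U" by (rule Lq_le_expectation(1)[OF U2]) auto
  have Zti: "integrable M (Z b d t)" by (rule Lq_le_expectation(1)[OF Z_L2[OF t d(1)]]) auto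
  have U0: "expectation U = 0"
    unfolding U_def using Zti by (simp add: prob_space)
  have Zs2: "Lq_le M 2 (Z b d' s) (B\<^sup>2 * K\<^sup>2 * real b)" by (rule Z_L2[OF s d(2)])
  have "expectation (\<lambda>\<omega>. U \<omega> * (Z b d' s \<omega> - expectation (Z b d' s)))
      = expectation (\<lambda>\<omega>. U \<omega> * Z b d' s \<omega> - expectation (Z b d' s) * U \<omega>)"
    by (simp add: algebra_simps)
  also have "\<dots> = expectation (\<lambda>\<omega>. U \<omega> * Z b d' s \<omega>)"
    using expectation_mult_bound(1)[OF U2 Zs2] Ui U0 by (subst Bochner_Integration.integral_diff) auto
  finally have eq: "expectation (\<lambda>\<omega>. U \<omega> * (Z b d' s \<omega> - expectation (Z b d' s))) = expectation (\<lambda>\<omega>. U \<omega> * Z b d' s \<omega>)" .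
  have bb: "real b \<le> (real b)\<^sup>2" "1 \<le> real b" using b by (auto simp: power2_eq_square)
  have r1: "1 \<le> 1 / (1 - \<rho>)" using \<rho> by simp
  have "\<bar>expectation (\<lambda>\<omega>. U \<omega> * Z b d' s \<omega>)\<bar> \<le> 4 * B ^ 4 * K ^ 4 / (1 - \<rho>) * (real b)\<^sup>2 * \<rho> ^ nat (s - t - int b)"
  proof (cases "s - t < int b")
    case True
    have "\<bar>expectation (\<lambda>\<omega>. U \<omega> * Z b d' s \<omega>)\<bar> \<le> 2 * (B\<^sup>2 * K\<^sup>2 * real b) * (B\<^sup>2 * K\<^sup>2 * real b)"
      by (rule expectation_mult_bound(2)[OF U2 Zs2]) auto
    also have "\<dots> = 2 * B ^ 4 * K ^ 4 * (real b)\<^sup>2 * 1"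
      by (simp add: power2_eq_square power4_eq_xxxx)
    also have "\<dots> \<le> 4 * B ^ 4 * K ^ 4 * (real b)\<^sup>2 * (1 / (1 - \<rho>))"
      using r1 by (intro mult_mono) auto
    finally show ?thesis using True by simp
  next
    case False
    define r where "r = nat (s - t - int b)"
    have sr: "s - int r = t + int b" using False by (simp add: r_def)
    have ScH: "Sc b s r \<in> borel_measurable (H (t + int b))"
      using Sc_H[OF s, of r] unfolding sr .
    have Scm[measurable]: "Sc b s r \<in> borel_measurable M" by (rule H_imp_M[OF ScH])
    have ZcH: "Zc b r d' s \<in> borel_measurable (H (t + int b))"
      unfolding Zc_def using ScH by measurable
    have Zcm[measurable]: "Zc b r d' s \<in> borel_measurable M" by (rule H_imp_M[OF ZcH])
    \<comment> \<open>A difference of squares is a product: one factor carries the geometric error,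
      the other is of order \<open>b\<close>, and the normalisation by \<open>b\<close> leaves a
      bound free of \<open>b\<close>.\<close>
    have D4: "Lq_le M 4 (\<lambda>\<omega>. d' \<bullet> (S b s \<omega> - Sc b s r \<omega>)) (B * (K / (1 - \<rho>) * \<rho> ^ r))"
      by (intro Lq_le_inner S_diff_L4[OF s] d) auto
    have "Lq_le M 4 (\<lambda>\<omega>. d' \<bullet> (S b s \<omega> + Sc b s r \<omega>)) (B * (real b * K + real b * K))"
      by (intro Lq_le_inner Lq_le_add S_L4[OF s] Sc_L4[OF s] d) auto
    then have "Lq_le M 2 (\<lambda>\<omega>. (d' \<bullet> (S b s \<omega> - Sc b s r \<omega>)) * (d' \<bullet> (S b s \<omega> + Sc b s r \<omega>)))
        (B * (K / (1 - \<rho>) * \<rho> ^ r) * (B * (real b * K + real b * K)))"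
      using D4 by (intro Lq_le_mult) auto
    then have "Lq_le M 2 (\<lambda>\<omega>. Z b d' s \<omega> - Zc b r d' s \<omega>) (1 / real b * (B * (K / (1 - \<rho>) * \<rho> ^ r) * (B * (real b * K + real b * K))))"
    proof (rule Lq_le_linear_bound)
      have "Z b d' s \<omega> - Zc b r d' s \<omega> = 1 / real b * ((d' \<bullet> (S b s \<omega> - Sc b s r \<omega>)) * (d' \<bullet> (S b s \<omega> + Sc b s r \<omega>)))" for \<omega>
        unfolding Z_def Zc_def by (simp add: inner_diff_right inner_add_right power2_eq_square diff_divide_distrib[symmetric] algebra_simps)
      then show "AE \<omega> in M. norm (Z b d' s \<omega> - Zc b r d' s \<omega>)
          \<le> 1 / real b * norm ((d' \<bullet> (S b s \<omega> - Sc b s r \<omega>)) * (d' \<bullet> (S b s \<omega> + Sc b s r \<omega>)))"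
        by (simp add: abs_mult)
    qed auto
    also have "1 / real b * (B * (K / (1 - \<rho>) * \<rho> ^ r) * (B * (real b * K + real b * K))) = 2 * B\<^sup>2 * K\<^sup>2 / (1 - \<rho>) * \<rho> ^ r"
      using b \<rho> by (simp add: power2_eq_square field_simps)
    finally have ZD2: "Lq_le M 2 (\<lambda>\<omega>. Z b d' s \<omega> - Zc b r d' s \<omega>) (2 * B\<^sup>2 * K\<^sup>2 / (1 - \<rho>) * \<rho> ^ r)" .
    have "Lq_le M 2 (\<lambda>\<omega>. Z b d' s \<omega> - (Z b d' s \<omega> - Zc b r d' s \<omega>)) (B\<^sup>2 * K\<^sup>2 * real b + 2 * B\<^sup>2 * K\<^sup>2 / (1 - \<rho>) * \<rho> ^ r)"
      by (intro Lq_le_diff Zs2 ZD2) auto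
    then have Zc2: "Lq_le M 2 (Zc b r d' s) (B\<^sup>2 * K\<^sup>2 * real b + 2 * B\<^sup>2 * K\<^sup>2 / (1 - \<rho>) * \<rho> ^ r)" by simp
    have Zci: "integrable M (Zc b r d' s)" by (rule Lq_le_expectation(1)[OF Zc2]) auto
    have "expectation (\<lambda>\<omega>. U \<omega> * Zc b r d' s \<omega>) = expectation U * expectation (Zc b r d' s)"
      by (rule indep_var_lebesgue_integral[OF indep_F_H[OF UF ZcH] Ui Zci])
    then have 0: "expectation (\<lambda>\<omega>. U \<omega> * Zc b r d' s \<omega>) = 0" using U0 by simp
    have "expectation (\<lambda>\<omega>. U \<omega> * Z b d' s \<omega>) = expectation (\<lambda>\<omega>. U \<omega> * Zc b r d' s \<omega> + U \<omega> * (Z b d' s \<omega> - Zc b r d' s \<omega>))"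
      by (simp add: algebra_simps)
    also have "\<dots> = expectation (\<lambda>\<omega>. U \<omega> * (Z b d' s \<omega> - Zc b r d' s \<omega>))"
      using expectation_mult_bound(1)[OF U2 Zc2] expectation_mult_bound(1)[OF U2 ZD2] 0
      by (subst Bochner_Integration.integral_add) auto
    also have "\<bar>\<dots>\<bar> \<le> 2 * (B\<^sup>2 * K\<^sup>2 * real b) * (2 * B\<^sup>2 * K\<^sup>2 / (1 - \<rho>) * \<rho> ^ r)"
      by (rule expectation_mult_bound(2)[OF U2 ZD2]) auto
    also have "\<dots> = 4 * B ^ 4 * K ^ 4 / (1 - \<rho>) * real b * \<rho> ^ r"
      by (simp add: power2_eq_square power4_eq_xxxx)
    also have "\<dots> \<le> 4 * B ^ 4 * K ^ 4 / (1 - \<rho>) * (real b)\<^sup>2 * \<rho> ^ r"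
      using bb \<rho> by (intro mult_right_mono mult_left_mono) auto
    finally show ?thesis by (simp add: r_def)
  qed
  then show ?thesis
    using eq by (simp add: U_def)
qed

lemma Z_covariance:
  assumes t: "{t + 1..t + int b} \<subseteq> T" and s: "{s + 1..s + int b} \<subseteq> T"
    and d: "norm d \<le> B" "norm d' \<le> B"
  shows "\<bar>expectation (\<lambda>\<omega>. (Z b d t \<omega> - expectation (Z b d t)) * (Z b d' s \<omega> - expectation (Z b d' s)))\<bar>
    \<le> 4 * B ^ 4 * K ^ 4 / (1 - \<rho>) * (real b)\<^sup>2 * \<rho> ^ nat (\<bar>s - t\<bar> - int b)"
proof (cases "t \<le> s")
  case True
  then show ?thesis using Z_covariance_ordered[OF t s _ d] by simp
next
  case False
  then show ?thesis using Z_covariance_ordered[OF s t _ d(2,1)] by (simp add: mult.commute)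
qed

text \<open>Fewer than \<open>2 * b\<close> indices have blocks that overlap the one at
  \<open>t\<close>, each contributing 1; the indices on either side form geometric series.\<close>

lemma sum_power_truncated_le:
  assumes "finite I"
  shows "(\<Sum>s\<in>I. \<rho> ^ nat (\<bar>s - t\<bar> - int b)) \<le> 4 / (1 - \<rho>) * real b"
proof -
  let ?N = "I \<inter> {s. \<bar>s - t\<bar> < int b}" and ?R = "I \<inter> {s. t + int b \<le> s}" and ?L = "I \<inter> {s. s \<le> t - int b}"
  have "(\<Sum>s\<in>I. \<rho> ^ nat (\<bar>s - t\<bar> - int b)) \<le> (\<Sum>s\<in>?N. \<rho> ^ nat (\<bar>s - t\<bar> - int b))
     + ((\<Sum>s\<in>?R. \<rho> ^ nat (\<bar>s - t\<bar> - int b)) + (\<Sum>s\<in>?L. \<rho> ^ nat (\<bar>s - t\<bar> - int b)))"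
  proof -
    have "?R \<inter> ?L = {}" "?N \<inter> (?R \<union> ?L) = {}" "I = ?N \<union> (?R \<union> ?L)" using b by auto
    then show ?thesis
      using assms by (smt (verit, best) finite_Int finite_UnI sum.union_disjoint)
  qed
  also have "(\<Sum>s\<in>?N. \<rho> ^ nat (\<bar>s - t\<bar> - int b)) \<le> (\<Sum>s\<in>?N. 1)"
    using \<rho> by (intro sum_mono) (auto intro: power_le_one)
  also have "(\<Sum>s\<in>?N. 1) \<le> 2 * real b"
  proof -
    have "card ?N \<le> card {t - int b<..<t + int b}" by (intro card_mono) auto
    also have "\<dots> \<le> 2 * b" by simp
    finally show ?thesis by simp
  qed
  also have "(\<Sum>s\<in>?R. \<rho> ^ nat (\<bar>s - t\<bar> - int b)) \<le> 1 / (1 - \<rho>)"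
    using assms \<rho> by (intro sum_power_inj_le) (auto simp: inj_on_def)
  also have "(\<Sum>s\<in>?L. \<rho> ^ nat (\<bar>s - t\<bar> - int b)) \<le> 1 / (1 - \<rho>)"
    using assms \<rho> b by (intro sum_power_inj_le) (auto simp: inj_on_def)
  also have "2 * real b + (1 / (1 - \<rho>) + 1 / (1 - \<rho>)) \<le> 4 / (1 - \<rho>) * real b"
  proof -
    define w where "w = 1 / (1 - \<rho>)"
    have w: "1 \<le> w" using \<rho> by (simp add: w_def)
    have "1 * real b \<le> w * real b" "w * 1 \<le> w * real b"
      using w b by (auto intro!: mult_mono)
    then have "2 * real b + (w + w) \<le> 4 * (w * real b)" by linarith
    then show ?thesis by (simp add: w_def)
  qed
  finally show ?thesis by simp
qed

text \<open>A covariance is of order \<open>b\<^sup>2\<close>, and for each index the geometric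
  weights sum to order \<open>b\<close>; together this is the factor
  \<open>real b ^ 3\<close>.\<close>

lemma Z_sum_variance:
  assumes I: "finite I" and blk: "\<And>t. t \<in> I \<Longrightarrow> {t + 1..t + int b} \<subseteq> T" and d: "\<And>t. t \<in> I \<Longrightarrow> norm (d t) \<le> B"
  shows "integrable M (\<lambda>\<omega>. (\<Sum>t\<in>I. Z b (d t) t \<omega> - expectation (Z b (d t) t))\<^sup>2)"
    "expectation (\<lambda>\<omega>. (\<Sum>t\<in>I. Z b (d t) t \<omega> - expectation (Z b (d t) t))\<^sup>2)
      \<le> 16 * B ^ 4 * K ^ 4 / (1 - \<rho>)\<^sup>2 * real (card I) * real b ^ 3"
proof -
  define U where "U t \<omega> = Z b (d t) t \<omega> - expectation (Z b (d t) t)" for t \<omega>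
  have Um[measurable]: "U t \<in> borel_measurable M" if "t \<in> I" for t
    using F_imp_M[OF Z_F[OF blk[OF that]]] unfolding U_def by measurable
  have U2: "Lq_le M 2 (U t) (2 * (B\<^sup>2 * K\<^sup>2 * real b))" if "t \<in> I" for t
    unfolding U_def by (intro Lq_le_centered Z_L2 blk d that F_imp_M[OF Z_F]) auto
  have int: "integrable M (\<lambda>\<omega>. U t \<omega> * U s \<omega>)" if "t \<in> I" "s \<in> I" for t s
    by (rule expectation_mult_bound(1)[OF U2 U2 Um Um]) (use that in auto)
  have eq: "(\<Sum>t\<in>I. U t \<omega>)\<^sup>2 = (\<Sum>t\<in>I. \<Sum>s\<in>I. U t \<omega> * U s \<omega>)" for \<omega>
    by (simp add: power2_eq_square sum_product)
  have i: "integrable M (\<lambda>\<omega>. (\<Sum>t\<in>I. U t \<omega>)\<^sup>2)"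
    unfolding eq by (intro Bochner_Integration.integrable_sum int)
  then show "integrable M (\<lambda>\<omega>. (\<Sum>t\<in>I. Z b (d t) t \<omega> - expectation (Z b (d t) t))\<^sup>2)"
    by (simp add: U_def)
  let ?C = "4 * B ^ 4 * K ^ 4 / (1 - \<rho>) * (real b)\<^sup>2"
  have C0: "0 \<le> ?C" using \<rho> by simp
  have "expectation (\<lambda>\<omega>. (\<Sum>t\<in>I. U t \<omega>)\<^sup>2) = (\<Sum>t\<in>I. \<Sum>s\<in>I. expectation (\<lambda>\<omega>. U t \<omega> * U s \<omega>))"
    unfolding eq by (subst Bochner_Integration.integral_sum)
      (auto intro!: sum.cong Bochner_Integration.integral_sum Bochner_Integration.integrable_sum int)
  also have "\<dots> \<le> (\<Sum>t\<in>I. \<Sum>s\<in>I. ?C * \<rho> ^ nat (\<bar>s - t\<bar> - int b))"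
  proof (intro sum_mono)
    fix t s assume "t \<in> I" "s \<in> I"
    then show "expectation (\<lambda>\<omega>. U t \<omega> * U s \<omega>) \<le> ?C * \<rho> ^ nat (\<bar>s - t\<bar> - int b)"
      using Z_covariance[OF blk[of t] blk[of s] d[of t] d[of s]] unfolding U_def by linarith
  qed
  also have "\<dots> = (\<Sum>t\<in>I. ?C * (\<Sum>s\<in>I. \<rho> ^ nat (\<bar>s - t\<bar> - int b)))"
    by (simp add: sum_distrib_left)
  also have "\<dots> \<le> (\<Sum>t\<in>I. ?C * (4 / (1 - \<rho>) * real b))"
    using C0 I by (intro sum_mono mult_left_mono sum_power_truncated_le)
  also have "\<dots> = 16 * B ^ 4 * K ^ 4 / (1 - \<rho>)\<^sup>2 * real (card I) * real b ^ 3"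
    by (simp add: power2_eq_square power3_eq_cube)
  finally show "expectation (\<lambda>\<omega>. (\<Sum>t\<in>I. Z b (d t) t \<omega> - expectation (Z b (d t) t))\<^sup>2)
      \<le> 16 * B ^ 4 * K ^ 4 / (1 - \<rho>)\<^sup>2 * real (card I) * real b ^ 3"
    by (simp add: U_def)
qed

text \<open>The mean stays bounded as \<open>b\<close> grows, because covariance decay makes the
  second moment of the block sum of order \<open>b\<close>. This supplies the dominating constant
  for the averages of means.\<close>

lemma Z_expectation_bound:
  assumes "{t + 1..t + int b} \<subseteq> T" "norm d \<le> B"
  shows "integrable M (Z b d t)" "0 \<le> expectation (Z b d t)" "expectation (Z b d t) \<le> B\<^sup>2 * A0\<^sup>2"
proof -
  show "integrable M (Z b d t)"
    unfolding Z_def using S_square_expand(2)[OF assms(1)] by simp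
  show "0 \<le> expectation (Z b d t)"
    unfolding Z_def by simp
  have [measurable]: "S b t \<in> borel_measurable M" by (rule S_measurable[OF assms(1)])
  have "expectation (\<lambda>\<omega>. (norm (d \<bullet> S b t \<omega>))\<^sup>2) \<le> (norm d * A0 * sqrt (real b))\<^sup>2"
    by (rule Lq_le_2_square(2)[OF S_inner_L2[OF assms(1)]]) measurable
  also have "\<dots> \<le> (B * A0 * sqrt (real b))\<^sup>2"
    using assms(2) A0_nonneg by (intro power_mono mult_right_mono) auto
  also have "\<dots> = B\<^sup>2 * A0\<^sup>2 * real b"
    by (simp add: power_mult_distrib)
  finally have *: "expectation (\<lambda>\<omega>. (d \<bullet> S b t \<omega>)\<^sup>2) \<le> B\<^sup>2 * A0\<^sup>2 * real b" by simp
  have "expectation (Z b d t) = expectation (\<lambda>\<omega>. (d \<bullet> S b t \<omega>)\<^sup>2) / real b"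
    unfolding Z_def by simp
  also have "\<dots> \<le> B\<^sup>2 * A0\<^sup>2"
    using * b by (simp add: divide_le_eq)
  finally show "expectation (Z b d t) \<le> B\<^sup>2 * A0\<^sup>2" .
qed

end

end

section \<open>Finite p-variation\<close>

text \<open>The control \<open>V x\<close> is the \<open>p\<close>-th power of the \<open>p\<close>-variation over \<open>{0..x}\<close>; it turns variation sums into
  telescoping sums.\<close>
lemma pvar_control_exists:
  fixes d :: "real \<Rightarrow> real \<Rightarrow> real"
  assumes bound: "\<And>u m. is_partition01 u m \<Longrightarrow> (\<Sum>i\<in>{1..m}. d (u (i - 1)) (u i) powr p) \<le> C"
  obtains V where "\<And>x. x \<in> {0..1} \<Longrightarrow> 0 \<le> V x \<and> V x \<le> C"
    "\<And>x y. 0 \<le> x \<Longrightarrow> x < y \<Longrightarrow> y \<le> 1 \<Longrightarrow> V x + d x y powr p \<le> V y"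
proof -
  \<comment> \<open>Partitions of \<open>{0..x}\<close>; here \<open>m = 0\<close> is allowed, so
    that there is one for \<open>x = 0\<close> as well.\<close>
  define part where "part u m x \<longleftrightarrow> u 0 = (0::real) \<and> u m = x \<and> (\<forall>i<m. u i < u (Suc i))" for u and m :: nat and x
  define s where "s u m = (\<Sum>i\<in>{1..m}. d (u (i - 1)) (u i) powr p)" for u and m :: nat
  define A where "A x = {s u m | u m. part u m x}" for x
  define V where "V x = Sup (A x)" for x
  have extend: "part (u(Suc m := y)) (Suc m) y \<and> s (u(Suc m := y)) (Suc m) = s u m + d x y powr p"
    if "part u m x" "x < y" for u m x y
    using that by (auto simp: part_def s_def less_Suc_eq intro!: sum.cong)
  have s0: "0 \<le> s u m" for u m by (auto simp: s_def intro: sum_nonneg)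
  \<comment> \<open>A partition that stops before 1 is completed by the point 1, which only adds a
    nonnegative term.\<close>
  have ub: "s u m \<le> C" if "part u m x" "x \<in> {0..1}" for u m x
  proof (cases "x = 1")
    case True
    then have "is_partition01 u m"
      using that by (cases m) (auto simp: part_def is_partition01_def)
    then show ?thesis using bound unfolding s_def by blast
  next
    case False
    then have "is_partition01 (u(Suc m := 1)) (Suc m)"
      using extend[OF that(1), of 1] that(2) by (auto simp: part_def is_partition01_def)
    from bound[OF this] extend[OF that(1), of 1] False that(2)
    have "s u m + d x 1 powr p \<le> C" unfolding s_def by auto
    then show ?thesis by (smt (verit) powr_ge_zero)
  qed
  have bdd: "bdd_above (A x)" if "x \<in> {0..1}" for x
    using ub that by (auto simp: A_def intro!: bdd_aboveI[of _ C])
  have ne: "A x \<noteq> {}" if "x \<in> {0..1}" for x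
  proof (cases "x = 0")
    case True
    then have "part (\<lambda>_. 0) 0 x" by (simp add: part_def)
    then show ?thesis by (auto simp: A_def)
  next
    case False
    then have "part (\<lambda>i. if i = 0 then 0 else x) 1 x" using that by (auto simp: part_def)
    then show ?thesis unfolding A_def by blast
  qed
  show ?thesis
  proof (rule that[of V])
    fix x :: real assume x: "x \<in> {0..1}"
    obtain a where a: "a \<in> A x" using ne[OF x] by auto
    then have "0 \<le> a" using s0 by (auto simp: A_def)
    also have "a \<le> V x" unfolding V_def by (rule cSup_upper[OF a bdd[OF x]])
    finally show "0 \<le> V x \<and> V x \<le> C"
      using ub x ne[OF x] unfolding V_def by (auto simp: A_def intro!: cSup_least)
  next
    fix x y :: real assume xy: "0 \<le> x" "x < y" "y \<le> 1"
    have "V x \<le> V y - d x y powr p"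
      unfolding V_def
    proof (rule cSup_least[OF ne])
      fix a assume "a \<in> A x"
      then obtain u m where a: "a = s u m" and "part u m x" by (auto simp: A_def)
      then have "a + d x y powr p \<in> A y"
        using extend[of u m x y] xy by (auto simp: A_def) metis
      then have "a + d x y powr p \<le> Sup (A y)"
        using xy by (intro cSup_upper bdd) auto
      then show "a \<le> Sup (A y) - d x y powr p" by simp
    qed (use xy in auto)
    then show "V x + d x y powr p \<le> V y" by simp
  qed
qed

text \<open>The control is monotone and hence has countably many discontinuities. Where it is
  continuous, \<open>d u v powr p \<le> \<bar>V u - V v\<bar>\<close> makes \<open>d u v\<close>
  small for \<open>u\<close> near \<open>v\<close>.\<close>

lemma pvar_countable_discontinuities:
  fixes d :: "real \<Rightarrow> real \<Rightarrow> real"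
  assumes bound: "\<And>u m. is_partition01 u m \<Longrightarrow> (\<Sum>i\<in>{1..m}. d (u (i - 1)) (u i) powr p) \<le> C"
    and sym: "\<And>x y. d x y = d y x" and nonneg: "\<And>x y. 0 \<le> d x y" and diag: "\<And>x. d x x = 0" and p: "0 < p"
  shows "countable {v\<in>{0..1}. \<not> (\<forall>e>0. \<exists>\<delta>>0. \<forall>u\<in>{0..1}. \<bar>u - v\<bar> < \<delta> \<longrightarrow> d u v < e)}"
proof -
  have "\<exists>V. \<forall>x y. 0 \<le> x \<longrightarrow> x < y \<longrightarrow> y \<le> 1 \<longrightarrow> V x + d x y powr p \<le> V y"
  proof (rule pvar_control_exists[of d p C])
    fix V :: "real \<Rightarrow> real"
    assume "\<And>x y. 0 \<le> x \<Longrightarrow> x < y \<Longrightarrow> y \<le> 1 \<Longrightarrow> V x + d x y powr p \<le> V y"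
    then show ?thesis by blast
  qed (rule bound)
  then obtain V where V: "\<And>x y. 0 \<le> x \<Longrightarrow> x < y \<Longrightarrow> y \<le> 1 \<Longrightarrow> V x + d x y powr p \<le> V y"
    by blast
  have "mono_on {0..1} V"
  proof (rule mono_onI)
    fix x y :: real assume xy: "x \<in> {0..1}" "y \<in> {0..1}" "x \<le> y"
    show "V x \<le> V y"
    proof (cases "x = y")
      case False
      then have "V x + d x y powr p \<le> V y" using V[of x y] xy by auto
      then show ?thesis using powr_ge_zero[of "d x y" p] by linarith
    qed simp
  qed
  then have "countable {v\<in>{0..1}. \<not> continuous (at v within {0..1}) V}"
    by (rule mono_on_ctble_discont)
  moreover have "\<forall>e>0. \<exists>\<delta>>0. \<forall>u\<in>{0..1}. \<bar>u - v\<bar> < \<delta> \<longrightarrow> d u v < e"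
    if v: "v \<in> {0..1}" and cont: "continuous (at v within {0..1}) V" for v
  proof (intro allI impI)
    fix e :: real assume e: "e > 0"
    then have "e powr p > 0" by simp
    then obtain \<delta> where \<delta>: "\<delta> > 0" "\<And>u. u \<in> {0..1} \<Longrightarrow> dist u v < \<delta> \<Longrightarrow> dist (V u) (V v) < e powr p"
      using cont unfolding continuous_within_eps_delta by blast
    have "d u v < e" if u: "u \<in> {0..1}" "\<bar>u - v\<bar> < \<delta>" for u
    proof -
      have 1: "\<bar>V u - V v\<bar> < e powr p" using \<delta>(2)[OF u(1)] u(2) by (simp add: dist_real_def)
      have "d u v powr p \<le> \<bar>V u - V v\<bar>"
        using V[of u v] V[of v u] u v sym[of u v] diag[of u] p
        by (cases u v rule: linorder_cases) auto
      with 1 have "d u v powr p < e powr p" by simp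
      then show ?thesis
        using powr_mono2[of p e "d u v"] e p by linarith
    qed
    then show "\<exists>\<delta>>0. \<forall>u\<in>{0..1}. \<bar>u - v\<bar> < \<delta> \<longrightarrow> d u v < e"
      using \<delta>(1) by blast
  qed
  ultimately show ?thesis
    by (elim countable_subset[rotated]) blast
qed

text \<open>A shift by \<open>k\<close> splits into \<open>k\<close> unit shifts, and each of them
  telescopes to a difference of two values between 0 and \<open>C\<close>.\<close>

lemma sum_shift_diff_le:
  fixes v :: "int \<Rightarrow> real"
  assumes "\<And>t. t \<in> {a..c + int k} \<Longrightarrow> 0 \<le> v t \<and> v t \<le> C" "0 \<le> C"
  shows "(\<Sum>t\<in>{a..c}. v (t + int k) - v t) \<le> real k * C"
  using assms(1)
proof (induction k)
  case 0
  then show ?case by simp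
next
  case (Suc k)
  show ?case
  proof (cases "a \<le> c")
    case True
    have tel: "(\<Sum>t\<in>{a..c}. v (t + int k + 1) - v (t + int k)) = v (c + int k + 1) - v (a + int k)"
      using True
    proof (induction c rule: int_ge_induct)
      case base
      then show ?case by simp
    next
      case (step i)
      have "{a..i + 1} = insert (i + 1) {a..i}" using step by auto
      then show ?case using step by (simp add: algebra_simps)
    qed
    have "(\<Sum>t\<in>{a..c}. v (t + int (Suc k)) - v t)
       = (\<Sum>t\<in>{a..c}. v (t + int k + 1) - v (t + int k)) + (\<Sum>t\<in>{a..c}. v (t + int k) - v t)"
      by (simp add: sum.distrib[symmetric] algebra_simps)
    also have "\<dots> \<le> C + real k * C"
    proof (rule add_mono)
      show "(\<Sum>t\<in>{a..c}. v (t + int k + 1) - v (t + int k)) \<le> C"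
        unfolding tel using Suc.prems[of "c + int k + 1"] Suc.prems[of "a + int k"] True by auto
      show "(\<Sum>t\<in>{a..c}. v (t + int k) - v t) \<le> real k * C"
        by (rule Suc.IH) (use Suc.prems in auto)
    qed
    finally show ?thesis by (simp add: algebra_simps)
  qed (use assms(2) in auto)
qed

text \<open>Young's inequality with the constant \<open>A\<close> chosen so that \<open>n * A powr r\<close> bounds the \<open>r\<close>-variation sum.\<close>
lemma sum_squares_pvar_le:
  fixes x :: "'i \<Rightarrow> real"
  assumes I: "finite I" "real (card I) \<le> n" and x: "\<And>i. i \<in> I \<Longrightarrow> 0 \<le> x i \<and> x i \<le> c" and c: "0 < c"
    and sum: "(\<Sum>i\<in>I. x i powr p) \<le> k * C" and p: "1 \<le> p" and pos: "0 < n" "0 < k" "0 < C"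
  shows "(\<Sum>i\<in>I. (x i)\<^sup>2) \<le> n * ((c powr (max p 2 - p) * C) * (k / n)) powr (2 / max p 2)"
proof -
  \<comment> \<open>Comparison with squares needs an exponent of at least 2. For
    \<open>p < 2\<close> the uniform bound \<open>c\<close> converts \<open>p\<close>-th powers into
    powers with exponent \<open>r\<close>.\<close>
  define r where "r = max p 2"
  have r: "2 \<le> r" "p \<le> r" by (auto simp: r_def)
  define A where "A = ((c powr (r - p) * C) * (k / n)) powr (1 / r)"
  have A: "0 < A" "A powr r = (c powr (r - p) * C) * (k / n)"
    using c pos r by (auto simp: A_def powr_powr)
  have A2: "A\<^sup>2 = ((c powr (r - p) * C) * (k / n)) powr (2 / r)"
    using A(1) by (simp add: A_def powr_powr flip: powr_numeral)
  have xr: "x i powr r \<le> c powr (r - p) * x i powr p" if "i \<in> I" for i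
  proof (cases "x i = 0")
    case False
    then have "x i powr r = x i powr (r - p) * x i powr p" by (simp flip: powr_add)
    also have "\<dots> \<le> c powr (r - p) * x i powr p"
      using x[OF that] r by (intro mult_right_mono powr_mono2) auto
    finally show ?thesis .
  qed simp
  have "(\<Sum>i\<in>I. (x i)\<^sup>2) \<le> (\<Sum>i\<in>I. A\<^sup>2 * (1 - 2 / r) + A\<^sup>2 * (2 / r) / A powr r * x i powr r)"
  proof (rule sum_mono)
    fix i assume "i \<in> I"
    then show "(x i)\<^sup>2 \<le> A\<^sup>2 * (1 - 2 / r) + A\<^sup>2 * (2 / r) / A powr r * x i powr r"
      using powr_le_Young[of A 2 r "x i"] A(1) r x by simp
  qed
  also have "\<dots> = real (card I) * (A\<^sup>2 * (1 - 2 / r)) + A\<^sup>2 * (2 / r) / A powr r * (\<Sum>i\<in>I. x i powr r)"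
    by (simp add: sum.distrib sum_distrib_left)
  also have "\<dots> \<le> n * (A\<^sup>2 * (1 - 2 / r)) + A\<^sup>2 * (2 / r) / A powr r * (n * A powr r)"
  proof (intro add_mono mult_right_mono mult_left_mono I)
    have "(\<Sum>i\<in>I. x i powr r) \<le> c powr (r - p) * (\<Sum>i\<in>I. x i powr p)"
      unfolding sum_distrib_left by (intro sum_mono xr)
    also have "\<dots> \<le> c powr (r - p) * (k * C)"
      using sum by (intro mult_left_mono) auto
    also have "\<dots> = n * A powr r" unfolding A(2) using pos by simp
    finally show "(\<Sum>i\<in>I. x i powr r) \<le> n * A powr r" .
  qed (use r A(1) in auto)
  also have "\<dots> = n * A\<^sup>2"
    using A(1) r by (simp add: field_simps)
  finally show ?thesis unfolding A2 r_def .
qed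

section \<open>The locally stationary model\<close>

text \<open>The norm on matrices is the Frobenius norm, so Cauchy-Schwarz row by row is enough. This
  is how the Hessian bound controls the operator norm.\<close>

lemma norm_matrix_vector_mult_le:
  fixes A :: "real^'n^'m"
  shows "norm (A *v x) \<le> norm A * norm x"
proof -
  have "norm (A *v x) \<le> L2_set (\<lambda>i. norm (A $ i) * norm x) UNIV"
    unfolding norm_vec_def[of "A *v x"]
  proof (rule L2_set_mono)
    show "norm ((A *v x) $ i) \<le> norm (A $ i) * norm x" for i
      using Cauchy_Schwarz_ineq2[of "A $ i" x]
      by (simp add: matrix_vector_mult_def inner_vec_def)
  qed simp
  also have "\<dots> = norm A * norm x"
    by (simp add: L2_set_left_distrib norm_vec_def[of A])
  finally show ?thesis .
qed

locale block_estimation = innovations M \<epsilon> \<epsilon>s for M :: "'a measure" and \<epsilon> \<epsilon>s +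
  fixes Gn :: "nat \<Rightarrow> real \<Rightarrow> (nat \<Rightarrow> real) \<Rightarrow> real^'d"
    and G :: "real \<Rightarrow> (nat \<Rightarrow> real) \<Rightarrow> real^'d"
    and Df :: "real^'d \<Rightarrow> real^'d"
    and D2f :: "real^'d \<Rightarrow> real^'d^'d"
    and q p C\<^sub>G C\<^sub>f \<rho> :: real
    and \<delta> :: ereal
    and mu :: "real \<Rightarrow> real^'d" and mun :: "nat \<Rightarrow> real \<Rightarrow> real^'d" and Mdelta :: "(real^'d) set"
  assumes mu_eq: "mu = (\<lambda>u. expectation (\<lambda>\<omega>. G u (eps_seq \<epsilon> 0 \<omega>)))"
    and mun_eq: "mun = (\<lambda>n u. expectation (\<lambda>\<omega>. Gn n u (eps_seq \<epsilon> 0 \<omega>)))"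
    and Mdelta_eq: "Mdelta = {x. \<exists>y\<in>convex hull (mu ` {0..1}). ereal (dist x y) < \<delta>}"
    and meas_Gn: "\<forall>n. (\<lambda>(u, x). Gn n u x) \<in> borel_measurable (borel \<Otimes>\<^sub>M seqM)"
    and meas_G: "(\<lambda>(u, x). G u x) \<in> borel_measurable (borel \<Otimes>\<^sub>M seqM)"
    and q: "q > 4" and p: "1 \<le> p"
    and A1: "\<forall>e>0. eventually (\<lambda>n. \<forall>u\<in>{0..1}.
               Lq_le M q (\<lambda>\<omega>. Gn n u (eps_seq \<epsilon> 0 \<omega>) - G u (eps_seq \<epsilon> 0 \<omega>)) e) sequentially"
    and A2_fin: "\<forall>n. \<forall>u\<in>{0..1}. Lq_moment M q (\<lambda>\<omega>. Gn n u (eps_seq \<epsilon> 0 \<omega>)) < \<infinity>"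
    and A2: "\<forall>n n' w u m. w \<in> {0..1} \<longrightarrow> is_partition01 u m \<longrightarrow>
               Lq_norm M q (\<lambda>\<omega>. Gn n w (eps_seq \<epsilon> 0 \<omega>)) +
               (\<Sum>i\<in>{1..m}. Lq_norm M q (\<lambda>\<omega>. Gn n' (u i) (eps_seq \<epsilon> 0 \<omega>)
                                              - Gn n' (u (i - 1)) (eps_seq \<epsilon> 0 \<omega>)) powr p) powr (1 / p)
               \<le> C\<^sub>G"
    and \<rho>: "0 < \<rho>" "\<rho> < 1"
    and A3: "\<forall>t j n. \<forall>u\<in>{0..1}.
               Lq_le M q (\<lambda>\<omega>. Gn n u (eps_seq \<epsilon> t \<omega>) - Gn n u (eps_tilde \<epsilon> \<epsilon>s t j \<omega>)) (C\<^sub>G * \<rho> ^ j)"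
    and \<delta>: "0 < \<delta>"
    and Df_diff: "\<forall>x. (Df has_derivative (\<lambda>h. D2f x *v h)) (at x)"
    and A4: "\<forall>x\<in>Mdelta. norm (Df x) + norm (D2f x) \<le> C\<^sub>f"
begin

lemma Gn_measurable[measurable]: "Gn n u \<in> borel_measurable seqM"
  using measurable_compose[OF measurable_Pair1'[of u borel seqM] meas_Gn[rule_format, of n]] by simp

lemma G_measurable[measurable]: "G u \<in> borel_measurable seqM"
  using measurable_compose[OF measurable_Pair1'[of u borel seqM] meas_G] by simp

lemma Lq_norm_nonneg: "0 \<le> Lq_norm M q X"
  by (simp add: Lq_norm_def)

lemma Gn_norm_le:
  assumes "w \<in> {0..1}" shows "Lq_norm M q (\<lambda>\<omega>. Gn n w (eps_seq \<epsilon> 0 \<omega>)) \<le> C\<^sub>G"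
proof -
  \<comment> \<open>\<open>A2\<close> bounds the norm plus a nonnegative variation term, so a single
    partition extracts the norm.\<close>
  have "is_partition01 real 1" by (simp add: is_partition01_def)
  then have "Lq_norm M q (\<lambda>\<omega>. Gn n w (eps_seq \<epsilon> 0 \<omega>)) +
               (\<Sum>i\<in>{1..1::nat}. Lq_norm M q (\<lambda>\<omega>. Gn n (real i) (eps_seq \<epsilon> 0 \<omega>)
                         - Gn n (real (i - 1)) (eps_seq \<epsilon> 0 \<omega>)) powr p) powr (1 / p) \<le> C\<^sub>G"
    using A2 assms by blast
  then show ?thesis by (smt (verit) powr_ge_zero)
qed

lemma C\<^sub>G_nonneg: "0 \<le> C\<^sub>G"
  using Gn_norm_le[of 0 0] Lq_norm_nonneg[of "\<lambda>\<omega>. Gn 0 0 (eps_seq \<epsilon> 0 \<omega>)"] by simp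

lemma Gn_Lq: "u \<in> {0..1} \<Longrightarrow> Lq_le M q (\<lambda>\<omega>. Gn n u (eps_seq \<epsilon> 0 \<omega>)) C\<^sub>G"
  using q A2_fin by (intro Lq_le_weaken[OF Lq_le_Lq_norm Gn_norm_le]) auto

lemma Gn_minus_G_shift:
  assumes "Lq_le M q (\<lambda>\<omega>. Gn n u (eps_seq \<epsilon> 0 \<omega>) - G u (eps_seq \<epsilon> 0 \<omega>)) c"
  shows "Lq_le M q (\<lambda>\<omega>. Gn n u (eps_seq \<epsilon> t \<omega>) - G u (eps_seq \<epsilon> t \<omega>)) c"
    "Lq_le M q (\<lambda>\<omega>. Gn n u (eps_cpl \<epsilon> \<epsilon>s t m \<omega>) - G u (eps_cpl \<epsilon> \<epsilon>s t m \<omega>)) c"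
  using assms Lq_le_distr_eq[OF distr_kernel_eq(1)[of "\<lambda>x. Gn n u x - G u x" t 0]]
    Lq_le_distr_eq[OF distr_kernel_eq(2)[of "\<lambda>x. Gn n u x - G u x" t m 0]]
  by auto

lemma Gn_close:
  assumes "c > 0"
  obtains n where "\<And>u. u \<in> {0..1} \<Longrightarrow> Lq_le M q (\<lambda>\<omega>. Gn n u (eps_seq \<epsilon> 0 \<omega>) - G u (eps_seq \<epsilon> 0 \<omega>)) c"
  using eventually_happens'[OF sequentially_bot A1[rule_format, OF assms]] by (elim exE) (rule that, blast)

lemma G_Lq: assumes u: "u \<in> {0..1}" shows "Lq_le M q (\<lambda>\<omega>. G u (eps_seq \<epsilon> 0 \<omega>)) C\<^sub>G"
proof (rule Lq_le_closed)
  fix c :: real assume "c > 0"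
  from Gn_close[OF this] obtain n where "Lq_le M q (\<lambda>\<omega>. Gn n u (eps_seq \<epsilon> 0 \<omega>) - G u (eps_seq \<epsilon> 0 \<omega>)) c"
    using u by metis
  from Lq_le_diff[OF Gn_Lq[OF u, of n] this]
  show "Lq_le M q (\<lambda>\<omega>. G u (eps_seq \<epsilon> 0 \<omega>)) (C\<^sub>G + c)"
    using q by simp
qed (use q C\<^sub>G_nonneg in auto)

lemma Gn_coupling:
  assumes u: "u \<in> {0..1}"
  shows "Lq_le M q (\<lambda>\<omega>. Gn n u (eps_seq \<epsilon> t \<omega>) - Gn n u (eps_cpl \<epsilon> \<epsilon>s t m \<omega>)) (C\<^sub>G * \<rho> ^ m / (1 - \<rho>))"
proof (rule coupling_Lq_le)
  have "Lq_le M q (\<lambda>\<omega>. Gn n u (eps_seq \<epsilon> t \<omega>)) C\<^sub>G"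
    using Gn_Lq[OF u, of n] Lq_le_distr_eq[OF distr_kernel_eq(1)[of "Gn n u" t 0]] by simp
  then show "integrable M (\<lambda>\<omega>. Gn n u (eps_seq \<epsilon> t \<omega>))"
    by (rule Lq_le_expectation(1)) (use q in auto)
qed (use q \<rho> A3 u in auto)

text \<open>Inherited from \<open>Gn\<close>: the approximation error is the same at the original
  and at the coupled sequence because their laws agree, and it can be made arbitrarily
  small.\<close>

lemma G_coupling:
  assumes u: "u \<in> {0..1}"
  shows "Lq_le M q (\<lambda>\<omega>. G u (eps_seq \<epsilon> t \<omega>) - G u (eps_cpl \<epsilon> \<epsilon>s t m \<omega>)) (C\<^sub>G * \<rho> ^ m / (1 - \<rho>))"
proof (rule Lq_le_closed)
  fix c :: real assume "c > 0"
  then have "c / 2 > 0" by simp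
  from Gn_close[OF this] obtain n where n: "Lq_le M q (\<lambda>\<omega>. Gn n u (eps_seq \<epsilon> 0 \<omega>) - G u (eps_seq \<epsilon> 0 \<omega>)) (c / 2)"
    using u by metis
  have "Lq_le M q (\<lambda>\<omega>. ((Gn n u (eps_seq \<epsilon> t \<omega>) - Gn n u (eps_cpl \<epsilon> \<epsilon>s t m \<omega>))
         - (Gn n u (eps_seq \<epsilon> t \<omega>) - G u (eps_seq \<epsilon> t \<omega>)))
         + (Gn n u (eps_cpl \<epsilon> \<epsilon>s t m \<omega>) - G u (eps_cpl \<epsilon> \<epsilon>s t m \<omega>)))
      (C\<^sub>G * \<rho> ^ m / (1 - \<rho>) + c / 2 + c / 2)"
    by (intro Lq_le_add Lq_le_diff Gn_coupling[OF u] Gn_minus_G_shift[OF n]) (use q in auto)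
  then show "Lq_le M q (\<lambda>\<omega>. G u (eps_seq \<epsilon> t \<omega>) - G u (eps_cpl \<epsilon> \<epsilon>s t m \<omega>)) (C\<^sub>G * \<rho> ^ m / (1 - \<rho>) + c)"
    by (simp add: add.commute)
qed (use q C\<^sub>G_nonneg \<rho> in auto)

text \<open>Meets two demands of \<open>innov_array\<close> at once: centering doubles the moment
  bound, and replacing infinitely many coordinates costs the factor
  \<open>1 / (1 - \<rho>)\<close>.\<close>

definition "K = 2 * C\<^sub>G / (1 - \<rho>)"

lemma K_bounds: "0 \<le> K" "2 * C\<^sub>G \<le> K" "C\<^sub>G * \<rho> ^ m / (1 - \<rho>) \<le> K * \<rho> ^ m"
proof -
  have r: "1 \<le> 1 / (1 - \<rho>)" using \<rho> by simp
  show "0 \<le> K" using C\<^sub>G_nonneg \<rho> by (simp add: K_def)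
  show "2 * C\<^sub>G \<le> K"
    using mult_left_mono[OF r, of "2 * C\<^sub>G"] C\<^sub>G_nonneg by (simp add: K_def)
  have "C\<^sub>G / (1 - \<rho>) \<le> K" using C\<^sub>G_nonneg \<rho> by (simp add: K_def divide_right_mono)
  then show "C\<^sub>G * \<rho> ^ m / (1 - \<rho>) \<le> K * \<rho> ^ m"
    using mult_right_mono[of "C\<^sub>G / (1 - \<rho>)" K "\<rho> ^ m"] \<rho> by simp
qed

lemma innov_array_kernel:
  assumes g: "\<And>t. t \<in> T \<Longrightarrow> g t \<in> borel_measurable seqM"
    and mom: "\<And>t. t \<in> T \<Longrightarrow> Lq_le M q (\<lambda>\<omega>. g t (eps_seq \<epsilon> 0 \<omega>)) C\<^sub>G"
    and cpl: "\<And>t m. t \<in> T \<Longrightarrow> Lq_le M q (\<lambda>\<omega>. g t (eps_seq \<epsilon> t \<omega>) - g t (eps_cpl \<epsilon> \<epsilon>s t m \<omega>)) (C\<^sub>G * \<rho> ^ m / (1 - \<rho>))"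
  shows "innov_array M \<epsilon> \<epsilon>s (\<lambda>t x. g t x - expectation (\<lambda>\<omega>. g t (eps_seq \<epsilon> 0 \<omega>))) T K \<rho>"
proof (intro innov_array.intro innov_array_axioms.intro)
  show "innovations M \<epsilon> \<epsilon>s" by (rule innovations_axioms)
next
  fix t assume t: "t \<in> T"
  note [measurable] = g[OF t]
  show "(\<lambda>x. g t x - expectation (\<lambda>\<omega>. g t (eps_seq \<epsilon> 0 \<omega>))) \<in> borel_measurable seqM"
    by measurable
  have "integrable M (\<lambda>\<omega>. g t (eps_seq \<epsilon> 0 \<omega>))"
    by (rule Lq_le_expectation(1)[OF mom[OF t]]) (use q in auto)
  then show "expectation (\<lambda>\<omega>. g t (eps_seq \<epsilon> 0 \<omega>) - expectation (\<lambda>\<omega>. g t (eps_seq \<epsilon> 0 \<omega>))) = 0"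
    by (simp add: prob_space)
  have "Lq_le M q (\<lambda>\<omega>. g t (eps_seq \<epsilon> 0 \<omega>) - expectation (\<lambda>\<omega>. g t (eps_seq \<epsilon> 0 \<omega>))) (2 * C\<^sub>G)"
    by (rule Lq_le_centered[OF mom[OF t]]) (use q in auto)
  then have "Lq_le M 4 (\<lambda>\<omega>. g t (eps_seq \<epsilon> 0 \<omega>) - expectation (\<lambda>\<omega>. g t (eps_seq \<epsilon> 0 \<omega>))) (2 * C\<^sub>G)"
    by (rule Lq_le_exponent_mono) (use q in auto)
  then show "Lq_le M 4 (\<lambda>\<omega>. g t (eps_seq \<epsilon> 0 \<omega>) - expectation (\<lambda>\<omega>. g t (eps_seq \<epsilon> 0 \<omega>))) K"
    by (rule Lq_le_weaken) (use K_bounds in auto)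
  fix m
  have "Lq_le M 4 (\<lambda>\<omega>. g t (eps_seq \<epsilon> t \<omega>) - g t (eps_cpl \<epsilon> \<epsilon>s t m \<omega>)) (C\<^sub>G * \<rho> ^ m / (1 - \<rho>))"
    by (rule Lq_le_exponent_mono[OF cpl[OF t]]) (use q in auto)
  then have "Lq_le M 4 (\<lambda>\<omega>. g t (eps_seq \<epsilon> t \<omega>) - g t (eps_cpl \<epsilon> \<epsilon>s t m \<omega>)) (K * \<rho> ^ m)"
    by (rule Lq_le_weaken) (use K_bounds in auto)
  then show "Lq_le M 4 (\<lambda>\<omega>. g t (eps_seq \<epsilon> t \<omega>) - expectation (\<lambda>\<omega>. g t (eps_seq \<epsilon> 0 \<omega>))
     - (g t (eps_cpl \<epsilon> \<epsilon>s t m \<omega>) - expectation (\<lambda>\<omega>. g t (eps_seq \<epsilon> 0 \<omega>)))) (K * \<rho> ^ m)"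
    by simp
qed (use \<rho> K_bounds in auto)

lemma array_n:
  assumes "1 \<le> n"
  shows "innov_array M \<epsilon> \<epsilon>s (\<lambda>t x. Gn n (real_of_int t / real n) x - mun n (real_of_int t / real n)) {0..int n} K \<rho>"
  unfolding mun_eq
proof (rule innov_array_kernel)
  fix t assume "t \<in> {0..int n}"
  then have u: "real_of_int t / real n \<in> {0..1}" using assms by auto
  show "Lq_le M q (\<lambda>\<omega>. Gn n (real_of_int t / real n) (eps_seq \<epsilon> 0 \<omega>)) C\<^sub>G"
    by (rule Gn_Lq[OF u])
  show "Lq_le M q (\<lambda>\<omega>. Gn n (real_of_int t / real n) (eps_seq \<epsilon> t \<omega>)
     - Gn n (real_of_int t / real n) (eps_cpl \<epsilon> \<epsilon>s t m \<omega>)) (C\<^sub>G * \<rho> ^ m / (1 - \<rho>))" for m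
    by (rule Gn_coupling[OF u])
qed auto

lemma array_G:
  assumes "v \<in> {0..1}"
  shows "innov_array M \<epsilon> \<epsilon>s (\<lambda>t x. G v x - mu v) UNIV K \<rho>"
  unfolding mu_eq by (rule innov_array_kernel) (auto intro: G_Lq[OF assms] G_coupling[OF assms])

section \<open>Means, the neighbourhood of their convex hull, and the gradient on it\<close>

lemma mun_minus_mu_le:
  assumes u: "u \<in> {0..1}" "v \<in> {0..1}"
    and c: "Lq_le M q (\<lambda>\<omega>. Gn n u (eps_seq \<epsilon> 0 \<omega>) - G v (eps_seq \<epsilon> 0 \<omega>)) c"
  shows "norm (mun n u - mu v) \<le> c"
proof -
  have i: "integrable M (\<lambda>\<omega>. Gn n u (eps_seq \<epsilon> 0 \<omega>))" "integrable M (\<lambda>\<omega>. G v (eps_seq \<epsilon> 0 \<omega>))"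
    using q by (auto intro!: Lq_le_expectation(1)[OF Gn_Lq[OF u(1)]] Lq_le_expectation(1)[OF G_Lq[OF u(2)]])
  have "norm (expectation (\<lambda>\<omega>. Gn n u (eps_seq \<epsilon> 0 \<omega>) - G v (eps_seq \<epsilon> 0 \<omega>))) \<le> c"
    by (rule Lq_le_expectation(2)[OF c]) (use q in auto)
  then show ?thesis using i by (simp add: mu_eq mun_eq)
qed

lemma mun_uniform:
  assumes "c > 0"
  shows "eventually (\<lambda>n. \<forall>u\<in>{0..1}. norm (mun n u - mu u) \<le> c) sequentially"
  using A1[rule_format, OF assms] by eventually_elim (auto intro: mun_minus_mu_le)

lemma mu_Mdelta: "u \<in> {0..1} \<Longrightarrow> mu u \<in> Mdelta"
  unfolding Mdelta_eq using \<delta> by (auto intro!: bexI[of _ "mu u"] hull_inc simp: zero_ereal_def)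

lemma mun_Mdelta: "eventually (\<lambda>n. \<forall>u\<in>{0..1}. mun n u \<in> Mdelta) sequentially"
proof -
  \<comment> \<open>As \<delta> may be infinite, a real radius below it is used.\<close>
  obtain c :: real where c: "c > 0" "ereal c < \<delta>"
    using \<delta> ereal_dense2[of 0 \<delta>] by (auto simp: zero_ereal_def)
  show ?thesis
    using mun_uniform[OF c(1)]
  proof eventually_elim
    case (elim n)
    show ?case
    proof
      fix u :: real assume u: "u \<in> {0..1}"
      have "ereal (dist (mun n u) (mu u)) \<le> ereal c" using elim u by (auto simp: dist_norm)
      also note c(2)
      finally show "mun n u \<in> Mdelta"
        unfolding Mdelta_eq using u by (auto intro!: bexI[of _ "mu u"] hull_inc)
    qed
  qed
qed

lemma Mdelta_open: "open Mdelta"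
proof -
  have "Mdelta = (\<Union>y\<in>convex hull (mu ` {0..1}). {x. ereal (dist x y) < \<delta>})"
    unfolding Mdelta_eq by auto
  moreover have "open {x. ereal (dist x y) < \<delta>}" for y :: "real^'d"
    by (intro open_Collect_less continuous_intros)
  ultimately show ?thesis by auto
qed

text \<open>Convexity is what turns the Hessian bound into a Lipschitz bound for \<open>Df\<close>.
  Comparing with the larger of the two distances avoids arithmetic with a possibly infinite
  \<delta>.\<close>

lemma Mdelta_convex: "convex Mdelta"
proof (rule convexI)
  fix x x' :: "real^'d" and s t :: real
  assume x: "x \<in> Mdelta" "x' \<in> Mdelta" and st: "0 \<le> s" "0 \<le> t" "s + t = 1"
  obtain y y' where y: "y \<in> convex hull (mu ` {0..1})" "ereal (dist x y) < \<delta>"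
    "y' \<in> convex hull (mu ` {0..1})" "ereal (dist x' y') < \<delta>"
    using x by (auto simp: Mdelta_eq)
  let ?m = "max (dist x y) (dist x' y')"
  have "dist (s *\<^sub>R x + t *\<^sub>R x') (s *\<^sub>R y + t *\<^sub>R y') \<le> s * dist x y + t * dist x' y'"
  proof -
    have "s *\<^sub>R x + t *\<^sub>R x' - (s *\<^sub>R y + t *\<^sub>R y') = s *\<^sub>R (x - y) + t *\<^sub>R (x' - y')"
      by (simp add: algebra_simps)
    then show ?thesis
      using norm_triangle_ineq[of "s *\<^sub>R (x - y)" "t *\<^sub>R (x' - y')"] st by (simp add: dist_norm)
  qed
  also have "\<dots> \<le> s * ?m + t * ?m" using st by (intro add_mono mult_left_mono) auto
  also have "\<dots> = ?m" using st by (simp flip: distrib_right)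
  finally have "ereal (dist (s *\<^sub>R x + t *\<^sub>R x') (s *\<^sub>R y + t *\<^sub>R y')) \<le> ereal ?m" by (simp only: ereal_less_eq)
  also have "\<dots> < \<delta>" using y by (auto simp: max_def)
  finally show "s *\<^sub>R x + t *\<^sub>R x' \<in> Mdelta"
    unfolding Mdelta_eq using convexD[OF convex_convex_hull y(1,3) st] by blast
qed

lemma Df_bound: "x \<in> Mdelta \<Longrightarrow> norm (Df x) \<le> C\<^sub>f"
  using A4[rule_format, of x] norm_ge_zero[of "D2f x"] by linarith

lemma C\<^sub>f_nonneg: "0 \<le> C\<^sub>f"
  using Df_bound[OF mu_Mdelta[of 0]] norm_ge_zero[of "Df (mu 0)"] by (auto simp del: norm_ge_zero)

lemma Df_Lipschitz:
  assumes "x \<in> Mdelta" "y \<in> Mdelta"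
  shows "norm (Df x - Df y) \<le> C\<^sub>f * norm (x - y)"
proof (rule differentiable_bound[OF Mdelta_convex])
  fix z assume z: "z \<in> Mdelta"
  show "(Df has_derivative (\<lambda>h. D2f z *v h)) (at z within Mdelta)"
    using Df_diff has_derivative_at_withinI by blast
  have "norm (D2f z) \<le> C\<^sub>f"
    using A4[rule_format, OF z] norm_ge_zero[of "Df z"] by linarith
  then show "onorm ((*v) (D2f z)) \<le> C\<^sub>f"
    by (intro onorm_le order_trans[OF norm_matrix_vector_mult_le] mult_right_mono) auto
qed (use assms in auto)

lemma Df_continuous: "continuous_on UNIV Df"
  using Df_diff by (meson continuous_at_imp_continuous_on has_derivative_continuous)

section \<open>Variation of the kernels in their spatial parameter\<close>

definition "dn n x y = Lq_norm M q (\<lambda>\<omega>. Gn n y (eps_seq \<epsilon> 0 \<omega>) - Gn n x (eps_seq \<epsilon> 0 \<omega>))"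
definition "dG x y = Lq_norm M q (\<lambda>\<omega>. G y (eps_seq \<epsilon> 0 \<omega>) - G x (eps_seq \<epsilon> 0 \<omega>))"

lemma dn_Lq_le:
  assumes "x \<in> {0..1}" "y \<in> {0..1}"
  shows "Lq_le M q (\<lambda>\<omega>. Gn n y (eps_seq \<epsilon> 0 \<omega>) - Gn n x (eps_seq \<epsilon> 0 \<omega>)) (dn n x y)"
proof -
  have "Lq_le M q (\<lambda>\<omega>. Gn n y (eps_seq \<epsilon> 0 \<omega>) - Gn n x (eps_seq \<epsilon> 0 \<omega>)) (C\<^sub>G + C\<^sub>G)"
    by (intro Lq_le_diff Gn_Lq assms) (use q in auto)
  from Lq_le_Lq_norm[OF Lq_le_finite[OF this]] q show ?thesis by (simp add: dn_def)
qed

lemma dG_Lq_le: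
  assumes "x \<in> {0..1}" "y \<in> {0..1}"
  shows "Lq_le M q (\<lambda>\<omega>. G y (eps_seq \<epsilon> 0 \<omega>) - G x (eps_seq \<epsilon> 0 \<omega>)) (dG x y)"
proof -
  have "Lq_le M q (\<lambda>\<omega>. G y (eps_seq \<epsilon> 0 \<omega>) - G x (eps_seq \<epsilon> 0 \<omega>)) (C\<^sub>G + C\<^sub>G)"
    by (intro Lq_le_diff G_Lq assms) (use q in auto)
  from Lq_le_Lq_norm[OF Lq_le_finite[OF this]] q show ?thesis by (simp add: dG_def)
qed

lemma dn_nonneg: "0 \<le> dn n x y" by (simp add: dn_def Lq_norm_def)
lemma dG_nonneg: "0 \<le> dG x y" by (simp add: dG_def Lq_norm_def)

lemma dG_sym: "dG x y = dG y x"
  by (simp add: dG_def Lq_norm_def Lq_moment_def norm_minus_commute)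

lemma dG_diag: "dG x x = 0"
  using q by (simp add: dG_def Lq_norm_def Lq_moment_def)

lemma dn_partition_bound:
  assumes "is_partition01 u m"
  shows "(\<Sum>i\<in>{1..m}. dn n (u (i - 1)) (u i) powr p) \<le> C\<^sub>G powr p"
proof -
  let ?s = "\<Sum>i\<in>{1..m}. dn n (u (i - 1)) (u i) powr p"
  have "Lq_norm M q (\<lambda>\<omega>. Gn n 0 (eps_seq \<epsilon> 0 \<omega>)) + ?s powr (1 / p) \<le> C\<^sub>G"
    unfolding dn_def by (rule A2[rule_format]) (use assms in auto)
  then have "?s powr (1 / p) \<le> C\<^sub>G"
    using Lq_norm_nonneg[of "\<lambda>\<omega>. Gn n 0 (eps_seq \<epsilon> 0 \<omega>)"] by linarith
  then have "(?s powr (1 / p)) powr p \<le> C\<^sub>G powr p"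
    using p by (intro powr_mono2) auto
  moreover have "0 \<le> ?s" by (intro sum_nonneg) auto
  ultimately show ?thesis using p by (simp add: powr_powr)
qed

lemma dn_tendsto_dG:
  assumes xy: "x \<in> {0..1}" "y \<in> {0..1}"
  shows "(\<lambda>n. dn n x y) \<longlonglongrightarrow> dG x y"
proof (rule metric_LIMSEQ_I)
  fix c :: real assume c: "c > 0"
  then have "c / 4 > 0" by simp
  from A1[rule_format, OF this] obtain N where N: "\<And>n u. n \<ge> N \<Longrightarrow> u \<in> {0..1} \<Longrightarrow>
      Lq_le M q (\<lambda>\<omega>. Gn n u (eps_seq \<epsilon> 0 \<omega>) - G u (eps_seq \<epsilon> 0 \<omega>)) (c / 4)"
    unfolding eventually_sequentially by blast
  have "dist (dn n x y) (dG x y) < c" if n: "n \<ge> N" for n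
  proof -
    let ?D = "\<lambda>u \<omega>. Gn n u (eps_seq \<epsilon> 0 \<omega>) - G u (eps_seq \<epsilon> 0 \<omega>)"
    let ?g = "\<lambda>\<omega>. G y (eps_seq \<epsilon> 0 \<omega>) - G x (eps_seq \<epsilon> 0 \<omega>)"
    let ?gn = "\<lambda>\<omega>. Gn n y (eps_seq \<epsilon> 0 \<omega>) - Gn n x (eps_seq \<epsilon> 0 \<omega>)"
    have "Lq_le M q (\<lambda>\<omega>. ?g \<omega> + ?D y \<omega> - ?D x \<omega>) (dG x y + c / 4 + c / 4)"
      by (intro Lq_le_add Lq_le_diff dG_Lq_le N n xy) (use q in auto)
    then have "Lq_le M q ?gn (dG x y + c / 4 + c / 4)" by simp
    then have 1: "dn n x y \<le> dG x y + c / 4 + c / 4"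
      unfolding dn_def by (rule Lq_norm_le) (use q in auto)
    have "Lq_le M q (\<lambda>\<omega>. ?gn \<omega> - ?D y \<omega> + ?D x \<omega>) (dn n x y + c / 4 + c / 4)"
      by (intro Lq_le_add Lq_le_diff dn_Lq_le N n xy) (use q in auto)
    then have "Lq_le M q ?g (dn n x y + c / 4 + c / 4)" by simp
    then have "dG x y \<le> dn n x y + c / 4 + c / 4"
      unfolding dG_def by (rule Lq_norm_le) (use q in auto)
    with 1 c show ?thesis by (auto simp: dist_real_def)
  qed
  then show "\<exists>N. \<forall>n\<ge>N. dist (dn n x y) (dG x y) < c" by blast
qed

lemma partition_in_unit: "is_partition01 u m \<Longrightarrow> i \<le> m \<Longrightarrow> u i \<in> {0..1}"
proof -
  assume u: "is_partition01 u m" and i: "i \<le> m"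
  have mono: "u j \<le> u k" if "j \<le> k" "k \<le> m" for j k
    using that
  proof (induction k rule: dec_induct)
    case (step k)
    then have "u k < u (Suc k)" "u j \<le> u k" using u by (auto simp: is_partition01_def)
    then show ?case by simp
  qed simp
  show ?thesis using mono[of 0 i] mono[of i m] i u by (auto simp: is_partition01_def)
qed

text \<open>Over a fixed finite partition, the variation sum of \<open>G\<close> is the limit of
  those of the \<open>Gn n\<close>, which share one bound.\<close>

lemma dG_partition_bound:
  assumes u: "is_partition01 u m"
  shows "(\<Sum>i\<in>{1..m}. dG (u (i - 1)) (u i) powr p) \<le> C\<^sub>G powr p"
proof (rule LIMSEQ_le_const2)
  show "(\<lambda>n. \<Sum>i\<in>{1..m}. dn n (u (i - 1)) (u i) powr p) \<longlonglongrightarrow> (\<Sum>i\<in>{1..m}. dG (u (i - 1)) (u i) powr p)"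
    using partition_in_unit[OF u] p
    by (intro tendsto_sum tendsto_powr2 dn_tendsto_dG) (auto simp: dn_nonneg)
qed (use dn_partition_bound[OF u] in blast)

text \<open>The discontinuities of \<open>G\<close> as a map from \<open>{0..1}\<close> into the
  space of \<open>q\<close>-integrable variables.\<close>

definition "disc = {v\<in>{0..1}. \<not> (\<forall>e>0. \<exists>\<delta>>0. \<forall>u\<in>{0..1}. \<bar>u - v\<bar> < \<delta> \<longrightarrow> dG u v < e)}"

lemma countable_disc: "countable disc"
  unfolding disc_def
  by (rule pvar_countable_discontinuities[of dG p "C\<^sub>G powr p"])
     (use dG_partition_bound dG_sym dG_nonneg dG_diag p in auto)

end

section \<open>Convergence of the expected squared block sums\<close>

text \<open>Written as the integral of a function constant on cells of length \<open>1 / n\<close>,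
  an average over times becomes accessible to dominated convergence.\<close>

lemma riemann_sum_eq_integral:
  fixes \<phi> :: "int \<Rightarrow> real"
  assumes n: "1 \<le> n" and I: "finite I"
  shows "(1 / real n) * (\<Sum>t\<in>I. \<phi> t) = (\<integral>v. (if \<lfloor>real n * v\<rfloor> \<in> I then \<phi> \<lfloor>real n * v\<rfloor> else 0) \<partial>lborel)"
    "(\<lambda>v. if \<lfloor>real n * v\<rfloor> \<in> I then \<phi> \<lfloor>real n * v\<rfloor> else 0) \<in> borel_measurable borel"
proof -
  let ?J = "\<lambda>t. {real_of_int t / real n..<(real_of_int t + 1) / real n}"
  have mem: "v \<in> ?J t \<longleftrightarrow> \<lfloor>real n * v\<rfloor> = t" for v t
    using n by (simp add: floor_eq_iff field_simps)
  have eq: "(if \<lfloor>real n * v\<rfloor> \<in> I then \<phi> \<lfloor>real n * v\<rfloor> else 0) = (\<Sum>t\<in>I. \<phi> t * indicator (?J t) v)" for v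
  proof -
    have "(\<Sum>t\<in>I. \<phi> t * indicator (?J t) v) = (\<Sum>t\<in>I. if t = \<lfloor>real n * v\<rfloor> then \<phi> t else 0)"
      unfolding indicator_def mem by (intro sum.cong) auto
    then show ?thesis using I by (simp add: sum.delta)
  qed
  have m: "measure lborel (?J t) = 1 / real n" for t
  proof -
    have "real_of_int t / real n \<le> (real_of_int t + 1) / real n"
      using n by (intro divide_right_mono) auto
    then show ?thesis by (simp add: measure_lborel_Ico diff_divide_distrib[symmetric])
  qed
  have fin: "emeasure lborel (?J t) < \<infinity>" for t
    by (cases "real_of_int t / real n \<le> (real_of_int t + 1) / real n") (auto simp: emeasure_lborel_Ico)
  have "(\<integral>v. (\<Sum>t\<in>I. \<phi> t * indicator (?J t) v) \<partial>lborel) = (\<Sum>t\<in>I. \<phi> t * measure lborel (?J t))"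
    using fin by (subst Bochner_Integration.integral_sum) auto
  then show "(1 / real n) * (\<Sum>t\<in>I. \<phi> t) = (\<integral>v. (if \<lfloor>real n * v\<rfloor> \<in> I then \<phi> \<lfloor>real n * v\<rfloor> else 0) \<partial>lborel)"
    unfolding eq m by (simp add: sum_distrib_left mult.commute sum_divide_distrib)
  show "(\<lambda>v. if \<lfloor>real n * v\<rfloor> \<in> I then \<phi> \<lfloor>real n * v\<rfloor> else 0) \<in> borel_measurable borel"
    unfolding eq by measurable
qed

context block_estimation
begin

definition "Yn n t \<omega> = Gn n (real_of_int t / real n) (eps_seq \<epsilon> t \<omega>) - mun n (real_of_int t / real n)"
definition "Sn n b t \<omega> = (\<Sum>i\<in>{1..b}. Yn n (t + int i) \<omega>)"
definition "Zn n b d t \<omega> = (d \<bullet> Sn n b t \<omega>)\<^sup>2 / real b"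
text \<open>The bound of \<open>Z_expectation_bound\<close> for directions of norm at most
  \<open>C\<^sub>f\<close>, with \<open>A0\<^sup>2\<close> written out.\<close>

definition "C\<^sub>Z = C\<^sub>f\<^sup>2 * (2 / (1 - \<rho>) * K\<^sup>2)"

text \<open>The stationary centered process obtained by freezing the kernel at
  \<open>v\<close>.\<close>

definition "U v t \<omega> = G v (eps_seq \<epsilon> t \<omega>) - mu v"

definition "Sig = (\<lambda>v. \<chi> i j. (\<Sum>\<^sub>\<infinity>h::int. expectation (\<lambda>\<omega>.
              (G v (eps_seq \<epsilon> 0 \<omega>) $ i - mu v $ i) * (G v (eps_seq \<epsilon> h \<omega>) $ j - mu v $ j))))"

definition "lrv v = Df (mu v) \<bullet> (Sig v *v Df (mu v))"

lemma C\<^sub>Z_nonneg: "0 \<le> C\<^sub>Z" using \<rho> by (simp add: C\<^sub>Z_def)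

lemma Zn_expectation_bound:
  assumes "1 \<le> n" "1 \<le> b" "0 \<le> t + 1" "t + int b \<le> int n" "norm d \<le> C\<^sub>f"
  shows "integrable M (Zn n b d t)" "0 \<le> expectation (Zn n b d t)" "expectation (Zn n b d t) \<le> C\<^sub>Z"
proof -
  interpret A: innov_array M \<epsilon> \<epsilon>s "\<lambda>t x. Gn n (real_of_int t / real n) x - mun n (real_of_int t / real n)" "{0..int n}" K \<rho>
    by (rule array_n[OF assms(1)])
  have Z: "A.Z b d t = Zn n b d t"
    by (auto simp: fun_eq_iff A.Z_def A.S_def A.Y_def Zn_def Sn_def Yn_def)
  have A0: "A.A0\<^sup>2 = 2 / (1 - \<rho>) * K\<^sup>2"
    using \<rho> by (simp add: A.A0_def power_mult_distrib)
  have blk: "{t + 1..t + int b} \<subseteq> {0..int n}" using assms by auto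
  show "integrable M (Zn n b d t)" "0 \<le> expectation (Zn n b d t)" "expectation (Zn n b d t) \<le> C\<^sub>Z"
    using A.Z_expectation_bound[OF assms(2) C\<^sub>f_nonneg blk assms(5)] unfolding Z C\<^sub>Z_def A0 by auto
qed

text \<open>Both factors are functions of one two-sided sequence, and shifting it by
  \<open>s\<close> is an injective relabelling.\<close>

lemma lag_stationary:
  "expectation (\<lambda>\<omega>. (D \<bullet> U v s \<omega>) * (D \<bullet> U v t \<omega>)) = expectation (\<lambda>\<omega>. (D \<bullet> U v 0 \<omega>) * (D \<bullet> U v (t - s) \<omega>))"
proof -
  define h where "h w = (D \<bullet> (G v (\<lambda>k. w (- int k)) - mu v)) * (D \<bullet> (G v (\<lambda>k. w (t - s - int k)) - mu v))" for w :: "int \<Rightarrow> real"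
  have [measurable]: "(\<lambda>w. G v (\<lambda>k. w (\<sigma> k))) \<in> borel_measurable (\<Pi>\<^sub>M k\<in>(UNIV::int set). borel)" for \<sigma> :: "nat \<Rightarrow> int"
    by (intro measurable_compose[OF _ G_measurable] measurable_PiM_single' measurable_component_singleton) auto
  have hm[measurable]: "h \<in> borel_measurable (\<Pi>\<^sub>M k\<in>UNIV. borel)"
    unfolding h_def by measurable
  have "distr M borel (\<lambda>\<omega>. h (\<lambda>k. e (Inl (k + s)) \<omega>)) = distr M borel (\<lambda>\<omega>. h (\<lambda>k. e (Inl k) \<omega>))"
    by (rule distr_reindex_eq[where \<sigma> = "\<lambda>k. Inl (k + s)" and \<sigma>' = Inl]) (auto simp: inj_def)
  then have "expectation (\<lambda>\<omega>. h (\<lambda>k. e (Inl (k + s)) \<omega>)) = expectation (\<lambda>\<omega>. h (\<lambda>k. e (Inl k) \<omega>))"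
    by (rule integral_distr_eq) (rule measurable_compose[OF env_measurable hm])+
  moreover have "h (\<lambda>k. e (Inl (k + s)) \<omega>) = (D \<bullet> U v s \<omega>) * (D \<bullet> U v t \<omega>)" for \<omega>
    by (simp add: h_def U_def eps_seq_def algebra_simps)
  moreover have "h (\<lambda>k. e (Inl k) \<omega>) = (D \<bullet> U v 0 \<omega>) * (D \<bullet> U v (t - s) \<omega>)" for \<omega>
    by (simp add: h_def U_def eps_seq_def)
  ultimately show ?thesis by simp
qed

text \<open>Bilinearity moves the projection inside: each entry of \<open>Sig v\<close> is a
  summable series over lags, so the finite sums over coordinates may be exchanged with it.\<close>

lemma lrv_eq_infsum:
  assumes v: "v \<in> {0..1}"
  shows "lrv v = (\<Sum>\<^sub>\<infinity>h. expectation (\<lambda>\<omega>. (Df (mu v) \<bullet> U v 0 \<omega>) * (Df (mu v) \<bullet> U v h \<omega>)))"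
proof -
  interpret A: innov_array M \<epsilon> \<epsilon>s "\<lambda>t x. G v x - mu v" UNIV K \<rho>
    by (rule array_G[OF v])
  have AY: "A.Y t \<omega> = U v t \<omega>" for t \<omega> by (simp add: A.Y_def U_def)
  let ?D = "Df (mu v)"
  let ?c = "\<lambda>i j h. expectation (\<lambda>\<omega>. U v 0 \<omega> $ i * U v h \<omega> $ j)"
  have int: "integrable M (\<lambda>\<omega>. U v 0 \<omega> $ i * U v h \<omega> $ j)" for i j h
    using A.inner_Y_mult_integrable[of 0 h "axis i 1" "axis j 1"] by (simp add: AY inner_axis')
  have bound: "\<bar>?c i j h\<bar> \<le> K\<^sup>2 * \<rho> ^ nat \<bar>h\<bar>" for i j h
    using A.covariance_decay[of 0 h "axis i 1" "axis j 1"] by (simp add: AY inner_axis')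
  have sm: "(?c i j has_sum Sig v $ i $ j) UNIV" for i j
  proof -
    have "?c i j summable_on UNIV"
      by (rule infsum_tail_le(1)[OF bound \<rho>, of "{}" 0]) auto
    moreover have "Sig v $ i $ j = infsum (?c i j) UNIV"
      by (simp add: Sig_def U_def)
    ultimately show ?thesis by (simp add: has_sum_infsum)
  qed
  have "((\<lambda>h. \<Sum>i\<in>UNIV. \<Sum>j\<in>UNIV. ?D $ i * ?D $ j * ?c i j h) has_sum (\<Sum>i\<in>UNIV. \<Sum>j\<in>UNIV. ?D $ i * ?D $ j * Sig v $ i $ j)) UNIV"
  proof -
    have hs: "((\<lambda>h. \<Sum>x\<in>F. f x h) has_sum (\<Sum>x\<in>F. l x)) UNIV"
      if "finite F" "\<And>x. (f x has_sum l x) UNIV" for F and f :: "'d \<Rightarrow> int \<Rightarrow> real" and l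
      using that(1) by (induction F rule: finite_induct) (auto intro: has_sum_add that(2))
    show ?thesis by (intro hs finite has_sum_cmult_right sm)
  qed
  moreover have "(\<Sum>i\<in>UNIV. \<Sum>j\<in>UNIV. ?D $ i * ?D $ j * ?c i j h) = expectation (\<lambda>\<omega>. (?D \<bullet> U v 0 \<omega>) * (?D \<bullet> U v h \<omega>))" for h
  proof -
    have "(?D \<bullet> U v 0 \<omega>) * (?D \<bullet> U v h \<omega>) = (\<Sum>i\<in>UNIV. \<Sum>j\<in>UNIV. ?D $ i * ?D $ j * (U v 0 \<omega> $ i * U v h \<omega> $ j))" for \<omega>
      by (simp add: inner_vec_def sum_product mult_ac)
    then show ?thesis using int by simp
  qed
  moreover have "(\<Sum>i\<in>UNIV. \<Sum>j\<in>UNIV. ?D $ i * ?D $ j * Sig v $ i $ j) = lrv v"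
    by (simp add: lrv_def inner_vec_def matrix_vector_mult_def sum_distrib_left mult_ac)
  ultimately show ?thesis
    by (simp add: infsumI)
qed

text \<open>In mean square each factor is off by at most \<open>(K + C\<^sub>f) * \<eta>\<close>,
  from its direction and from its process, while the other factor is at most
  \<open>C\<^sub>f * K\<close>. The leading 2 counts the two factors, exchanged one at a
  time.\<close>

lemma covariance_perturbation:
  assumes v: "v \<in> {0..1}" and n: "1 \<le> n" and st: "s \<in> {0..int n}" "t \<in> {0..int n}"
    and d: "norm d \<le> C\<^sub>f" "norm (d - Df (mu v)) \<le> \<eta>"
    and Y: "Lq_le M 2 (\<lambda>\<omega>. Yn n s \<omega> - U v s \<omega>) \<eta>" "Lq_le M 2 (\<lambda>\<omega>. Yn n t \<omega> - U v t \<omega>) \<eta>"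
  shows "\<bar>expectation (\<lambda>\<omega>. (d \<bullet> Yn n s \<omega>) * (d \<bullet> Yn n t \<omega>))
      - expectation (\<lambda>\<omega>. (Df (mu v) \<bullet> U v s \<omega>) * (Df (mu v) \<bullet> U v t \<omega>))\<bar> \<le> 2 * C\<^sub>f * K * (K + C\<^sub>f) * \<eta>"
proof -
  interpret A: innov_array M \<epsilon> \<epsilon>s "\<lambda>t x. Gn n (real_of_int t / real n) x - mun n (real_of_int t / real n)" "{0..int n}" K \<rho>
    by (rule array_n[OF n])
  interpret B: innov_array M \<epsilon> \<epsilon>s "\<lambda>t x. G v x - mu v" UNIV K \<rho>
    by (rule array_G[OF v])
  let ?D = "Df (mu v)"
  have AY: "A.Y r = Yn n r" for r by (auto simp: fun_eq_iff A.Y_def Yn_def)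
  have BY: "B.Y r = U v r" for r by (auto simp: fun_eq_iff B.Y_def U_def)
  have D: "norm ?D \<le> C\<^sub>f" by (rule Df_bound[OF mu_Mdelta[OF v]])
  have Ym[measurable]: "Yn n r \<in> borel_measurable M" for r
    unfolding Yn_def by measurable
  have Um[measurable]: "U v r \<in> borel_measurable M" for r
    unfolding U_def by measurable
  have Y2: "Lq_le M 2 (Yn n r) K" if "r \<in> {0..int n}" for r
    using A.Lq_le_2_of_4[OF A.Y_moment[OF that]] unfolding AY by simp
  have U2: "Lq_le M 2 (U v r) K" for r
    using B.Lq_le_2_of_4[OF B.Y_moment[of r]] unfolding BY by simp
  have diff: "Lq_le M 2 (\<lambda>\<omega>. d \<bullet> Yn n r \<omega> - ?D \<bullet> U v r \<omega>) ((K + C\<^sub>f) * \<eta>)"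
    if "r \<in> {0..int n}" "Lq_le M 2 (\<lambda>\<omega>. Yn n r \<omega> - U v r \<omega>) \<eta>" for r
  proof -
    have "Lq_le M 2 (\<lambda>\<omega>. (d - ?D) \<bullet> Yn n r \<omega> + ?D \<bullet> (Yn n r \<omega> - U v r \<omega>)) (\<eta> * K + C\<^sub>f * \<eta>)"
      by (intro Lq_le_add Lq_le_inner Y2 that d D) auto
    then show ?thesis by (simp add: inner_diff_left inner_diff_right algebra_simps)
  qed
  have a: "Lq_le M 2 (\<lambda>\<omega>. d \<bullet> Yn n t \<omega>) (C\<^sub>f * K)"
    by (intro Lq_le_inner Y2 st d) auto
  have b: "Lq_le M 2 (\<lambda>\<omega>. ?D \<bullet> U v s \<omega>) (C\<^sub>f * K)"
    by (intro Lq_le_inner U2 D) auto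
  note ds = diff[OF st(1) Y(1)] and dt = diff[OF st(2) Y(2)]
  have i1: "integrable M (\<lambda>\<omega>. (d \<bullet> Yn n s \<omega>) * (d \<bullet> Yn n t \<omega>))"
    using A.inner_Y_mult_integrable[OF st] unfolding AY .
  have i2: "integrable M (\<lambda>\<omega>. (?D \<bullet> U v s \<omega>) * (?D \<bullet> U v t \<omega>))"
    using B.inner_Y_mult_integrable[of s t] unfolding BY by simp
  have j1: "integrable M (\<lambda>\<omega>. (d \<bullet> Yn n s \<omega> - ?D \<bullet> U v s \<omega>) * (d \<bullet> Yn n t \<omega>))"
    "\<bar>expectation (\<lambda>\<omega>. (d \<bullet> Yn n s \<omega> - ?D \<bullet> U v s \<omega>) * (d \<bullet> Yn n t \<omega>))\<bar> \<le> (K + C\<^sub>f) * \<eta> * (C\<^sub>f * K)"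
    using expectation_mult_bound[OF ds a] by auto
  have j2: "integrable M (\<lambda>\<omega>. (?D \<bullet> U v s \<omega>) * (d \<bullet> Yn n t \<omega> - ?D \<bullet> U v t \<omega>))"
    "\<bar>expectation (\<lambda>\<omega>. (?D \<bullet> U v s \<omega>) * (d \<bullet> Yn n t \<omega> - ?D \<bullet> U v t \<omega>))\<bar> \<le> (C\<^sub>f * K) * ((K + C\<^sub>f) * \<eta>)"
    using expectation_mult_bound[OF b dt] by auto
  have "expectation (\<lambda>\<omega>. (d \<bullet> Yn n s \<omega>) * (d \<bullet> Yn n t \<omega>)) - expectation (\<lambda>\<omega>. (?D \<bullet> U v s \<omega>) * (?D \<bullet> U v t \<omega>))
     = expectation (\<lambda>\<omega>. (d \<bullet> Yn n s \<omega>) * (d \<bullet> Yn n t \<omega>) - (?D \<bullet> U v s \<omega>) * (?D \<bullet> U v t \<omega>))"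
    using i1 i2 by simp
  also have "\<dots> = expectation (\<lambda>\<omega>. (d \<bullet> Yn n s \<omega> - ?D \<bullet> U v s \<omega>) * (d \<bullet> Yn n t \<omega>)
        + (?D \<bullet> U v s \<omega>) * (d \<bullet> Yn n t \<omega> - ?D \<bullet> U v t \<omega>))"
    by (rule arg_cong[where f = expectation]) (simp add: fun_eq_iff algebra_simps)
  also have "\<dots> = expectation (\<lambda>\<omega>. (d \<bullet> Yn n s \<omega> - ?D \<bullet> U v s \<omega>) * (d \<bullet> Yn n t \<omega>))
        + expectation (\<lambda>\<omega>. (?D \<bullet> U v s \<omega>) * (d \<bullet> Yn n t \<omega> - ?D \<bullet> U v t \<omega>))"
    using j1(1) j2(1) by simp
  finally show ?thesis using j1(2) j2(2) by (simp add: algebra_simps)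
qed

lemma Zn_expectation_limit:
  fixes L b :: "nat \<Rightarrow> nat"
  assumes v: "0 < v" "v < 1" "v \<notin> disc"
    and b_inf: "filterlim b at_top sequentially"
    and b_n: "(\<lambda>n. real (b n) / real n) \<longlonglongrightarrow> 0" and L_n: "(\<lambda>n. real (L n) / real n) \<longlonglongrightarrow> 0"
  shows "(\<lambda>n. expectation (Zn n (b n) (Df (mun n (real_of_int (\<lfloor>real n * v\<rfloor> - int (L n)) / real n))) \<lfloor>real n * v\<rfloor>)) \<longlonglongrightarrow> lrv v"
proof (rule LIMSEQ_I)
  fix r :: real assume r: "0 < r"
  have v01: "v \<in> {0..1}" using v by simp
  interpret B: innov_array M \<epsilon> \<epsilon>s "\<lambda>t x. G v x - mu v" UNIV K \<rho>
    by (rule array_G[OF v01])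
  have BY: "B.Y r = U v r" for r by (auto simp: fun_eq_iff B.Y_def U_def)
  define C where "C = C\<^sub>f\<^sup>2 * K\<^sup>2"
  have C0: "0 \<le> C" by (simp add: C_def)
  let ?\<gamma> = "\<lambda>h. expectation (\<lambda>\<omega>. (Df (mu v) \<bullet> U v 0 \<omega>) * (Df (mu v) \<bullet> U v h \<omega>))"
  have CC: "norm x * norm x * K\<^sup>2 * \<rho> ^ k \<le> C * \<rho> ^ k" if "norm x \<le> C\<^sub>f" for x :: "real^'d" and k
    unfolding C_def power2_eq_square[of C\<^sub>f] using that \<rho> by (intro mult_right_mono mult_mono) (auto simp: C\<^sub>f_nonneg)
  have \<gamma>: "\<bar>?\<gamma> h\<bar> \<le> C * \<rho> ^ nat \<bar>h\<bar>" for h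
    using B.covariance_decay[of 0 h "Df (mu v)" "Df (mu v)"] CC[OF Df_bound[OF mu_Mdelta[OF v01]], of "nat \<bar>h\<bar>"]
    unfolding BY by simp
  obtain H where H: "4 * C * \<rho> ^ H / (1 - \<rho>) < r / 3"
  proof -
    have "(\<lambda>H. 4 * C * \<rho> ^ H / (1 - \<rho>)) \<longlonglongrightarrow> 4 * C * 0 / (1 - \<rho>)"
      using \<rho> by (intro tendsto_intros LIMSEQ_realpow_zero) auto
    then have "eventually (\<lambda>H. 4 * C * \<rho> ^ H / (1 - \<rho>) < r / 3) sequentially"
      using r by (intro order_tendstoD) auto
    then show ?thesis using that by (auto simp: eventually_sequentially)
  qed
  \<comment> \<open>The \<open>2 * H + 1\<close> short lags share one third of \<open>r\<close>; the
    other two thirds are for the truncation and for the edges of the block.\<close>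
  define \<eta> where "\<eta> = r / (3 * real (2 * H + 1))"
  have \<eta>: "0 < \<eta>" "real (2 * H + 1) * \<eta> = r / 3" using r by (auto simp: \<eta>_def field_simps)
  define R where "R = 2 * C\<^sub>f * K * (K + C\<^sub>f)"
  have R0: "0 \<le> R" using K_bounds C\<^sub>f_nonneg by (simp add: R_def)
  define \<eta>0 where "\<eta>0 = \<eta> / (R + 1)"
  have \<eta>0: "0 < \<eta>0" "R * \<eta>0 \<le> \<eta>"
    using \<eta>(1) R0 by (auto simp: \<eta>0_def field_simps)
  obtain c where c: "0 < c" "\<And>x. norm (x - mu v) < c \<Longrightarrow> norm (Df x - Df (mu v)) < \<eta>0"
    using Df_continuous \<eta>0(1) unfolding continuous_on_iff dist_norm by blast
  \<comment> \<open>Kernel and mean are each off by at most \<open>2 * c0\<close>, so the centered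
    process is off by at most \<open>4 * c0 \<le> \<eta>0\<close>, and the mean stays within the
    radius \<open>c\<close> chosen for \<open>Df\<close>.\<close>
  define c0 where "c0 = min \<eta>0 c / 4"
  have c0: "0 < c0" "2 * c0 < c" "2 * c0 + 2 * c0 \<le> \<eta>0" using c(1) \<eta>0(1) by (auto simp: c0_def min_def)
  obtain \<delta>1 where \<delta>1: "\<delta>1 > 0" "\<And>u. u \<in> {0..1} \<Longrightarrow> \<bar>u - v\<bar> < \<delta>1 \<Longrightarrow> dG u v < c0"
    using v(3) v01 c0(1) unfolding disc_def by blast
  \<comment> \<open>The inner minimum keeps all rescaled times inside \<open>{0..1}\<close>; here
    \<open>v\<close> has to be an interior point.\<close>
  define \<delta>2 where "\<delta>2 = min \<delta>1 (min v (1 - v))"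
  have \<delta>2: "\<delta>2 > 0" using \<delta>1(1) v by (simp add: \<delta>2_def)
  have "(\<lambda>n. 1 / real n + real (L n) / real n + real (b n) / real n) \<longlonglongrightarrow> 0 + 0 + 0"
    by (intro tendsto_intros lim_1_over_n b_n L_n)
  then have ev1: "eventually (\<lambda>n. 1 / real n + real (L n) / real n + real (b n) / real n < \<delta>2) sequentially"
    using \<delta>2 by (intro order_tendstoD) auto
  have ev2: "eventually (\<lambda>n. 1 \<le> b n) sequentially"
    using b_inf by (auto simp: filterlim_at_top)
  have "(\<lambda>n. 4 * C / (1 - \<rho>)\<^sup>2 / real (b n)) \<longlonglongrightarrow> 0"
    by (rule tendsto_divide_0[OF tendsto_const filterlim_at_top_imp_at_infinity])
       (rule filterlim_compose[OF filterlim_real_sequentially b_inf])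
  then have ev3: "eventually (\<lambda>n. 4 * C / (1 - \<rho>)\<^sup>2 / real (b n) < r / 3) sequentially"
    using r by (intro order_tendstoD) auto
  have ev: "eventually (\<lambda>n. norm (expectation (Zn n (b n) (Df (mun n (real_of_int (\<lfloor>real n * v\<rfloor> - int (L n)) / real n))) \<lfloor>real n * v\<rfloor>) - lrv v) < r) sequentially"
    using ev1 ev2 ev3 A1[rule_format, OF c0(1)] mun_Mdelta eventually_ge_at_top[of 1]
  proof eventually_elim
    case (elim n)
    define t where "t = \<lfloor>real n * v\<rfloor>"
    define d where "d = Df (mun n (real_of_int (t - int (L n)) / real n))"
    have n: "1 \<le> n" and n0: "0 < real n" using elim by auto
    interpret A: innov_array M \<epsilon> \<epsilon>s "\<lambda>t x. Gn n (real_of_int t / real n) x - mun n (real_of_int t / real n)" "{0..int n}" K \<rho>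
      by (rule array_n[OF n])
    have AY: "A.Y r = Yn n r" for r by (auto simp: fun_eq_iff A.Y_def Yn_def)
    have tv: "\<bar>real_of_int t / real n - v\<bar> \<le> 1 / real n"
    proof -
      have "\<bar>real_of_int t - real n * v\<bar> \<le> 1" unfolding t_def by linarith
      moreover have "real_of_int t / real n - v = (real_of_int t - real n * v) / real n" using n0 by (simp add: field_simps)
      ultimately show ?thesis using n0 by (simp add: divide_right_mono)
    qed
    have near: "\<bar>real_of_int (t + i) / real n - v\<bar> < \<delta>2" if "- int (L n) \<le> i" "i \<le> int (b n)" for i
    proof -
      have "\<bar>real_of_int i\<bar> \<le> real (L n) + real (b n)" using that by linarith
      then have "\<bar>real_of_int i\<bar> / real n \<le> (real (L n) + real (b n)) / real n" using n0 by (intro divide_right_mono) auto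
      then have "\<bar>real_of_int i / real n\<bar> \<le> real (L n) / real n + real (b n) / real n"
        using n0 by (simp add: add_divide_distrib)
      moreover have "real_of_int (t + i) / real n - v = (real_of_int t / real n - v) + real_of_int i / real n"
        by (simp add: add_divide_distrib)
      ultimately show ?thesis using tv elim(1) by linarith
    qed
    have unit: "real_of_int (t + i) / real n \<in> {0..1}" and close: "dG (real_of_int (t + i) / real n) v < c0"
      if "- int (L n) \<le> i" "i \<le> int (b n)" for i
    proof -
      show "real_of_int (t + i) / real n \<in> {0..1}" using near[OF that] unfolding \<delta>2_def atLeastAtMost_iff by linarith
      then show "dG (real_of_int (t + i) / real n) v < c0" using near[OF that] \<delta>1(2) by (simp add: \<delta>2_def)
    qed
    have GG: "Lq_le M q (\<lambda>\<omega>. Gn n (real_of_int (t + i) / real n) (eps_seq \<epsilon> 0 \<omega>) - G v (eps_seq \<epsilon> 0 \<omega>)) (2 * c0)"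
      if "- int (L n) \<le> i" "i \<le> int (b n)" for i
    proof -
      let ?u = "real_of_int (t + i) / real n"
      have "Lq_le M q (\<lambda>\<omega>. (Gn n ?u (eps_seq \<epsilon> 0 \<omega>) - G ?u (eps_seq \<epsilon> 0 \<omega>)) - (G v (eps_seq \<epsilon> 0 \<omega>) - G ?u (eps_seq \<epsilon> 0 \<omega>))) (c0 + dG ?u v)"
        by (intro Lq_le_diff dG_Lq_le unit[OF that] v01) (use elim(4) unit[OF that] q in auto)
      then have "Lq_le M q (\<lambda>\<omega>. Gn n ?u (eps_seq \<epsilon> 0 \<omega>) - G v (eps_seq \<epsilon> 0 \<omega>)) (c0 + dG ?u v)" by simp
      then show ?thesis by (rule Lq_le_weaken) (use close[OF that] q in auto)
    qed
    have mm: "norm (mun n (real_of_int (t + i) / real n) - mu v) \<le> 2 * c0" if "- int (L n) \<le> i" "i \<le> int (b n)" for i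
      by (rule mun_minus_mu_le[OF unit[OF that] v01 GG[OF that]])
    have dd: "norm (d - Df (mu v)) \<le> \<eta>0"
      using c(2)[of "mun n (real_of_int (t + - int (L n)) / real n)"] mm[of "- int (L n)"] c0(2) by (simp add: d_def)
    have dC: "norm d \<le> C\<^sub>f"
      unfolding d_def using elim(5) unit[of "- int (L n)"] by (intro Df_bound) auto
    have YU: "Lq_le M 2 (\<lambda>\<omega>. Yn n (t + i) \<omega> - U v (t + i) \<omega>) \<eta>0" if i: "1 \<le> i" "i \<le> int (b n)" for i
    proof -
      have i': "- int (L n) \<le> i" "i \<le> int (b n)" using i by auto
      let ?u = "real_of_int (t + i) / real n"
      have "Lq_le M q (\<lambda>\<omega>. Gn n ?u (eps_seq \<epsilon> (t + i) \<omega>) - G v (eps_seq \<epsilon> (t + i) \<omega>)) (2 * c0)"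
        using GG[OF i'] Lq_le_distr_eq[OF distr_kernel_eq(1)[of "\<lambda>x. Gn n ?u x - G v x" "t + i" 0]] by simp
      then have *: "Lq_le M 2 (\<lambda>\<omega>. Gn n ?u (eps_seq \<epsilon> (t + i) \<omega>) - G v (eps_seq \<epsilon> (t + i) \<omega>)) (2 * c0)"
        by (rule Lq_le_exponent_mono) (use q in auto)
      have "Lq_le M 2 (\<lambda>_. mun n ?u - mu v) (norm (mun n ?u - mu v))"
        by (rule Lq_le_const) simp
      then have "Lq_le M 2 (\<lambda>_. mun n ?u - mu v) (2 * c0)"
        by (rule Lq_le_weaken) (use mm[OF i'] in auto)
      with * have "Lq_le M 2 (\<lambda>\<omega>. (Gn n ?u (eps_seq \<epsilon> (t + i) \<omega>) - G v (eps_seq \<epsilon> (t + i) \<omega>)) - (mun n ?u - mu v)) (2 * c0 + 2 * c0)"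
        by (rule Lq_le_diff) auto
      then have "Lq_le M 2 (\<lambda>\<omega>. Yn n (t + i) \<omega> - U v (t + i) \<omega>) (2 * c0 + 2 * c0)"
        by (simp add: Yn_def U_def algebra_simps)
      then show ?thesis by (rule Lq_le_weaken) (use c0 in auto)
    qed
    have inT: "t + i \<in> {0..int n}" if "1 \<le> i" "i \<le> int (b n)" for i
    proof -
      have "real_of_int (t + i) / real n \<in> {0..1}" by (rule unit) (use that in auto)
      then have "0 \<le> real_of_int (t + i)" "real_of_int (t + i) \<le> real n" using n0 by (auto simp: field_simps)
      then show ?thesis by auto
    qed
    let ?c = "\<lambda>i j. expectation (\<lambda>\<omega>. (d \<bullet> Yn n (t + i) \<omega>) * (d \<bullet> Yn n (t + j) \<omega>))"
    have blk: "{t + 1..t + int (b n)} \<subseteq> {0..int n}"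
    proof
      fix x assume "x \<in> {t + 1..t + int (b n)}"
      then show "x \<in> {0..int n}" using inT[of "x - t"] by auto
    qed
    have "expectation (Zn n (b n) d t) = expectation (\<lambda>\<omega>. (d \<bullet> A.S (b n) t \<omega>)\<^sup>2) / real (b n)"
      by (simp add: Zn_def[abs_def] Sn_def A.S_def AY)
    also have "\<dots> = (\<Sum>i\<in>{1..int (b n)}. \<Sum>j\<in>{1..int (b n)}. ?c i j) / real (b n)"
      unfolding A.S_square_expand(1)[OF blk] AY ..
    also have "\<bar>\<dots> - (\<Sum>\<^sub>\<infinity>h. ?\<gamma> h)\<bar>
       \<le> real (2 * H + 1) * \<eta> + 4 * C * \<rho> ^ H / (1 - \<rho>) + 4 * C / (1 - \<rho>)\<^sup>2 / real (b n)"
    proof (rule block_average_bound[OF \<gamma> \<rho>])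
      fix i j assume ij: "i \<in> {1..int (b n)}" "j \<in> {1..int (b n)}"
      show "\<bar>?c i j\<bar> \<le> C * \<rho> ^ nat \<bar>i - j\<bar>"
        using A.covariance_decay[OF inT inT, of i j d d] CC[OF dC, of "nat \<bar>i - j\<bar>"] ij unfolding AY by auto
      have "\<bar>?c i j - expectation (\<lambda>\<omega>. (Df (mu v) \<bullet> U v (t + i) \<omega>) * (Df (mu v) \<bullet> U v (t + j) \<omega>))\<bar> \<le> R * \<eta>0"
        unfolding R_def using ij by (intro covariance_perturbation v01 n inT dC dd YU) auto
      also have "expectation (\<lambda>\<omega>. (Df (mu v) \<bullet> U v (t + i) \<omega>) * (Df (mu v) \<bullet> U v (t + j) \<omega>)) = ?\<gamma> (j - i)"
        using lag_stationary[of "Df (mu v)" v "t + i" "t + j"] by simp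
      finally show "\<bar>?c i j - ?\<gamma> (j - i)\<bar> \<le> \<eta>" using \<eta>0(2) by simp
    qed (use elim in auto)
    also have "\<dots> < r" using H \<eta>(2) elim(3) by linarith
    finally show ?case
      unfolding lrv_eq_infsum[OF v01] d_def t_def by simp
  qed
  then show "\<exists>no. \<forall>n\<ge>no. norm (expectation (Zn n (b n) (Df (mun n (real_of_int (\<lfloor>real n * v\<rfloor> - int (L n)) / real n))) \<lfloor>real n * v\<rfloor>) - lrv v) < r"
    by (simp add: eventually_sequentially)
qed

end

section \<open>The infeasible estimator with known drift\<close>

locale block_rates = block_estimation +
  fixes \<tau> L b :: "nat \<Rightarrow> nat"
  assumes \<tau>_pos: "\<forall>n. 1 \<le> \<tau> n"
    and \<tau>_n: "(\<lambda>n. real (\<tau> n) / real n) \<longlonglongrightarrow> 0"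
    and L_n: "(\<lambda>n. real (L n) / real n) \<longlonglongrightarrow> 0"
    and b_inf: "filterlim b at_top sequentially"
    and b3_n: "(\<lambda>n. real (b n) ^ 3 / real n) \<longlonglongrightarrow> 0"
begin

lemma b_n: "(\<lambda>n. real (b n) / real n) \<longlonglongrightarrow> 0"
proof (rule tendsto_0_le[OF b3_n, of _ 1], intro always_eventually allI)
  fix n
  have "real (b n) \<le> real (b n) ^ 3"
    by (cases "b n = 0") (auto simp: self_le_power)
  then show "norm (real (b n) / real n) \<le> norm (real (b n) ^ 3 / real n) * 1"
    by (simp add: divide_right_mono)
qed

definition "I n u = {int (\<tau> n + L n)..\<lfloor>real n * u\<rfloor> - int (b n)}"
text \<open>Evaluated at the time \<open>t - L n\<close> of the pilot, so that it differs from the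
  estimated direction only through the error of the pilot, with no drift involved.\<close>

definition "dt n t = Df (mun n (real_of_int (t - int (L n)) / real n))"
definition "mean n u = (1 / real n) * (\<Sum>t\<in>I n u. expectation (Zn n (b n) (dt n t) t))"
definition "T n u \<omega> = (1 / real n) * (\<Sum>t\<in>I n u. Zn n (b n) (dt n t) t \<omega>)"
definition "Q u = integral {0..u} lrv"

definition "good n \<longleftrightarrow> 1 \<le> n \<and> 1 \<le> b n \<and> (\<forall>u\<in>{0..1}. mun n u \<in> Mdelta)"

lemma eventually_good: "eventually good sequentially"
proof -
  have "eventually (\<lambda>n. 1 \<le> b n) sequentially"
    using b_inf by (auto simp: filterlim_at_top)
  then show ?thesis
    using mun_Mdelta eventually_ge_at_top[of 1] unfolding good_def by eventually_elim auto
qed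

lemma finite_I[simp]: "finite (I n u)" by (simp add: I_def)

lemma I_range:
  assumes "t \<in> I n u" "u \<in> {0..1}"
  shows "1 \<le> t" "int (\<tau> n) \<le> t - int (L n)" "t + int (b n) \<le> int n" "t \<le> int n"
proof -
  have "1 \<le> \<tau> n" using \<tau>_pos by blast
  then show "1 \<le> t" "int (\<tau> n) \<le> t - int (L n)" using assms(1) by (auto simp: I_def)
  have "real n * u \<le> real n * 1" using assms(2) by (intro mult_left_mono) auto
  then have "\<lfloor>real n * u\<rfloor> \<le> int n" by linarith
  then show "t + int (b n) \<le> int n" "t \<le> int n" using assms(1) by (auto simp: I_def)
qed

lemma I_pilot_unit:
  assumes "t \<in> I n u" "u \<in> {0..1}" "1 \<le> n"
  shows "real_of_int (t - int (L n)) / real n \<in> {0..1}"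
  using I_range[OF assms(1,2)] assms(3) by (auto simp: divide_le_eq)

lemma card_I: assumes "u \<in> {0..1}" shows "real (card (I n u)) \<le> real n"
proof -
  have "I n u \<subseteq> {1..int n}" using I_range[OF _ assms] by auto
  from card_mono[OF _ this] show ?thesis by simp
qed

lemma dt_bound:
  assumes "good n" "t \<in> I n u" "u \<in> {0..1}"
  shows "norm (dt n t) \<le> C\<^sub>f"
  unfolding dt_def using assms I_pilot_unit[OF assms(2,3)] by (intro Df_bound) (auto simp: good_def)

lemma Zn_I:
  assumes "good n" "t \<in> I n u" "u \<in> {0..1}"
  shows "integrable M (Zn n (b n) (dt n t) t)" "0 \<le> expectation (Zn n (b n) (dt n t) t)"
    "expectation (Zn n (b n) (dt n t) t) \<le> C\<^sub>Z"
  using Zn_expectation_bound[of n "b n" t "dt n t"] dt_bound[OF assms] I_range[OF assms(2,3)] assms(1)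
  by (auto simp: good_def)

lemma eventually_in_I:
  assumes v: "0 < v" "v < u"
  shows "eventually (\<lambda>n. \<lfloor>real n * v\<rfloor> \<in> I n u) sequentially"
proof -
  have "(\<lambda>n. real (\<tau> n) / real n + real (L n) / real n + 1 / real n) \<longlonglongrightarrow> 0 + 0 + 0"
    by (intro tendsto_intros \<tau>_n L_n lim_1_over_n)
  then have 1: "eventually (\<lambda>n. real (\<tau> n) / real n + real (L n) / real n + 1 / real n < v) sequentially"
    using v by (intro order_tendstoD) auto
  have "(\<lambda>n. real (b n) / real n + 1 / real n) \<longlonglongrightarrow> 0 + 0"
    by (intro tendsto_intros b_n lim_1_over_n)
  then have 2: "eventually (\<lambda>n. real (b n) / real n + 1 / real n < u - v) sequentially"
    using v by (intro order_tendstoD) auto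
  show ?thesis
    using 1 2 eventually_ge_at_top[of 1]
  proof eventually_elim
    case (elim n)
    then have n: "0 < real n" by simp
    have "(real (\<tau> n) + real (L n) + 1) / real n < v" using elim(1) by (simp add: add_divide_distrib)
    then have "real (\<tau> n) + real (L n) + 1 < real n * v" using n by (simp add: divide_less_eq mult.commute)
    moreover have "(real (b n) + 1) / real n < u - v" using elim(2) by (simp add: add_divide_distrib)
    then have "real (b n) + 1 < (u - v) * real n" using n by (simp only: pos_divide_less_eq)
    then have "real (b n) + 1 < real n * u - real n * v" by (simp add: algebra_simps)
    ultimately show ?case unfolding I_def atLeastAtMost_iff by linarith
  qed
qed

lemma mean_limit:
  assumes u: "u \<in> {0..1}"
  shows "(\<lambda>n. mean n u) \<longlonglongrightarrow> Q u"
proof -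
  let ?\<phi> = "\<lambda>n t. expectation (Zn n (b n) (dt n t) t)"
  define h where "h n v = (if \<lfloor>real n * v\<rfloor> \<in> I n u then ?\<phi> n \<lfloor>real n * v\<rfloor> else 0)" for n v
  \<comment> \<open>With the end points among the exceptions, only points strictly inside or
    strictly outside the interval remain.\<close>
  define N where "N = disc \<union> {0, u}"
  have N: "countable N" by (simp add: N_def countable_disc)
  have Nb[measurable]: "N \<in> sets borel" using sets.countable[OF _ N, of borel] by auto
  define g where "g v = (if v \<in> {0..u} - N then lrv v else 0)" for v
  have hm[measurable]: "h n \<in> borel_measurable borel" if "1 \<le> n" for n
    unfolding h_def by (rule riemann_sum_eq_integral(2)[OF that]) simp
  have in01: "v \<in> {0..1}" if "good n" "\<lfloor>real n * v\<rfloor> \<in> I n u" for n v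
  proof -
    have n: "0 < real n" "1 \<le> b n" using that by (auto simp: good_def)
    have "1 \<le> \<lfloor>real n * v\<rfloor>" "\<lfloor>real n * v\<rfloor> + int (b n) \<le> int n" using I_range[OF that(2) u] by auto
    then have "0 \<le> real n * v" "real n * v \<le> real n * 1" using n(2) by linarith+
    then show ?thesis using n(1) by (simp add: zero_le_mult_iff)
  qed
  have lim: "(\<lambda>n. h n v) \<longlonglongrightarrow> g v" if v: "v \<notin> N" for v
  proof (cases "0 < v \<and> v < u")
    case True
    have v': "0 < v" "v < 1" "v \<notin> disc" using True v u by (auto simp: N_def)
    have "(\<lambda>n. ?\<phi> n \<lfloor>real n * v\<rfloor>) \<longlonglongrightarrow> lrv v"
      using Zn_expectation_limit[OF v' b_inf b_n L_n] unfolding dt_def .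
    moreover have "eventually (\<lambda>n. ?\<phi> n \<lfloor>real n * v\<rfloor> = h n v) sequentially"
      using eventually_in_I[of v u] True by (auto simp: h_def elim!: eventually_mono)
    ultimately have "(\<lambda>n. h n v) \<longlonglongrightarrow> lrv v" by (rule Lim_transform_eventually)
    then show ?thesis using True v by (simp add: g_def)
  next
    case False
    have "eventually (\<lambda>n. h n v = 0) sequentially"
      using eventually_good
    proof eventually_elim
      case (elim n)
      have "\<lfloor>real n * v\<rfloor> \<notin> I n u"
      proof
        assume a: "\<lfloor>real n * v\<rfloor> \<in> I n u"
        then have "0 \<le> v" using in01[OF elim] by auto
        then have "u < v" using False v by (auto simp: N_def)
        then have "real n * u \<le> real n * v" by (intro mult_left_mono) auto
        then have "\<lfloor>real n * u\<rfloor> \<le> \<lfloor>real n * v\<rfloor>" by (rule floor_mono)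
        then show False using a elim by (auto simp: I_def good_def)
      qed
      then show ?case by (simp add: h_def)
    qed
    then have "(\<lambda>n. h n v) \<longlonglongrightarrow> 0" by (rule tendsto_eventually)
    moreover have "g v = 0" using False v by (auto simp: g_def N_def)
    ultimately show ?thesis by simp
  qed
  \<comment> \<open>Measurability of \<open>lrv\<close> off the null set comes from the limit
    itself: \<open>g\<close> is a pointwise limit of step functions. The index is
    \<open>Suc n\<close> because the cells need \<open>1 \<le> n\<close>.\<close>
  have gm[measurable]: "g \<in> borel_measurable borel"
  proof (rule borel_measurable_LIMSEQ_real[where u = "\<lambda>n v. if v \<in> N then 0 else h (Suc n) v"])
    fix v show "(\<lambda>n. if v \<in> N then 0 else h (Suc n) v) \<longlonglongrightarrow> g v"
      using lim[of v] by (cases "v \<in> N") (auto simp: g_def intro: LIMSEQ_Suc)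
  next
    fix n
    have [measurable]: "h (Suc n) \<in> borel_measurable borel" by (rule hm) simp
    show "(\<lambda>v. if v \<in> N then 0 else h (Suc n) v) \<in> borel_measurable borel" by measurable
  qed
  \<comment> \<open>Domination is required for every member of the sequence, hence the shift by
    \<open>n0\<close>.\<close>
  obtain n0 where n0: "\<And>n. n0 \<le> n \<Longrightarrow> good n"
    using eventually_good unfolding eventually_sequentially by blast
  let ?w = "\<lambda>v. C\<^sub>Z * indicator {0..1::real} v"
  have wi: "integrable lborel ?w" by simp
  have hb: "norm (h (n + n0) v) \<le> ?w v" for n v
    using Zn_I[OF n0[of "n + n0"] _ u] in01[OF n0[of "n + n0"]] C\<^sub>Z_nonneg by (auto simp: h_def indicator_def)
  have nullN: "N \<in> null_sets lborel" by (rule countable_imp_null_set_lborel[OF N])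
  have AEl: "AE v in lborel. (\<lambda>n. h (n + n0) v) \<longlonglongrightarrow> g v"
    using AE_not_in[OF nullN] by eventually_elim (intro LIMSEQ_ignore_initial_segment lim)
  have hm': "h (n + n0) \<in> borel_measurable lborel" for n
    using hm[of "n + n0"] n0[of "n + n0"] by (simp add: good_def)
  have gi: "integrable lborel g"
    by (rule integrable_dominated_convergence[OF _ hm' wi AEl]) (use hb in auto)
  have "(\<lambda>n. integral\<^sup>L lborel (h (n + n0))) \<longlonglongrightarrow> integral\<^sup>L lborel g"
    by (rule integral_dominated_convergence[OF _ hm' wi AEl]) (use hb in auto)
  moreover have "integral\<^sup>L lborel (h (n + n0)) = mean (n + n0) u" for n
    unfolding mean_def h_def using n0[of "n + n0"]
    by (subst riemann_sum_eq_integral(1)) (auto simp: good_def)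
  ultimately have "(\<lambda>n. mean (n + n0) u) \<longlonglongrightarrow> integral\<^sup>L lborel g" by simp
  then have "(\<lambda>n. mean n u) \<longlonglongrightarrow> integral\<^sup>L lborel g" by (rule LIMSEQ_offset)
  \<comment> \<open>\<open>Q\<close> is a gauge integral: the Lebesgue integral of \<open>g\<close>
    is also its gauge integral, and restoring \<open>lrv\<close> on the negligible set
    \<open>N\<close> does not change it.\<close>
  moreover have "integral\<^sup>L lborel g = Q u"
  proof -
    have "(g has_integral (integral\<^sup>L lborel g)) UNIV"
      by (rule has_integral_integral_lborel[OF gi])
    then have "((\<lambda>v. if v \<in> {0..u} then lrv v else 0) has_integral (integral\<^sup>L lborel g)) UNIV"
      by (rule has_integral_spike[rotated 2, where S = N])
         (auto simp: g_def negligible_iff_null_sets null_sets_completionI[OF nullN])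
    then have "(lrv has_integral (integral\<^sup>L lborel g)) {0..u}"
      by (rule iffD1[OF has_integral_restrict_UNIV])
    then show ?thesis by (simp add: Q_def integral_unique)
  qed
  ultimately show ?thesis by simp
qed

text \<open>Read off from the approximating averages: between the two end points at most
  \<open>n * (u' - u) + 1\<close> terms enter, each between 0 and \<open>C\<^sub>Z\<close>, and both
  bounds survive the limit.\<close>

lemma Q_increment:
  assumes "0 \<le> u" "u \<le> u'" "u' \<le> 1"
  shows "Q u \<le> Q u'" "Q u' - Q u \<le> C\<^sub>Z * (u' - u)"
proof -
  have u: "u \<in> {0..1}" "u' \<in> {0..1}" using assms by auto
  let ?\<phi> = "\<lambda>n t. expectation (Zn n (b n) (dt n t) t)"
  have step: "0 \<le> mean n u' - mean n u \<and> mean n u' - mean n u \<le> C\<^sub>Z * (u' - u) + C\<^sub>Z * (1 / real n)" if g: "good n" for n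
  proof -
    have n: "0 < real n" using g by (simp add: good_def)
    have fl: "\<lfloor>real n * u\<rfloor> \<le> \<lfloor>real n * u'\<rfloor>" using assms by (intro floor_mono mult_left_mono) auto
    then have sub: "I n u \<subseteq> I n u'" by (auto simp: I_def)
    have eq: "mean n u' - mean n u = (1 / real n) * (\<Sum>t\<in>I n u' - I n u. ?\<phi> n t)"
      unfolding mean_def right_diff_distrib[symmetric] by (subst sum_diff[OF finite_I sub]) simp
    have 1: "0 \<le> (\<Sum>t\<in>I n u' - I n u. ?\<phi> n t)"
      by (intro sum_nonneg Zn_I(2)[OF g _ u(2)]) auto
    have "(\<Sum>t\<in>I n u' - I n u. ?\<phi> n t) \<le> real (card (I n u' - I n u)) * C\<^sub>Z"
      by (intro sum_bounded_above Zn_I(3)[OF g _ u(2)]) auto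
    also have "real (card (I n u' - I n u)) \<le> real n * (u' - u) + 1"
    proof -
      have "card (I n u' - I n u) \<le> card {\<lfloor>real n * u\<rfloor> - int (b n)<..\<lfloor>real n * u'\<rfloor> - int (b n)}"
        by (intro card_mono) (auto simp: I_def)
      also have "\<dots> = nat (\<lfloor>real n * u'\<rfloor> - \<lfloor>real n * u\<rfloor>)" by simp
      finally have "real (card (I n u' - I n u)) \<le> real (nat (\<lfloor>real n * u'\<rfloor> - \<lfloor>real n * u\<rfloor>))"
        by simp
      also have "\<dots> = real_of_int (\<lfloor>real n * u'\<rfloor> - \<lfloor>real n * u\<rfloor>)" using fl by simp
      also have "\<dots> \<le> real n * u' - real n * u + 1" by linarith
      finally show ?thesis by (simp add: algebra_simps)
    qed
    finally have 2: "(\<Sum>t\<in>I n u' - I n u. ?\<phi> n t) \<le> (real n * (u' - u) + 1) * C\<^sub>Z"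
      using C\<^sub>Z_nonneg by (simp add: mult_right_mono)
    have "(1 / real n) * (\<Sum>t\<in>I n u' - I n u. ?\<phi> n t) \<le> (1 / real n) * ((real n * (u' - u) + 1) * C\<^sub>Z)"
      using 2 n by (intro mult_left_mono) auto
    also have "\<dots> = C\<^sub>Z * (u' - u) + C\<^sub>Z * (1 / real n)" using n by (simp add: field_simps)
    finally show ?thesis unfolding eq using 1 n by auto
  qed
  have lim: "(\<lambda>n. mean n u' - mean n u) \<longlonglongrightarrow> Q u' - Q u"
    by (intro tendsto_diff mean_limit u)
  have ev: "eventually (\<lambda>n. 0 \<le> mean n u' - mean n u) sequentially"
    "eventually (\<lambda>n. mean n u' - mean n u \<le> C\<^sub>Z * (u' - u) + C\<^sub>Z * (1 / real n)) sequentially"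
    using eventually_good by (auto elim!: eventually_mono dest: step)
  have "0 \<le> Q u' - Q u"
    by (rule tendsto_lowerbound[OF lim ev(1)]) simp
  then show "Q u \<le> Q u'" by simp
  have "(\<lambda>n. C\<^sub>Z * (u' - u) + C\<^sub>Z * (1 / real n)) \<longlonglongrightarrow> C\<^sub>Z * (u' - u) + C\<^sub>Z * 0"
    by (intro tendsto_intros lim_1_over_n)
  then show "Q u' - Q u \<le> C\<^sub>Z * (u' - u)"
    using tendsto_le[OF _ _ lim ev(2)] by simp
qed

lemma Q_nonneg: "u \<in> {0..1} \<Longrightarrow> 0 \<le> Q u"
  using Q_increment(1)[of 0 u] by (simp add: Q_def)

lemma T_measurable: "T n u \<in> borel_measurable M"
  unfolding T_def[abs_def] Zn_def Sn_def Yn_def by measurable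

text \<open>Half of \<open>c\<close> absorbs the deterministic error of the mean; Chebyshev's
  inequality treats the rest, the variance of the average being of order
  \<open>b^3 / n\<close>.\<close>

lemma T_converges:
  assumes u: "u \<in> {0..1}" and c: "0 < c"
  shows "(\<lambda>n. prob {\<omega>\<in>space M. c < \<bar>T n u \<omega> - Q u\<bar>}) \<longlonglongrightarrow> 0"
proof -
  define C where "C = 16 * C\<^sub>f ^ 4 * K ^ 4 / (1 - \<rho>)\<^sup>2"
  have C0: "0 \<le> C" by (simp add: C_def)
  note [measurable] = T_measurable
  have var: "prob {\<omega>\<in>space M. c / 2 < \<bar>T n u \<omega> - mean n u\<bar>} \<le> 4 * C / c\<^sup>2 * (real (b n) ^ 3 / real n)" if g: "good n" for n
  proof -
    have n: "1 \<le> n" "1 \<le> b n" using g by (auto simp: good_def)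
    then have n0: "0 < real n" by simp
    interpret A: innov_array M \<epsilon> \<epsilon>s "\<lambda>t x. Gn n (real_of_int t / real n) x - mun n (real_of_int t / real n)" "{0..int n}" K \<rho>
      by (rule array_n[OF n(1)])
    have Z: "A.Z (b n) d t = Zn n (b n) d t" for d t
      by (auto simp: fun_eq_iff A.Z_def A.S_def A.Y_def Zn_def Sn_def Yn_def)
    let ?D = "\<lambda>\<omega>. \<Sum>t\<in>I n u. Zn n (b n) (dt n t) t \<omega> - expectation (Zn n (b n) (dt n t) t)"
    have blk: "{t + 1..t + int (b n)} \<subseteq> {0..int n}" if "t \<in> I n u" for t
      using I_range[OF that u] by auto
    have v: "integrable M (\<lambda>\<omega>. (?D \<omega>)\<^sup>2)" "expectation (\<lambda>\<omega>. (?D \<omega>)\<^sup>2) \<le> C * real (card (I n u)) * real (b n) ^ 3"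
      using A.Z_sum_variance[OF n(2) C\<^sub>f_nonneg finite_I blk dt_bound[OF g _ u], of n u "\<lambda>t. t"]
      unfolding Z C_def by auto
    have eq: "T n u \<omega> - mean n u = ?D \<omega> / real n" for \<omega>
      by (simp add: T_def mean_def sum_subtractf diff_divide_distrib)
    have "prob {\<omega>\<in>space M. c / 2 < \<bar>T n u \<omega> - mean n u\<bar>} \<le> prob {\<omega>\<in>space M. (real n * c / 2)\<^sup>2 \<le> (?D \<omega>)\<^sup>2}"
    proof (rule finite_measure_mono)
      show "{\<omega>\<in>space M. c / 2 < \<bar>T n u \<omega> - mean n u\<bar>} \<subseteq> {\<omega>\<in>space M. (real n * c / 2)\<^sup>2 \<le> (?D \<omega>)\<^sup>2}"
      proof safe
        fix \<omega> assume "c / 2 < \<bar>T n u \<omega> - mean n u\<bar>"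
        then have "\<bar>real n * c / 2\<bar> \<le> \<bar>?D \<omega>\<bar>" unfolding eq using n0 c by (simp add: field_simps)
        then show "(real n * c / 2)\<^sup>2 \<le> (?D \<omega>)\<^sup>2" by (simp only: abs_le_square_iff)
      qed
      show "{\<omega>\<in>space M. (real n * c / 2)\<^sup>2 \<le> (?D \<omega>)\<^sup>2} \<in> events"
        using borel_measurable_integrable[OF v(1)] by measurable
    qed
    also have "\<dots> \<le> expectation (\<lambda>\<omega>. (?D \<omega>)\<^sup>2) / (real n * c / 2)\<^sup>2"
      by (rule integral_Markov_inequality_measure[OF v(1), of "{}"]) (use n0 c in auto)
    also have "\<dots> \<le> (C * real n * real (b n) ^ 3) / (real n * c / 2)\<^sup>2"
    proof (intro divide_right_mono order_trans[OF v(2)] mult_right_mono mult_left_mono)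
      show "real (card (I n u)) \<le> real n" by (rule card_I[OF u])
    qed (use C0 in auto)
    also have "\<dots> = 4 * C / c\<^sup>2 * (real (b n) ^ 3 / real n)"
      using n0 c by (simp add: power2_eq_square field_simps)
    finally show ?thesis .
  qed
  have "eventually (\<lambda>n. \<bar>mean n u - Q u\<bar> < c / 2) sequentially"
    using c tendstoD[OF mean_limit[OF u], of "c / 2"] by (simp add: dist_real_def)
  then have "eventually (\<lambda>n. norm (prob {\<omega>\<in>space M. c < \<bar>T n u \<omega> - Q u\<bar>}) \<le> norm (4 * C / c\<^sup>2 * (real (b n) ^ 3 / real n)) * 1) sequentially"
    using eventually_good
  proof eventually_elim
    case (elim n)
    have "prob {\<omega>\<in>space M. c < \<bar>T n u \<omega> - Q u\<bar>} \<le> prob {\<omega>\<in>space M. c / 2 < \<bar>T n u \<omega> - mean n u\<bar>}"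
    proof (rule finite_measure_mono)
      show "{\<omega>\<in>space M. c < \<bar>T n u \<omega> - Q u\<bar>} \<subseteq> {\<omega>\<in>space M. c / 2 < \<bar>T n u \<omega> - mean n u\<bar>}"
      proof safe
        fix \<omega> assume "c < \<bar>T n u \<omega> - Q u\<bar>"
        then show "c / 2 < \<bar>T n u \<omega> - mean n u\<bar>" using elim(1) by linarith
      qed
    qed measurable
    also note var[OF elim(2)]
    finally show ?case
      unfolding real_norm_def mult_1_right abs_of_nonneg[OF measure_nonneg] by (rule order_trans[OF _ abs_ge_self])
  qed
  moreover have "(\<lambda>n. 4 * C / c\<^sup>2 * (real (b n) ^ 3 / real n)) \<longlonglongrightarrow> 0"
    using tendsto_mult_right_zero[OF b3_n] by blast
  ultimately show ?thesis by (rule tendsto_0_le[rotated])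
qed

end

section \<open>The effect of the pilot estimator\<close>

text \<open>Young's inequality for the cross term. Summed over blocks, the main part reappears as
  \<theta> times a convergent quantity, and the perturbation enters only through its square.\<close>

lemma square_perturbation:
  fixes x y :: real
  assumes "0 < \<theta>"
  shows "\<bar>(x + y)\<^sup>2 - x\<^sup>2\<bar> \<le> \<theta> * x\<^sup>2 + (1 + 1 / \<theta>) * y\<^sup>2"
proof -
  have "2 * \<bar>x * y\<bar> \<le> \<theta> * x\<^sup>2 + (1 / \<theta>) * y\<^sup>2"
  proof -
    have "0 \<le> (sqrt \<theta> * \<bar>x\<bar> - \<bar>y\<bar> / sqrt \<theta>)\<^sup>2" by simp
    also have "\<dots> = \<theta> * x\<^sup>2 + (1 / \<theta>) * y\<^sup>2 - 2 * \<bar>x * y\<bar>"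
      using assms by (simp add: power2_diff power_mult_distrib power_divide abs_mult)
    finally show ?thesis by simp
  qed
  moreover have eq: "(x + y)\<^sup>2 - x\<^sup>2 = 2 * (x * y) + y\<^sup>2" by (simp add: power2_sum)
  have "\<bar>(x + y)\<^sup>2 - x\<^sup>2\<bar> \<le> 2 * \<bar>x * y\<bar> + y\<^sup>2"
    unfolding eq using zero_le_power2[of y] by linarith
  ultimately show ?thesis unfolding distrib_right by linarith
qed

lemma norm_sum_squared_le:
  fixes x :: "'i \<Rightarrow> 'b::real_normed_vector"
  assumes "finite A"
  shows "(norm (\<Sum>i\<in>A. x i))\<^sup>2 \<le> real (card A) * (\<Sum>i\<in>A. (norm (x i))\<^sup>2)"
proof -
  have "(norm (\<Sum>i\<in>A. x i))\<^sup>2 \<le> (\<Sum>i\<in>A. norm (x i))\<^sup>2"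
    by (intro power_mono norm_sum) auto
  also have "\<dots> = (\<Sum>i\<in>A. 1 * norm (x i))\<^sup>2" by simp
  also have "\<dots> \<le> (\<Sum>i\<in>A. 1\<^sup>2) * (\<Sum>i\<in>A. (norm (x i))\<^sup>2)"
    by (rule Cauchy_Schwarz_ineq_sum)
  finally show ?thesis by simp
qed

text \<open>Each of the two added rates belongs to one error: \<open>b_\<kappa>\<close> to centering
  at the pilot value, \<open>b_pvar\<close> to the drift of the mean over a block.\<close>

locale block_pilot = block_rates +
  fixes muhat :: "int \<Rightarrow> nat \<Rightarrow> 'a \<Rightarrow> real^'b" and \<kappa> :: real
  assumes muhat_meas: "\<forall>n t. int (\<tau> n) \<le> t \<and> t \<le> int n \<longrightarrow> muhat t n \<in> borel_measurable (past_sigma M \<epsilon> t)"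
    and C5: "small_oP M (\<lambda>n \<omega>. \<Sum>t\<in>{int (\<tau> n)..int n}. (norm (muhat t n \<omega> - mun n (real_of_int t / real n)))\<^sup>2)
             (\<lambda>n. real n powr (1 - \<kappa>))"
    and A6: "(\<lambda>n. measure M {\<omega>\<in>space M. \<forall>t\<in>{int (\<tau> n)..int n}. muhat t n \<omega> \<in> Mdelta}) \<longlonglongrightarrow> 1"
    and \<kappa>: "0 < \<kappa>"
    and b_\<kappa>: "(\<lambda>n. real (b n) / real n powr \<kappa>) \<longlonglongrightarrow> 0"
    and b_pvar: "(\<lambda>n. real (b n) * ((real (L n) + real (b n)) / real n) powr (2 / max p 2)) \<longlonglongrightarrow> 0"
begin

definition "err n \<omega> = (\<Sum>t\<in>{int (\<tau> n)..int n}. (norm (muhat t n \<omega> - mun n (real_of_int t / real n)))\<^sup>2)"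
text \<open>The cut-off makes the direction error bounded for every outcome once \<open>n\<close> is
  large, so that expectations can be used; with probability tending to one it is inactive.\<close>

definition "W n t \<omega> = (if muhat (t - int (L n)) n \<omega> \<in> Mdelta then Df (muhat (t - int (L n)) n \<omega>) - dt n t else 0)"
definition "VW n u \<omega> = (1 / real n) * (\<Sum>t\<in>I n u. (norm (W n t \<omega>))\<^sup>2)"
definition "R n u \<omega> = (1 / real n) * (\<Sum>t\<in>I n u. (W n t \<omega> \<bullet> Sn n (b n) t \<omega>)\<^sup>2 / real (b n))"
definition "drift n u = (1 / real n) * (\<Sum>t\<in>I n u. \<Sum>i\<in>{1..b n}.
    (norm (mun n (real_of_int (t + int i) / real n) - mun n (real_of_int (t - int (L n)) / real n)))\<^sup>2)"
definition "Qn n u \<omega> = (1 / real n) * (\<Sum>t\<in>I n u. (1 / real (b n)) *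
               (Df (muhat (t - int (L n)) n \<omega>) \<bullet>
                  (\<Sum>i\<in>{1..b n}. Gn n (real_of_int (t + int i) / real n) (eps_seq \<epsilon> (t + int i) \<omega>) - muhat (t - int (L n)) n \<omega>))\<^sup>2)"

lemma muhat_measurable: "int (\<tau> n) \<le> t \<Longrightarrow> t \<le> int n \<Longrightarrow> muhat t n \<in> borel_measurable M"
  using muhat_meas borel_measurable_innov_sigma_M unfolding past_sigma_eq[of M \<epsilon> _ \<epsilon>s] by blast

lemma err_measurable: "err n \<in> borel_measurable M"
  unfolding err_def
proof (rule borel_measurable_sum)
  fix t assume "t \<in> {int (\<tau> n)..int n}"
  then have [measurable]: "muhat t n \<in> borel_measurable M" by (auto intro: muhat_measurable)
  show "(\<lambda>\<omega>. (norm (muhat t n \<omega> - mun n (real_of_int t / real n)))\<^sup>2) \<in> borel_measurable M"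
    by measurable
qed

lemma err_prob:
  assumes "c > 0" shows "(\<lambda>n. prob {\<omega>\<in>space M. c * real n powr (1 - \<kappa>) < err n \<omega>}) \<longlonglongrightarrow> 0"
proof -
  have "\<bar>err n \<omega>\<bar> = err n \<omega>" for n \<omega> by (simp add: err_def sum_nonneg)
  then show ?thesis
    using C5 assms unfolding small_oP_def err_def[symmetric] by simp
qed

lemma W_bounds:
  assumes "good n" "t \<in> I n u" "u \<in> {0..1}"
  shows "norm (W n t \<omega>) \<le> 2 * C\<^sub>f"
    "(norm (W n t \<omega>))\<^sup>2 \<le> C\<^sub>f\<^sup>2 * (norm (muhat (t - int (L n)) n \<omega> - mun n (real_of_int (t - int (L n)) / real n)))\<^sup>2"
proof -
  let ?m = "muhat (t - int (L n)) n \<omega>" and ?\<mu> = "mun n (real_of_int (t - int (L n)) / real n)"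
  have \<mu>: "?\<mu> \<in> Mdelta" using assms I_pilot_unit[OF assms(2,3)] by (auto simp: good_def)
  show "norm (W n t \<omega>) \<le> 2 * C\<^sub>f"
  proof (cases "?m \<in> Mdelta")
    case True
    then show ?thesis
      using norm_triangle_ineq4[of "Df ?m" "dt n t"] Df_bound[OF True] dt_bound[OF assms] by (simp add: W_def)
  qed (use C\<^sub>f_nonneg in \<open>auto simp: W_def\<close>)
  have "norm (W n t \<omega>) \<le> C\<^sub>f * norm (?m - ?\<mu>)"
  proof (cases "?m \<in> Mdelta")
    case True
    then show ?thesis
      using Df_Lipschitz[OF True \<mu>] by (simp add: W_def dt_def)
  qed (use C\<^sub>f_nonneg in \<open>auto simp: W_def\<close>)
  then have "(norm (W n t \<omega>))\<^sup>2 \<le> (C\<^sub>f * norm (?m - ?\<mu>))\<^sup>2" by (intro power_mono) auto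
  then show "(norm (W n t \<omega>))\<^sup>2 \<le> C\<^sub>f\<^sup>2 * (norm (?m - ?\<mu>))\<^sup>2" by (simp add: power_mult_distrib)
qed

lemma W_measurable_past:
  assumes "t \<in> I n u" "u \<in> {0..1}"
  shows "W n t \<in> borel_measurable (past_sigma M \<epsilon> (t - int (L n)))"
proof -
  have [measurable]: "muhat (t - int (L n)) n \<in> borel_measurable (past_sigma M \<epsilon> (t - int (L n)))"
    using muhat_meas I_range[OF assms] by auto
  have [measurable]: "Df \<in> borel_measurable borel"
    by (rule borel_measurable_continuous_onI[OF Df_continuous])
  have [measurable]: "Mdelta \<in> sets borel" using Mdelta_open by simp
  show ?thesis unfolding W_def by measurable
qed

lemma W_measurable[measurable]:
  assumes "t \<in> I n u" "u \<in> {0..1}" shows "W n t \<in> borel_measurable M"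
  using borel_measurable_innov_sigma_M W_measurable_past[OF assms] unfolding past_sigma_eq[of M \<epsilon> _ \<epsilon>s] by blast

text \<open>The summation starts at \<open>\<tau> n + L n\<close>, so every pilot time
  \<open>t - L n\<close> falls into the range in which the pilot error is controlled.\<close>

lemma pilot_sum_le_err:
  assumes u: "u \<in> {0..1}"
  shows "(\<Sum>t\<in>I n u. (norm (muhat (t - int (L n)) n \<omega> - mun n (real_of_int (t - int (L n)) / real n)))\<^sup>2) \<le> err n \<omega>"
proof -
  let ?f = "\<lambda>t. (norm (muhat t n \<omega> - mun n (real_of_int t / real n)))\<^sup>2"
  have "(\<Sum>t\<in>I n u. ?f (t - int (L n))) = (\<Sum>t\<in>(\<lambda>t. t - int (L n)) ` I n u. ?f t)"
    by (subst sum.reindex) (auto simp: inj_on_def)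
  also have "\<dots> \<le> err n \<omega>"
    unfolding err_def
  proof (rule sum_mono2)
    show "(\<lambda>t. t - int (L n)) ` I n u \<subseteq> {int (\<tau> n)..int n}"
      using I_range[OF _ u] by force
  qed auto
  finally show ?thesis .
qed

lemma VW_bounds:
  assumes g: "good n" and u: "u \<in> {0..1}"
  shows "0 \<le> VW n u \<omega>" "VW n u \<omega> \<le> 4 * C\<^sub>f\<^sup>2" "VW n u \<omega> \<le> C\<^sub>f\<^sup>2 * (err n \<omega> / real n)"
proof -
  have n: "0 < real n" using g by (simp add: good_def)
  show "0 \<le> VW n u \<omega>" by (auto simp: VW_def intro!: sum_nonneg divide_nonneg_nonneg)
  have "(\<Sum>t\<in>I n u. (norm (W n t \<omega>))\<^sup>2) \<le> real (card (I n u)) * (4 * C\<^sub>f\<^sup>2)"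
  proof (rule sum_bounded_above)
    fix t assume "t \<in> I n u"
    then have "(norm (W n t \<omega>))\<^sup>2 \<le> (2 * C\<^sub>f)\<^sup>2" by (intro power_mono W_bounds(1)[OF g _ u]) auto
    then show "(norm (W n t \<omega>))\<^sup>2 \<le> 4 * C\<^sub>f\<^sup>2" by (simp add: power_mult_distrib)
  qed
  also have "\<dots> \<le> real n * (4 * C\<^sub>f\<^sup>2)" by (intro mult_right_mono card_I u) auto
  finally show "VW n u \<omega> \<le> 4 * C\<^sub>f\<^sup>2" using n by (simp add: VW_def divide_le_eq mult.commute)
  have "(\<Sum>t\<in>I n u. (norm (W n t \<omega>))\<^sup>2)
     \<le> C\<^sub>f\<^sup>2 * (\<Sum>t\<in>I n u. (norm (muhat (t - int (L n)) n \<omega> - mun n (real_of_int (t - int (L n)) / real n)))\<^sup>2)"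
    unfolding sum_distrib_left by (intro sum_mono W_bounds(2)[OF g _ u])
  also have "\<dots> \<le> C\<^sub>f\<^sup>2 * err n \<omega>" by (intro mult_left_mono pilot_sum_le_err u) auto
  finally have "(\<Sum>t\<in>I n u. (norm (W n t \<omega>))\<^sup>2) / real n \<le> C\<^sub>f\<^sup>2 * err n \<omega> / real n" using n by (intro divide_right_mono) auto
  then show "VW n u \<omega> \<le> C\<^sub>f\<^sup>2 * (err n \<omega> / real n)" by (simp add: VW_def)
qed

lemma VW_measurable: "u \<in> {0..1} \<Longrightarrow> VW n u \<in> borel_measurable M"
  unfolding VW_def
  by (intro borel_measurable_times borel_measurable_sum borel_measurable_power borel_measurable_norm W_measurable) auto

text \<open>The pilot error is small only in probability. Off an event of vanishing probability
  \<open>VW\<close> is small, and on that event the cut-off bounds it by a constant. Convergence in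
  mean is needed because independence yields products of expectations.\<close>

lemma VW_expectation:
  assumes u: "u \<in> {0..1}"
  shows "(\<lambda>n. expectation (VW n u)) \<longlonglongrightarrow> 0"
proof (rule LIMSEQ_I)
  fix r :: real assume r: "0 < r"
  define D where "D = C\<^sub>f\<^sup>2 + 1"
  define c where "c = r / (2 * D)"
  have C1: "0 < D" by (simp add: D_def add_nonneg_pos)
  have c: "0 < c" "C\<^sub>f\<^sup>2 * c \<le> r / 2"
  proof -
    show "0 < c" using r C1 by (simp add: c_def)
    have "C\<^sub>f\<^sup>2 * c \<le> D * c" using \<open>0 < c\<close> by (intro mult_right_mono) (auto simp: D_def)
    also have "\<dots> = r / 2" using C1 by (simp add: c_def)
    finally show "C\<^sub>f\<^sup>2 * c \<le> r / 2" .
  qed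
  have "(\<lambda>n. 4 * C\<^sub>f\<^sup>2 * prob {\<omega>\<in>space M. c * real n powr (1 - \<kappa>) < err n \<omega>}) \<longlonglongrightarrow> 0"
    using tendsto_mult_right_zero[OF err_prob[OF c(1)]] by blast
  then have "eventually (\<lambda>n. 4 * C\<^sub>f\<^sup>2 * prob {\<omega>\<in>space M. c * real n powr (1 - \<kappa>) < err n \<omega>} < r / 2) sequentially"
    using r by (intro order_tendstoD) auto
  then have "eventually (\<lambda>n. norm (expectation (VW n u) - 0) < r) sequentially"
    using eventually_good
  proof eventually_elim
    case (elim n)
    note [measurable] = VW_measurable[OF u] err_measurable
    have n1: "1 \<le> real n" using elim(2) by (simp add: good_def)
    have pn: "real n powr (1 - \<kappa>) \<le> real n"
      using powr_mono[of "1 - \<kappa>" 1 "real n"] n1 \<kappa> by simp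
    let ?E = "{\<omega>\<in>space M. c * real n powr (1 - \<kappa>) < err n \<omega>}"
    have pw: "VW n u \<omega> \<le> C\<^sub>f\<^sup>2 * c + 4 * C\<^sub>f\<^sup>2 * indicator ?E \<omega>" if "\<omega> \<in> space M" for \<omega>
    proof (cases "\<omega> \<in> ?E")
      case True
      then show ?thesis using VW_bounds(2)[OF elim(2) u, of \<omega>] c(1) by (simp add: add_increasing)
    next
      case False
      then have "err n \<omega> \<le> c * real n powr (1 - \<kappa>)" using that by auto
      also have "\<dots> \<le> c * real n" using pn c by (intro mult_left_mono) auto
      finally have "err n \<omega> / real n \<le> c" using n1 by (simp add: divide_le_eq)
      then have "C\<^sub>f\<^sup>2 * (err n \<omega> / real n) \<le> C\<^sub>f\<^sup>2 * c" by (intro mult_left_mono) auto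
      then show ?thesis using VW_bounds(3)[OF elim(2) u, of \<omega>] False by simp
    qed
    have i: "integrable M (VW n u)"
      by (rule integrable_const_bound[where B = "4 * C\<^sub>f\<^sup>2"]) (use VW_bounds[OF elim(2) u] in auto)
    have "?E \<in> events" by measurable
    then have ind: "integrable M (\<lambda>\<omega>. 4 * C\<^sub>f\<^sup>2 * indicator ?E \<omega>)" "expectation (\<lambda>\<omega>. 4 * C\<^sub>f\<^sup>2 * indicator ?E \<omega>) = 4 * C\<^sub>f\<^sup>2 * prob ?E"
      by (auto intro!: integrable_mult_right integrable_real_indicator simp: less_top[symmetric])
    have "expectation (VW n u) \<le> expectation (\<lambda>\<omega>. C\<^sub>f\<^sup>2 * c + 4 * C\<^sub>f\<^sup>2 * indicator ?E \<omega>)"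
      by (intro integral_mono i Bochner_Integration.integrable_add ind(1) integrable_const pw)
    also have "\<dots> = C\<^sub>f\<^sup>2 * c + 4 * C\<^sub>f\<^sup>2 * prob ?E"
      using ind by (subst Bochner_Integration.integral_add) (auto simp: prob_space)
    also have "\<dots> < r" using c(2) elim(1) by linarith
    finally have "expectation (VW n u) < r" .
    moreover have "0 \<le> expectation (VW n u)" using VW_bounds(1)[OF elim(2) u] by (intro integral_nonneg_AE) auto
    ultimately show ?case by simp
  qed
  then show "\<exists>no. \<forall>n\<ge>no. norm (expectation (VW n u) - 0) < r" by (simp add: eventually_sequentially)
qed

definition "C\<^sub>R = 2 * (real DIM(real^'b) * (sqrt (2 / (1 - \<rho>)) * K) + K / (1 - \<rho>))\<^sup>2"

text \<open>The factor \<open>b\<close> in front of the mean of the squared direction error cancels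
  against the normalisation of a block, and the coupling remainder is left with order
  \<open>1 / b\<close>.\<close>

lemma R_expectation:
  assumes g: "good n" and u: "u \<in> {0..1}"
  shows "integrable M (R n u)" "expectation (R n u) \<le> C\<^sub>R * (expectation (VW n u) + 4 * C\<^sub>f\<^sup>2 / real (b n))"
proof -
  have n: "1 \<le> n" "1 \<le> b n" using g by (auto simp: good_def)
  then have n0: "0 < real n" "0 < real (b n)" by auto
  interpret A: innov_array M \<epsilon> \<epsilon>s "\<lambda>t x. Gn n (real_of_int t / real n) x - mun n (real_of_int t / real n)" "{0..int n}" K \<rho>
    by (rule array_n[OF n(1)])
  have S: "A.S (b n) t = Sn n (b n) t" for t
    by (auto simp: fun_eq_iff A.S_def A.Y_def Sn_def Yn_def)
  have CR: "2 * (real DIM(real^'b) * A.A0 + K / (1 - \<rho>))\<^sup>2 = C\<^sub>R" by (simp add: C\<^sub>R_def A.A0_def)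
  have C0: "0 \<le> C\<^sub>R" by (simp add: C\<^sub>R_def)
  have W: "integrable M (\<lambda>\<omega>. (W n t \<omega> \<bullet> Sn n (b n) t \<omega>)\<^sup>2)"
    "expectation (\<lambda>\<omega>. (W n t \<omega> \<bullet> Sn n (b n) t \<omega>)\<^sup>2) \<le> C\<^sub>R * (real (b n) * expectation (\<lambda>\<omega>. (norm (W n t \<omega>))\<^sup>2) + (2 * C\<^sub>f)\<^sup>2)"
    if t: "t \<in> I n u" for t
  proof -
    have blk: "{t + 1..t + int (b n)} \<subseteq> {0..int n}" using I_range[OF t u] by auto
    have "W n t \<in> borel_measurable (A.F (t - int (L n)))"
      using W_measurable_past[OF t u] unfolding A.F_def past_sigma_eq[of M \<epsilon> _ \<epsilon>s] .
    then have "W n t \<in> borel_measurable (A.F t)" by (rule A.F_mono) simp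
    from A.predictable_direction_L2[OF blk this W_bounds(1)[OF g t u] n(2)]
    show "integrable M (\<lambda>\<omega>. (W n t \<omega> \<bullet> Sn n (b n) t \<omega>)\<^sup>2)"
      "expectation (\<lambda>\<omega>. (W n t \<omega> \<bullet> Sn n (b n) t \<omega>)\<^sup>2) \<le> C\<^sub>R * (real (b n) * expectation (\<lambda>\<omega>. (norm (W n t \<omega>))\<^sup>2) + (2 * C\<^sub>f)\<^sup>2)"
      unfolding S CR by auto
  qed
  show "integrable M (R n u)"
    unfolding R_def using W(1) by (intro integrable_mult_right Bochner_Integration.integrable_sum) auto
  have Wi: "integrable M (\<lambda>\<omega>. (norm (W n t \<omega>))\<^sup>2)" if t: "t \<in> I n u" for t
  proof (rule integrable_const_bound[where B = "(2 * C\<^sub>f)\<^sup>2"])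
    show "(\<lambda>\<omega>. (norm (W n t \<omega>))\<^sup>2) \<in> borel_measurable M" using W_measurable[OF t u] by measurable
    show "AE \<omega> in M. norm ((norm (W n t \<omega>))\<^sup>2) \<le> (2 * C\<^sub>f)\<^sup>2"
    proof (intro AE_I2)
      fix \<omega>
      have "(norm (W n t \<omega>))\<^sup>2 \<le> (2 * C\<^sub>f)\<^sup>2" by (intro power_mono W_bounds(1)[OF g t u]) auto
      then show "norm ((norm (W n t \<omega>))\<^sup>2) \<le> (2 * C\<^sub>f)\<^sup>2" by simp
    qed
  qed
  have "expectation (R n u) = (1 / real n) * (\<Sum>t\<in>I n u. expectation (\<lambda>\<omega>. (W n t \<omega> \<bullet> Sn n (b n) t \<omega>)\<^sup>2) / real (b n))"
    unfolding R_def using W(1) by simp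
  also have "\<dots> \<le> (1 / real n) * (\<Sum>t\<in>I n u. C\<^sub>R * expectation (\<lambda>\<omega>. (norm (W n t \<omega>))\<^sup>2) + C\<^sub>R * (4 * C\<^sub>f\<^sup>2 / real (b n)))"
  proof (intro mult_left_mono sum_mono)
    fix t assume t: "t \<in> I n u"
    have "expectation (\<lambda>\<omega>. (W n t \<omega> \<bullet> Sn n (b n) t \<omega>)\<^sup>2) / real (b n)
      \<le> C\<^sub>R * (real (b n) * expectation (\<lambda>\<omega>. (norm (W n t \<omega>))\<^sup>2) + (2 * C\<^sub>f)\<^sup>2) / real (b n)"
      using W(2)[OF t] by (intro divide_right_mono) auto
    also have "\<dots> = C\<^sub>R * expectation (\<lambda>\<omega>. (norm (W n t \<omega>))\<^sup>2) + C\<^sub>R * (4 * C\<^sub>f\<^sup>2 / real (b n))"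
      using n0 by (simp add: power_mult_distrib field_simps)
    finally show "expectation (\<lambda>\<omega>. (W n t \<omega> \<bullet> Sn n (b n) t \<omega>)\<^sup>2) / real (b n)
      \<le> C\<^sub>R * expectation (\<lambda>\<omega>. (norm (W n t \<omega>))\<^sup>2) + C\<^sub>R * (4 * C\<^sub>f\<^sup>2 / real (b n))" .
  qed (use n0 in auto)
  also have "\<dots> = C\<^sub>R * ((1 / real n) * (\<Sum>t\<in>I n u. expectation (\<lambda>\<omega>. (norm (W n t \<omega>))\<^sup>2)))
      + C\<^sub>R * (4 * C\<^sub>f\<^sup>2 / real (b n)) * (real (card (I n u)) / real n)"
    by (simp add: sum.distrib sum_distrib_left[symmetric] add_divide_distrib)
  also have "(1 / real n) * (\<Sum>t\<in>I n u. expectation (\<lambda>\<omega>. (norm (W n t \<omega>))\<^sup>2)) = expectation (VW n u)"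
    unfolding VW_def using Wi by simp
  also have "C\<^sub>R * expectation (VW n u) + C\<^sub>R * (4 * C\<^sub>f\<^sup>2 / real (b n)) * (real (card (I n u)) / real n)
     \<le> C\<^sub>R * expectation (VW n u) + C\<^sub>R * (4 * C\<^sub>f\<^sup>2 / real (b n)) * 1"
    using card_I[OF u, of n] C0 n0 by (intro add_left_mono mult_left_mono) (auto simp: divide_le_eq)
  finally show "expectation (R n u) \<le> C\<^sub>R * (expectation (VW n u) + 4 * C\<^sub>f\<^sup>2 / real (b n))"
    by (simp add: algebra_simps)
qed

lemma R_nonneg: "0 \<le> R n u \<omega>"
  by (auto simp: R_def intro!: sum_nonneg divide_nonneg_nonneg)

lemma R_converges:
  assumes u: "u \<in> {0..1}" and c: "0 < c"
  shows "(\<lambda>n. prob {\<omega>\<in>space M. c \<le> R n u \<omega>}) \<longlonglongrightarrow> 0"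
proof (rule tendsto_0_le[where K = 1])
  have "(\<lambda>n. 4 * C\<^sub>f\<^sup>2 / real (b n)) \<longlonglongrightarrow> 0"
    by (rule tendsto_divide_0[OF tendsto_const filterlim_at_top_imp_at_infinity])
       (rule filterlim_compose[OF filterlim_real_sequentially b_inf])
  then have "(\<lambda>n. C\<^sub>R * (expectation (VW n u) + 4 * C\<^sub>f\<^sup>2 / real (b n)) / c) \<longlonglongrightarrow> C\<^sub>R * (0 + 0) / c"
    using c by (intro tendsto_intros VW_expectation[OF u]) auto
  then show "(\<lambda>n. C\<^sub>R * (expectation (VW n u) + 4 * C\<^sub>f\<^sup>2 / real (b n)) / c) \<longlonglongrightarrow> 0" by simp
  show "eventually (\<lambda>n. norm (prob {\<omega>\<in>space M. c \<le> R n u \<omega>}) \<le> norm (C\<^sub>R * (expectation (VW n u) + 4 * C\<^sub>f\<^sup>2 / real (b n)) / c) * 1) sequentially"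
    using eventually_good
  proof eventually_elim
    case (elim n)
    have "prob {\<omega>\<in>space M. c \<le> R n u \<omega>} \<le> expectation (R n u) / c"
      by (rule integral_Markov_inequality_measure[OF R_expectation(1)[OF elim u], of "{}"]) (use c R_nonneg in auto)
    also have "\<dots> \<le> C\<^sub>R * (expectation (VW n u) + 4 * C\<^sub>f\<^sup>2 / real (b n)) / c"
      using R_expectation(2)[OF elim u] c by (intro divide_right_mono) auto
    finally show ?case
      unfolding real_norm_def mult_1_right abs_of_nonneg[OF measure_nonneg] by (rule order_trans[OF _ abs_ge_self])
  qed
qed

text \<open>The constant of \<open>sum_squares_pvar_le\<close> for increments bounded by
  \<open>2 * C\<^sub>G + 1\<close>; the added ones keep the constants positive when
  \<open>C\<^sub>G\<close> is zero.\<close>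

definition "C\<^sub>V = ((2 * C\<^sub>G + 1) powr (max p 2 - p) * (C\<^sub>G powr p + 1)) powr (2 / max p 2)"

text \<open>For fixed \<open>i\<close> every increment spans \<open>L n + i\<close> grid steps, so
  the control bounds the sum of \<open>p\<close>-th powers by that number times a constant. Passing
  to squares gives the power of \<open>(L + b) / n\<close>, and adding over \<open>i\<close> the
  factor \<open>b\<close>.\<close>

lemma drift_bound:
  assumes g: "good n" and u: "u \<in> {0..1}"
  shows "drift n u \<le> C\<^sub>V * (real (b n) * ((real (L n) + real (b n)) / real n) powr (2 / max p 2))"
proof -
  have n: "1 \<le> n" "1 \<le> b n" using g by (auto simp: good_def)
  then have n0: "0 < real n" "0 < real (b n)" by auto
  have "\<exists>V. (\<forall>x\<in>{0..1}. 0 \<le> V x \<and> V x \<le> C\<^sub>G powr p) \<and> (\<forall>x y. 0 \<le> x \<longrightarrow> x < y \<longrightarrow> y \<le> 1 \<longrightarrow> V x + dn n x y powr p \<le> V y)"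
  proof (rule pvar_control_exists[of "dn n" p "C\<^sub>G powr p"])
    fix V :: "real \<Rightarrow> real"
    assume "\<And>x. x \<in> {0..1} \<Longrightarrow> 0 \<le> V x \<and> V x \<le> C\<^sub>G powr p"
      "\<And>x y. 0 \<le> x \<Longrightarrow> x < y \<Longrightarrow> y \<le> 1 \<Longrightarrow> V x + dn n x y powr p \<le> V y"
    then show ?thesis by blast
  qed (rule dn_partition_bound)
  then obtain V where V: "\<And>x. x \<in> {0..1} \<Longrightarrow> 0 \<le> V x \<and> V x \<le> C\<^sub>G powr p"
    "\<And>x y. 0 \<le> x \<Longrightarrow> x < y \<Longrightarrow> y \<le> 1 \<Longrightarrow> V x + dn n x y powr p \<le> V y"
    by blast
  let ?x = "\<lambda>i t. norm (mun n (real_of_int (t + int i) / real n) - mun n (real_of_int (t - int (L n)) / real n))"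
  let ?k = "real (L n) + real (b n)"
  have one: "(\<Sum>t\<in>I n u. (?x i t)\<^sup>2) \<le> real n * (C\<^sub>V * (?k / real n) powr (2 / max p 2))" if i: "i \<in> {1..b n}" for i
  proof -
    have unit: "real_of_int (t - int (L n)) / real n \<in> {0..1}" "real_of_int (t + int i) / real n \<in> {0..1}"
      "real_of_int (t - int (L n)) / real n < real_of_int (t + int i) / real n" if t: "t \<in> I n u" for t
      using I_pilot_unit[OF t u n(1)] I_range[OF t u] i n0 by (auto simp: divide_le_eq divide_less_cancel)
    have xd: "?x i t \<le> dn n (real_of_int (t - int (L n)) / real n) (real_of_int (t + int i) / real n)" if t: "t \<in> I n u" for t
    proof -
      let ?a = "real_of_int (t - int (L n)) / real n" and ?c = "real_of_int (t + int i) / real n"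
      have int: "integrable M (\<lambda>\<omega>. Gn n w (eps_seq \<epsilon> 0 \<omega>))" if "w \<in> {0..1}" for w
        by (rule Lq_le_expectation(1)[OF Gn_Lq[OF that]]) (use q in auto)
      have "norm (expectation (\<lambda>\<omega>. Gn n ?c (eps_seq \<epsilon> 0 \<omega>) - Gn n ?a (eps_seq \<epsilon> 0 \<omega>))) \<le> dn n ?a ?c"
        by (rule Lq_le_expectation(2)[OF dn_Lq_le[OF unit(1,2)[OF t]]]) (use q in auto)
      then show ?thesis using int[OF unit(1)[OF t]] int[OF unit(2)[OF t]] by (simp add: mun_eq)
    qed
    have mb: "norm (mun n w) \<le> C\<^sub>G" if "w \<in> {0..1}" for w
      unfolding mun_eq by (rule Lq_le_expectation(2)[OF Gn_Lq[OF that]]) (use q in auto)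
    have "(\<Sum>t\<in>I n u. ?x i t powr p) \<le> (\<Sum>t\<in>I n u. V (real_of_int (t + int i) / real n) - V (real_of_int (t - int (L n)) / real n))"
    proof (rule sum_mono)
      fix t assume t: "t \<in> I n u"
      have "?x i t powr p \<le> dn n (real_of_int (t - int (L n)) / real n) (real_of_int (t + int i) / real n) powr p"
        using xd[OF t] p by (intro powr_mono2) auto
      also have "\<dots> \<le> V (real_of_int (t + int i) / real n) - V (real_of_int (t - int (L n)) / real n)"
        using V(2)[of "real_of_int (t - int (L n)) / real n" "real_of_int (t + int i) / real n"] unit[OF t] by auto
      finally show "?x i t powr p \<le> V (real_of_int (t + int i) / real n) - V (real_of_int (t - int (L n)) / real n)" .
    qed
    \<comment> \<open>Counting from the pilot time turns the increment into a forward shift by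
      \<open>L n + i\<close>.\<close>
    also have "\<dots> = (\<Sum>s\<in>{int (\<tau> n)..\<lfloor>real n * u\<rfloor> - int (b n) - int (L n)}.
        V (real_of_int (s + int (L n + i)) / real n) - V (real_of_int s / real n))"
      unfolding I_def by (rule sum.reindex_bij_witness[of _ "\<lambda>s. s + int (L n)" "\<lambda>t. t - int (L n)"]) auto
    also have "\<dots> \<le> real (L n + i) * C\<^sub>G powr p"
    proof (rule sum_shift_diff_le)
      fix s assume s: "s \<in> {int (\<tau> n)..\<lfloor>real n * u\<rfloor> - int (b n) - int (L n) + int (L n + i)}"
      have "real n * u \<le> real n * 1" using u by (intro mult_left_mono) auto
      then have "\<lfloor>real n * u\<rfloor> \<le> int n" by linarith
      then have "0 \<le> s" "s \<le> int n" using s i by auto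
      then show "0 \<le> V (real_of_int s / real n) \<and> V (real_of_int s / real n) \<le> C\<^sub>G powr p"
        using n0 by (intro V(1)) (auto simp: divide_le_eq)
    qed simp
    also have "\<dots> \<le> ?k * (C\<^sub>G powr p + 1)" using i by (intro mult_mono) auto
    finally have sum: "(\<Sum>t\<in>I n u. ?x i t powr p) \<le> ?k * (C\<^sub>G powr p + 1)" .
    have "(\<Sum>t\<in>I n u. (?x i t)\<^sup>2)
       \<le> real n * (((2 * C\<^sub>G + 1) powr (max p 2 - p) * (C\<^sub>G powr p + 1)) * (?k / real n)) powr (2 / max p 2)"
    proof (rule sum_squares_pvar_le[OF finite_I card_I[OF u] _ _ sum p])
      fix t assume t: "t \<in> I n u"
      show "0 \<le> ?x i t \<and> ?x i t \<le> 2 * C\<^sub>G + 1"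
        using norm_triangle_ineq4[of "mun n (real_of_int (t + int i) / real n)" "mun n (real_of_int (t - int (L n)) / real n)"]
          mb[OF unit(1)[OF t]] mb[OF unit(2)[OF t]] by auto
    qed (use n0 C\<^sub>G_nonneg in \<open>auto simp: add_nonneg_pos\<close>)
    also have "\<dots> = real n * (C\<^sub>V * (?k / real n) powr (2 / max p 2))"
      unfolding C\<^sub>V_def using n0 C\<^sub>G_nonneg by (subst powr_mult) auto
    finally show ?thesis .
  qed
  have "drift n u = (1 / real n) * (\<Sum>i\<in>{1..b n}. \<Sum>t\<in>I n u. (?x i t)\<^sup>2)"
    unfolding drift_def by (subst sum.swap) simp
  also have "\<dots> \<le> (1 / real n) * (\<Sum>i\<in>{1..b n}. real n * (C\<^sub>V * (?k / real n) powr (2 / max p 2)))"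
    using n0 by (intro mult_left_mono sum_mono one) auto
  also have "\<dots> = C\<^sub>V * (real (b n) * (?k / real n) powr (2 / max p 2))"
    using n0 by simp
  finally show ?thesis .
qed

end

section \<open>Comparison with the infeasible estimator and uniform convergence\<close>

context block_pilot
begin

text \<open>The projected block sum is the infeasible one plus three errors, whose squares are
  averaged separately. The centering error is the same for all terms of a block, so it is multiplied
  by \<open>b\<close>; after squaring and dividing by \<open>b\<close> it leaves
  \<open>b / n\<close> times the total pilot error.\<close>

lemma Qn_T_diff:
  assumes g: "good n" and u: "u \<in> {0..1}" and \<theta>: "0 < \<theta>"
    and in_M: "\<forall>t\<in>{int (\<tau> n)..int n}. muhat t n \<omega> \<in> Mdelta"
  shows "\<bar>Qn n u \<omega> - T n u \<omega>\<bar> \<le> \<theta> * T n u \<omega>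
     + (1 + 1 / \<theta>) * (3 * (R n u \<omega> + C\<^sub>f\<^sup>2 * drift n u + C\<^sub>f\<^sup>2 * (real (b n) / real n * err n \<omega>)))"
proof -
  have n: "0 < real n" "0 < real (b n)" using g by (auto simp: good_def)
  let ?m = "\<lambda>t. muhat (t - int (L n)) n \<omega>" and ?\<mu> = "\<lambda>t. mun n (real_of_int (t - int (L n)) / real n)"
  let ?\<Delta> = "\<lambda>t i. mun n (real_of_int (t + int i) / real n) - ?\<mu> t"
  let ?x = "\<lambda>t. dt n t \<bullet> Sn n (b n) t \<omega>"
  \<comment> \<open>In turn: the error of the direction, the drift of the mean over the block, and
    centering at the pilot value instead of the mean.\<close>
  let ?y1 = "\<lambda>t. W n t \<omega> \<bullet> Sn n (b n) t \<omega>"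
  let ?y2 = "\<lambda>t. Df (?m t) \<bullet> (\<Sum>i\<in>{1..b n}. ?\<Delta> t i)"
  let ?y3 = "\<lambda>t. Df (?m t) \<bullet> (real (b n) *\<^sub>R (?\<mu> t - ?m t))"
  let ?y = "\<lambda>t. ?y1 t + ?y2 t + ?y3 t"
  let ?q = "\<lambda>t. (norm (?m t - ?\<mu> t))\<^sup>2" and ?s = "\<lambda>t. \<Sum>i\<in>{1..b n}. (norm (?\<Delta> t i))\<^sup>2"
  have mM: "?m t \<in> Mdelta" if "t \<in> I n u" for t
    using in_M I_range[OF that u] by auto
  have split: "Df (?m t) \<bullet> (\<Sum>i\<in>{1..b n}. Gn n (real_of_int (t + int i) / real n) (eps_seq \<epsilon> (t + int i) \<omega>) - ?m t)
      = ?x t + ?y t" if t: "t \<in> I n u" for t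
  proof -
    have "(\<Sum>i\<in>{1..b n}. Gn n (real_of_int (t + int i) / real n) (eps_seq \<epsilon> (t + int i) \<omega>) - ?m t)
       = (\<Sum>i\<in>{1..b n}. Yn n (t + int i) \<omega> + (?\<Delta> t i + (?\<mu> t - ?m t)))"
      by (intro sum.cong) (auto simp: Yn_def)
    also have "\<dots> = Sn n (b n) t \<omega> + ((\<Sum>i\<in>{1..b n}. ?\<Delta> t i) + real (b n) *\<^sub>R (?\<mu> t - ?m t))"
      unfolding sum.distrib by (simp add: Sn_def sum_constant_scaleR del: sum_constant)
    finally have 1: "(\<Sum>i\<in>{1..b n}. Gn n (real_of_int (t + int i) / real n) (eps_seq \<epsilon> (t + int i) \<omega>) - ?m t)
       = Sn n (b n) t \<omega> + ((\<Sum>i\<in>{1..b n}. ?\<Delta> t i) + real (b n) *\<^sub>R (?\<mu> t - ?m t))" .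
    have "Df (?m t) = dt n t + W n t \<omega>" using mM[OF t] by (simp add: W_def)
    then have "Df (?m t) \<bullet> Sn n (b n) t \<omega> = ?x t + ?y1 t" by (simp add: inner_add_left)
    then show ?thesis unfolding 1 inner_add_right by simp
  qed
  have y: "(?y t)\<^sup>2 / real (b n) \<le> 3 * ((?y1 t)\<^sup>2 / real (b n) + C\<^sub>f\<^sup>2 * ?s t + C\<^sub>f\<^sup>2 * real (b n) * ?q t)" if t: "t \<in> I n u" for t
  proof -
    have D: "norm (Df (?m t)) \<le> C\<^sub>f" by (rule Df_bound[OF mM[OF t]])
    have inner_le: "(Df (?m t) \<bullet> z)\<^sup>2 \<le> C\<^sub>f\<^sup>2 * (norm z)\<^sup>2" for z
    proof -
      have "\<bar>Df (?m t) \<bullet> z\<bar> \<le> norm (Df (?m t)) * norm z" by (rule Cauchy_Schwarz_ineq2)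
      also have "\<dots> \<le> C\<^sub>f * norm z" by (intro mult_right_mono D) auto
      finally have "\<bar>Df (?m t) \<bullet> z\<bar>\<^sup>2 \<le> (C\<^sub>f * norm z)\<^sup>2" by (intro power_mono) auto
      then show ?thesis by (simp add: power_mult_distrib)
    qed
    have 2: "(?y2 t)\<^sup>2 \<le> C\<^sub>f\<^sup>2 * (real (b n) * ?s t)"
      by (rule order_trans[OF inner_le mult_left_mono]) (use norm_sum_squared_le[of "{1..b n}" "?\<Delta> t"] in auto)
    have 3: "(?y3 t)\<^sup>2 \<le> C\<^sub>f\<^sup>2 * ((real (b n))\<^sup>2 * ?q t)"
      by (rule order_trans[OF inner_le]) (simp add: power_mult_distrib norm_minus_commute)
    have "(?y t)\<^sup>2 \<le> 3 * ((?y1 t)\<^sup>2 + (?y2 t)\<^sup>2 + (?y3 t)\<^sup>2)"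
    proof -
      have "(a + b + c)\<^sup>2 \<le> 3 * (a\<^sup>2 + b\<^sup>2 + c\<^sup>2)" for a b c :: real
        using sum_squares_bound[of a b] sum_squares_bound[of a c] sum_squares_bound[of b c]
        by (simp add: power2_eq_square algebra_simps)
      then show ?thesis .
    qed
    also have "\<dots> \<le> 3 * ((?y1 t)\<^sup>2 + C\<^sub>f\<^sup>2 * (real (b n) * ?s t) + C\<^sub>f\<^sup>2 * ((real (b n))\<^sup>2 * ?q t))"
      using 2 3 by simp
    finally have "(?y t)\<^sup>2 / real (b n) \<le> 3 * ((?y1 t)\<^sup>2 + C\<^sub>f\<^sup>2 * (real (b n) * ?s t) + C\<^sub>f\<^sup>2 * ((real (b n))\<^sup>2 * ?q t)) / real (b n)"
      using n by (intro divide_right_mono) auto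
    also have "\<dots> = 3 * ((?y1 t)\<^sup>2 / real (b n) + C\<^sub>f\<^sup>2 * ?s t + C\<^sub>f\<^sup>2 * real (b n) * ?q t)"
      using n by (simp add: add_divide_distrib power2_eq_square)
    finally show ?thesis .
  qed
  let ?Y = "(1 / real n) * (\<Sum>t\<in>I n u. (?y t)\<^sup>2 / real (b n))"
  have Y: "?Y \<le> 3 * (R n u \<omega> + C\<^sub>f\<^sup>2 * drift n u + C\<^sub>f\<^sup>2 * (real (b n) / real n * err n \<omega>))"
  proof -
    have "(\<Sum>t\<in>I n u. (?y t)\<^sup>2 / real (b n))
      \<le> (\<Sum>t\<in>I n u. 3 * ((?y1 t)\<^sup>2 / real (b n) + C\<^sub>f\<^sup>2 * ?s t + C\<^sub>f\<^sup>2 * real (b n) * ?q t))"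
      by (intro sum_mono y)
    also have "\<dots> = 3 * ((\<Sum>t\<in>I n u. (?y1 t)\<^sup>2 / real (b n)) + C\<^sub>f\<^sup>2 * (\<Sum>t\<in>I n u. ?s t) + C\<^sub>f\<^sup>2 * real (b n) * (\<Sum>t\<in>I n u. ?q t))"
      by (simp only: sum_distrib_left[symmetric] sum.distrib)
    also have "\<dots> \<le> 3 * ((\<Sum>t\<in>I n u. (?y1 t)\<^sup>2 / real (b n)) + C\<^sub>f\<^sup>2 * (\<Sum>t\<in>I n u. ?s t) + C\<^sub>f\<^sup>2 * real (b n) * err n \<omega>)"
      by (intro mult_left_mono add_left_mono pilot_sum_le_err u) auto
    finally have "?Y \<le> (1 / real n) * (3 * ((\<Sum>t\<in>I n u. (?y1 t)\<^sup>2 / real (b n)) + C\<^sub>f\<^sup>2 * (\<Sum>t\<in>I n u. ?s t) + C\<^sub>f\<^sup>2 * real (b n) * err n \<omega>))"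
      using n by (intro mult_left_mono) auto
    also have "\<dots> = 3 * (R n u \<omega> + C\<^sub>f\<^sup>2 * drift n u + C\<^sub>f\<^sup>2 * (real (b n) / real n * err n \<omega>))"
      unfolding R_def drift_def by (simp add: add_divide_distrib distrib_left)
    finally show ?thesis .
  qed
  have "Qn n u \<omega> - T n u \<omega> = (1 / real n) * (\<Sum>t\<in>I n u. ((?x t + ?y t)\<^sup>2 - (?x t)\<^sup>2) / real (b n))"
    unfolding Qn_def T_def Zn_def right_diff_distrib[symmetric] sum_subtractf[symmetric]
  proof (rule arg_cong[where f = "(*) (1 / real n)"], rule sum.cong[OF refl])
    fix t assume "t \<in> I n u"
    show "(1 / real (b n)) * (Df (?m t) \<bullet> (\<Sum>i\<in>{1..b n}. Gn n (real_of_int (t + int i) / real n) (eps_seq \<epsilon> (t + int i) \<omega>) - ?m t))\<^sup>2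
        - (?x t)\<^sup>2 / real (b n) = ((?x t + ?y t)\<^sup>2 - (?x t)\<^sup>2) / real (b n)"
      unfolding split[OF \<open>t \<in> I n u\<close>] by (simp add: diff_divide_distrib)
  qed
  then have "\<bar>Qn n u \<omega> - T n u \<omega>\<bar> = (1 / real n) * \<bar>\<Sum>t\<in>I n u. ((?x t + ?y t)\<^sup>2 - (?x t)\<^sup>2) / real (b n)\<bar>"
    using n by (simp add: abs_mult)
  also have "\<dots> \<le> (1 / real n) * (\<Sum>t\<in>I n u. \<theta> * ((?x t)\<^sup>2 / real (b n)) + (1 + 1 / \<theta>) * ((?y t)\<^sup>2 / real (b n)))"
  proof (intro mult_left_mono order_trans[OF sum_abs] sum_mono)
    fix t assume "t \<in> I n u"
    have "\<bar>((?x t + ?y t)\<^sup>2 - (?x t)\<^sup>2) / real (b n)\<bar> = \<bar>(?x t + ?y t)\<^sup>2 - (?x t)\<^sup>2\<bar> / real (b n)"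
      using n by simp
    also have "\<dots> \<le> (\<theta> * (?x t)\<^sup>2 + (1 + 1 / \<theta>) * (?y t)\<^sup>2) / real (b n)"
      using n by (intro divide_right_mono square_perturbation[OF \<theta>]) auto
    also have "\<dots> = \<theta> * ((?x t)\<^sup>2 / real (b n)) + (1 + 1 / \<theta>) * ((?y t)\<^sup>2 / real (b n))"
      by (simp only: add_divide_distrib times_divide_eq_right)
    finally show "\<bar>((?x t + ?y t)\<^sup>2 - (?x t)\<^sup>2) / real (b n)\<bar> \<le> \<theta> * ((?x t)\<^sup>2 / real (b n)) + (1 + 1 / \<theta>) * ((?y t)\<^sup>2 / real (b n))" .
  qed (use n in auto)
  also have "\<dots> = \<theta> * T n u \<omega> + (1 + 1 / \<theta>) * ?Y"
    unfolding T_def Zn_def sum.distrib sum_distrib_left[symmetric] distrib_left by simp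
  also have "\<dots> \<le> \<theta> * T n u \<omega> + (1 + 1 / \<theta>) * (3 * (R n u \<omega> + C\<^sub>f\<^sup>2 * drift n u + C\<^sub>f\<^sup>2 * (real (b n) / real n * err n \<omega>)))"
    using Y \<theta> by (intro add_left_mono mult_left_mono) auto
  finally show ?thesis .
qed

lemma Qn_measurable: assumes u: "u \<in> {0..1}" shows "Qn n u \<in> borel_measurable M"
proof -
  have [measurable]: "Df \<in> borel_measurable borel"
    by (rule borel_measurable_continuous_onI[OF Df_continuous])
  have m: "(\<lambda>\<omega>. (1 / real (b n)) * (Df (muhat (t - int (L n)) n \<omega>) \<bullet>
                  (\<Sum>i\<in>{1..b n}. Gn n (real_of_int (t + int i) / real n) (eps_seq \<epsilon> (t + int i) \<omega>) - muhat (t - int (L n)) n \<omega>))\<^sup>2) \<in> borel_measurable M"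
    if t: "t \<in> I n u" for t
  proof -
    have [measurable]: "muhat (t - int (L n)) n \<in> borel_measurable M"
      using I_range[OF t u] by (intro muhat_measurable) auto
    show ?thesis by measurable
  qed
  show ?thesis
    unfolding Qn_def by (rule borel_measurable_times[OF borel_measurable_const borel_measurable_sum]) (rule m)
qed

lemma Qn_mono: "u \<le> u' \<Longrightarrow> Qn n u \<omega> \<le> Qn n u' \<omega>"
proof -
  assume "u \<le> u'"
  then have "\<lfloor>real n * u\<rfloor> \<le> \<lfloor>real n * u'\<rfloor>" by (intro floor_mono mult_left_mono) auto
  then have "I n u \<subseteq> I n u'" by (auto simp: I_def)
  then show ?thesis unfolding Qn_def by (intro mult_left_mono sum_mono2) auto
qed

lemma Qn_converges:
  assumes u: "u \<in> {0..1}" and c: "0 < c"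
  shows "(\<lambda>n. prob {\<omega>\<in>space M. c < \<bar>Qn n u \<omega> - Q u\<bar>}) \<longlonglongrightarrow> 0"
proof -
  \<comment> \<open>Budget for \<open>c\<close>: \<open>T\<close> is at most \<open>a\<close> off
    the exceptional events because \<open>c1 \<le> 1\<close>, so \<open>\<theta> * a\<close> uses
    one quarter; three errors of size at most \<open>c2\<close>, multiplied by \<open>3 * w\<close>,
    use another; the distance from \<open>T\<close> to \<open>Q\<close> uses a third.\<close>
  define a where "a = Q u + 1"
  define \<theta> where "\<theta> = c / (4 * a)"
  have Q0: "0 < a" using Q_nonneg[OF u] by (simp add: a_def)
  have \<theta>: "0 < \<theta>" "\<theta> * a = c / 4" using c Q0 by (auto simp: \<theta>_def)
  define c1 where "c1 = min 1 (c / 4)"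
  have c1: "0 < c1" "c1 \<le> 1" "c1 \<le> c / 4" using c by (auto simp: c1_def)
  define w where "w = 1 + 1 / \<theta>"
  have w: "0 < w" using \<theta> by (simp add: w_def add_pos_pos)
  define c2 where "c2 = c / (36 * w)"
  have c2: "0 < c2" "w * (3 * (c2 + c2 + c2)) = c / 4" using c w by (auto simp: c2_def)
  define E where "E n = {\<omega>\<in>space M. \<forall>t\<in>{int (\<tau> n)..int n}. muhat t n \<omega> \<in> Mdelta}" for n
  have E[measurable]: "E n \<in> events" for n
  proof -
    have "{\<omega>\<in>space M. muhat t n \<omega> \<in> Mdelta} \<in> events" if "t \<in> {int (\<tau> n)..int n}" for t
    proof -
      have [measurable]: "muhat t n \<in> borel_measurable M" using that by (intro muhat_measurable) auto
      have [measurable]: "Mdelta \<in> sets borel" using Mdelta_open by simp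
      show ?thesis by measurable
    qed
    then show ?thesis unfolding E_def by (intro sets.sets_Collect_finite_All) auto
  qed
  have Elim: "(\<lambda>n. prob (space M - E n)) \<longlonglongrightarrow> 0"
  proof -
    have "(\<lambda>n. 1 - prob (E n)) \<longlonglongrightarrow> 1 - 1" using A6 unfolding E_def by (intro tendsto_intros)
    then show ?thesis by (simp add: prob_compl E)
  qed
  have "(\<lambda>n. C\<^sub>f\<^sup>2 * (C\<^sub>V * (real (b n) * ((real (L n) + real (b n)) / real n) powr (2 / max p 2)))) \<longlonglongrightarrow> C\<^sub>f\<^sup>2 * (C\<^sub>V * 0)"
    by (intro tendsto_intros b_pvar)
  then have ev1: "eventually (\<lambda>n. C\<^sub>f\<^sup>2 * (C\<^sub>V * (real (b n) * ((real (L n) + real (b n)) / real n) powr (2 / max p 2))) < c2) sequentially"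
    using c2 by (intro order_tendstoD) auto
  have "(\<lambda>n. C\<^sub>f\<^sup>2 * (real (b n) / real n powr \<kappa>)) \<longlonglongrightarrow> C\<^sub>f\<^sup>2 * 0"
    by (intro tendsto_intros b_\<kappa>)
  then have ev2: "eventually (\<lambda>n. C\<^sub>f\<^sup>2 * (real (b n) / real n powr \<kappa>) < c2) sequentially"
    using c2 by (intro order_tendstoD) auto
  \<comment> \<open>The exceptional events: a pilot value outside \<open>Mdelta\<close>, a large
    pilot error, a deviation of the infeasible estimator, and a large direction term.\<close>
  let ?A = "\<lambda>n. space M - E n" and ?B = "\<lambda>n. {\<omega>\<in>space M. 1 * real n powr (1 - \<kappa>) < err n \<omega>}"
    and ?C = "\<lambda>n. {\<omega>\<in>space M. c1 < \<bar>T n u \<omega> - Q u\<bar>}" and ?D = "\<lambda>n. {\<omega>\<in>space M. c2 \<le> R n u \<omega>}"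
  note [measurable] = err_measurable T_measurable
  have lim: "(\<lambda>n. prob (?A n) + prob (?B n) + prob (?C n) + prob (?D n)) \<longlonglongrightarrow> 0 + 0 + 0 + 0"
    by (intro tendsto_add Elim err_prob T_converges R_converges u c1 c2) simp
  have bound: "eventually (\<lambda>n. norm (prob {\<omega>\<in>space M. c < \<bar>Qn n u \<omega> - Q u\<bar>}) \<le> norm (prob (?A n) + prob (?B n) + prob (?C n) + prob (?D n)) * 1) sequentially"
    using ev1 ev2 eventually_good
  proof eventually_elim
    case (elim n)
    have n: "0 < real n" using elim(3) by (simp add: good_def)
    have [measurable]: "R n u \<in> borel_measurable M" using R_expectation(1)[OF elim(3) u] by auto
    have m: "?A n \<in> events" "?B n \<in> events" "?C n \<in> events" "?D n \<in> events" by measurable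
    have "{\<omega>\<in>space M. c < \<bar>Qn n u \<omega> - Q u\<bar>} \<subseteq> ?A n \<union> ?B n \<union> ?C n \<union> ?D n"
    proof (rule ccontr)
      assume "\<not> ?thesis"
      then obtain \<omega> where "\<omega> \<in> space M" "c < \<bar>Qn n u \<omega> - Q u\<bar>" "\<omega> \<notin> ?A n \<union> ?B n \<union> ?C n \<union> ?D n"
        by blast
      then have \<omega>: "\<omega> \<in> space M" "c < \<bar>Qn n u \<omega> - Q u\<bar>" "\<omega> \<in> E n"
        "err n \<omega> \<le> real n powr (1 - \<kappa>)" "\<bar>T n u \<omega> - Q u\<bar> \<le> c1" "R n u \<omega> < c2"
        by (auto simp: not_less not_le)
      have T: "T n u \<omega> \<le> a" "\<bar>T n u \<omega> - Q u\<bar> \<le> c / 4" using \<omega>(5) c1 by (auto simp: a_def)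
      have e: "C\<^sub>f\<^sup>2 * (real (b n) / real n * err n \<omega>) \<le> c2"
      proof -
        have "real (b n) / real n * err n \<omega> \<le> real (b n) / real n * real n powr (1 - \<kappa>)"
          using \<omega>(4) n by (intro mult_left_mono) auto
        also have "\<dots> = real (b n) / real n powr \<kappa>"
          using n by (simp add: powr_diff)
        finally show ?thesis using elim(2) mult_left_mono[of "real (b n) / real n * err n \<omega>" "real (b n) / real n powr \<kappa>" "C\<^sub>f\<^sup>2"] by auto
      qed
      have d: "C\<^sub>f\<^sup>2 * drift n u \<le> c2"
        using elim(1) mult_left_mono[OF drift_bound[OF elim(3) u], of "C\<^sub>f\<^sup>2"] by auto
      have "\<bar>Qn n u \<omega> - T n u \<omega>\<bar> \<le> \<theta> * T n u \<omega>
         + w * (3 * (R n u \<omega> + C\<^sub>f\<^sup>2 * drift n u + C\<^sub>f\<^sup>2 * (real (b n) / real n * err n \<omega>)))"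
        unfolding w_def by (rule Qn_T_diff[OF elim(3) u \<theta>(1)]) (use \<omega>(3) in \<open>auto simp: E_def\<close>)
      also have "\<dots> \<le> \<theta> * a + w * (3 * (c2 + c2 + c2))"
        using T(1) \<omega>(6) d e \<theta>(1) w by (intro add_mono mult_left_mono) auto
      also have "\<dots> = c / 2" unfolding \<theta>(2) c2(2) by simp
      finally show False using T(2) \<omega>(2) c by linarith
    qed
    then have "prob {\<omega>\<in>space M. c < \<bar>Qn n u \<omega> - Q u\<bar>} \<le> prob (?A n \<union> ?B n \<union> ?C n \<union> ?D n)"
      using m by (intro finite_measure_mono) auto
    also have "\<dots> \<le> prob (?A n) + prob (?B n) + prob (?C n) + prob (?D n)"
    proof -
      have "prob (?A n \<union> ?B n \<union> ?C n \<union> ?D n) \<le> prob (?A n \<union> ?B n \<union> ?C n) + prob (?D n)"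
        using m by (intro measure_Un_le) auto
      moreover have "prob (?A n \<union> ?B n \<union> ?C n) \<le> prob (?A n \<union> ?B n) + prob (?C n)"
        using m by (intro measure_Un_le) auto
      moreover have "prob (?A n \<union> ?B n) \<le> prob (?A n) + prob (?B n)"
        using m by (intro measure_Un_le) auto
      ultimately show ?thesis by linarith
    qed
    finally show ?case
      unfolding real_norm_def mult_1_right abs_of_nonneg[OF measure_nonneg] by (rule order_trans[OF _ abs_ge_self])
  qed
  show ?thesis by (rule tendsto_0_le[OF lim[unfolded add_0] bound])
qed

text \<open>\<open>Qn\<close> is monotone in \<open>u\<close> and \<open>Q\<close> is Lipschitz, so pointwise convergence on a finite grid suffices.\<close>
lemma Qn_converges_uniformly:
  assumes c: "0 < c"
  shows "(\<lambda>n. prob {\<omega>\<in>space M. \<exists>u\<in>{0..1}. \<bar>Qn n u \<omega> - Q u\<bar> > c}) \<longlonglongrightarrow> 0"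
proof -
  \<comment> \<open>Fine enough that \<open>Q\<close> grows by at most \<open>c / 2\<close> on a
    cell; the other half of \<open>c\<close> is for the deviation at grid points.\<close>
  obtain N :: nat where N: "2 * C\<^sub>Z / c < real N" using reals_Archimedean2 by blast
  have N0: "0 < real N" using N C\<^sub>Z_nonneg c by (smt (verit) divide_nonneg_pos)
  have NC: "C\<^sub>Z * (1 / real N) \<le> c / 2" using N N0 c by (simp add: field_simps)
  let ?v = "\<lambda>k. real k / real N"
  have v: "?v k \<in> {0..1}" if "k \<le> N" for k using that N0 by (auto simp: divide_le_eq)
  let ?B = "\<lambda>n k. {\<omega>\<in>space M. c / 2 < \<bar>Qn n (?v k) \<omega> - Q (?v k)\<bar>}"
  have lim: "(\<lambda>n. \<Sum>k\<le>N. prob (?B n k)) \<longlonglongrightarrow> 0"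
    using c by (intro tendsto_null_sum Qn_converges v) auto
  have B: "?B n k \<in> events" if "k \<le> N" for n k
    using Qn_measurable[OF v[OF that], of n] by measurable
  have le: "prob {\<omega>\<in>space M. \<exists>u\<in>{0..1}. \<bar>Qn n u \<omega> - Q u\<bar> > c} \<le> (\<Sum>k\<le>N. prob (?B n k))" for n
  proof -
    have "{\<omega>\<in>space M. \<exists>u\<in>{0..1}. \<bar>Qn n u \<omega> - Q u\<bar> > c} \<subseteq> (\<Union>k\<le>N. ?B n k)"
    proof (rule ccontr)
      assume "\<not> ?thesis"
      then obtain \<omega> where \<omega>: "\<omega> \<in> space M" "\<exists>u\<in>{0..1}. \<bar>Qn n u \<omega> - Q u\<bar> > c" "\<omega> \<notin> (\<Union>k\<le>N. ?B n k)"
        by blast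
      obtain u where u: "u \<in> {0..1}" "\<bar>Qn n u \<omega> - Q u\<bar> > c" using \<omega>(2) by blast
      have nB: "\<bar>Qn n (?v k) \<omega> - Q (?v k)\<bar> \<le> c / 2" if "k \<le> N" for k
        using \<omega>(1,3) that by (auto simp: not_less)
      define k where "k = nat \<lfloor>u * real N\<rfloor>"
      have k: "real k \<le> u * real N" "u * real N < real k + 1"
        using u(1) N0 by (auto simp: k_def of_nat_nat)
      have kN: "k \<le> N"
      proof -
        have "u * real N \<le> 1 * real N" using u(1) by (intro mult_right_mono) auto
        then show ?thesis using k(1) by simp
      qed
      have lo: "?v k \<le> u" using k(1) N0 by (simp add: divide_le_eq)
      have "Qn n (?v k) \<omega> - Q (?v k) \<ge> - (c / 2)" using nB[OF kN] by linarith
      moreover have "Q u - Q (?v k) \<le> c / 2"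
      proof -
        have "u \<le> (real k + 1) / real N" using k(2) N0 by (simp add: le_divide_eq)
        then have "u - ?v k \<le> 1 / real N" by (simp add: add_divide_distrib)
        then have "C\<^sub>Z * (u - ?v k) \<le> C\<^sub>Z * (1 / real N)" by (intro mult_left_mono C\<^sub>Z_nonneg)
        moreover have "Q u - Q (?v k) \<le> C\<^sub>Z * (u - ?v k)"
          by (rule Q_increment(2)) (use lo v[OF kN] u(1) in auto)
        ultimately show ?thesis using NC by linarith
      qed
      moreover have "Qn n (?v k) \<omega> \<le> Qn n u \<omega>" by (rule Qn_mono[OF lo])
      ultimately have low: "- c \<le> Qn n u \<omega> - Q u" by linarith
      have "Qn n u \<omega> - Q u \<le> c"
      \<comment> \<open>At the right end there is no further grid point, but then \<open>u\<close>
        is itself the last one.\<close>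
      proof (cases "k = N")
        case True
        then have uk: "u = ?v k" using lo u(1) N0 by auto
        have "Qn n u \<omega> - Q u \<le> c / 2" unfolding uk using nB[OF kN] by linarith
        then show ?thesis using c by linarith
      next
        case False
        then have k1: "k + 1 \<le> N" using kN by simp
        have hi: "u \<le> ?v (k + 1)" using k(2) N0 by (simp add: le_divide_eq)
        have "Q (?v (k + 1)) - Q u \<le> c / 2"
        proof -
          have "?v (k + 1) - u \<le> 1 / real N" using lo by (simp add: add_divide_distrib)
          then have "C\<^sub>Z * (?v (k + 1) - u) \<le> C\<^sub>Z * (1 / real N)" by (intro mult_left_mono C\<^sub>Z_nonneg)
          moreover have "Q (?v (k + 1)) - Q u \<le> C\<^sub>Z * (?v (k + 1) - u)"
            by (rule Q_increment(2)) (use hi v[OF k1] u(1) in auto)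
          ultimately show ?thesis using NC by linarith
        qed
        moreover have "Qn n u \<omega> \<le> Qn n (?v (k + 1)) \<omega>" by (rule Qn_mono[OF hi])
        moreover have "Qn n (?v (k + 1)) \<omega> - Q (?v (k + 1)) \<le> c / 2" using nB[OF k1] by linarith
        ultimately show ?thesis by linarith
      qed
      with low u(2) show False by linarith
    qed
    \<comment> \<open>For this comparison only the covering event, a finite union, has to be
      measurable.\<close>
    then have "prob {\<omega>\<in>space M. \<exists>u\<in>{0..1}. \<bar>Qn n u \<omega> - Q u\<bar> > c} \<le> prob (\<Union>k\<le>N. ?B n k)"
      using B by (intro finite_measure_mono) auto
    also have "\<dots> \<le> (\<Sum>k\<le>N. prob (?B n k))"
      using B by (intro measure_UNION_le) auto
    finally show ?thesis .
  qed
  show ?thesis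
  proof (rule tendsto_sandwich[OF _ _ tendsto_const lim])
    show "eventually (\<lambda>n. 0 \<le> prob {\<omega>\<in>space M. \<exists>u\<in>{0..1}. \<bar>Qn n u \<omega> - Q u\<bar> > c}) sequentially"
      by (intro always_eventually allI measure_nonneg)
    show "eventually (\<lambda>n. prob {\<omega>\<in>space M. \<exists>u\<in>{0..1}. \<bar>Qn n u \<omega> - Q u\<bar> > c} \<le> (\<Sum>k\<le>N. prob (?B n k))) sequentially"
      by (intro always_eventually allI le)
  qed
qed

end

section \<open>Reduction of the rate conditions\<close>

lemma divide_powr_mono_tendsto_0:
  fixes s s' :: real
  assumes "(\<lambda>n. real (a n) / real n powr s) \<longlonglongrightarrow> 0" "s \<le> s'"
  shows "(\<lambda>n. real (a n) / real n powr s') \<longlonglongrightarrow> 0"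
proof (rule tendsto_0_le[OF assms(1), of _ 1])
  show "eventually (\<lambda>n. norm (real (a n) / real n powr s') \<le> norm (real (a n) / real n powr s) * 1) sequentially"
    using eventually_ge_at_top[of 1]
  proof eventually_elim
    case (elim n)
    then have "real n powr s \<le> real n powr s'" by (intro powr_mono assms) auto
    then show ?case using elim by (auto intro!: divide_left_mono mult_pos_pos)
  qed
qed

theorem theoremC7:
  fixes M :: "'a measure"
    and \<epsilon> \<epsilon>s :: "int \<Rightarrow> 'a \<Rightarrow> real"
    and Gn :: "nat \<Rightarrow> real \<Rightarrow> (nat \<Rightarrow> real) \<Rightarrow> real^'d"
    and G :: "real \<Rightarrow> (nat \<Rightarrow> real) \<Rightarrow> real^'d"
    and f :: "real^'d \<Rightarrow> real"
    and Df :: "real^'d \<Rightarrow> real^'d"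
    and D2f :: "real^'d \<Rightarrow> real^'d^'d"
    and muhat :: "int \<Rightarrow> nat \<Rightarrow> 'a \<Rightarrow> real^'d"
    and \<tau> L b :: "nat \<Rightarrow> nat"
    and q p \<kappa> C\<^sub>G C\<^sub>f :: real
    and \<delta> :: ereal
    and X :: "int \<Rightarrow> nat \<Rightarrow> 'a \<Rightarrow> real^'d"
    and mu :: "real \<Rightarrow> real^'d"
    and mun :: "nat \<Rightarrow> real \<Rightarrow> real^'d"
    and Mdelta :: "(real^'d) set"
    and Sig :: "real \<Rightarrow> real^'d^'d"
    and Qn :: "nat \<Rightarrow> real \<Rightarrow> 'a \<Rightarrow> real"
    and Q :: "real \<Rightarrow> real"
  defines "X \<equiv> (\<lambda>t n \<omega>. Gn n (real_of_int t / real n) (eps_seq \<epsilon> t \<omega>))"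
    and "mu \<equiv> (\<lambda>u. integral\<^sup>L M (\<lambda>\<omega>. G u (eps_seq \<epsilon> 0 \<omega>)))"
    and "mun \<equiv> (\<lambda>n u. integral\<^sup>L M (\<lambda>\<omega>. Gn n u (eps_seq \<epsilon> 0 \<omega>)))"
    and "Mdelta \<equiv> {x. \<exists>y\<in>convex hull (mu ` {0..1}). ereal (dist x y) < \<delta>}"
    and "Sig \<equiv> (\<lambda>v. \<chi> i j. (\<Sum>\<^sub>\<infinity>h::int. integral\<^sup>L M (\<lambda>\<omega>.
              (G v (eps_seq \<epsilon> 0 \<omega>) $ i - mu v $ i) * (G v (eps_seq \<epsilon> h \<omega>) $ j - mu v $ j))))"
    and "Qn \<equiv> (\<lambda>n u \<omega>. (1 / real n) *
            (\<Sum>t\<in>{int (\<tau> n + L n) .. \<lfloor>real n * u\<rfloor> - int (b n)}.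
               (1 / real (b n)) *
               (Df (muhat (t - int (L n)) n \<omega>) \<bullet>
                  (\<Sum>i\<in>{1..b n}. X (t + int i) n \<omega> - muhat (t - int (L n)) n \<omega>))\<^sup>2))"
    and "Q \<equiv> (\<lambda>u. integral {0..u} (\<lambda>v. Df (mu v) \<bullet> (Sig v *v Df (mu v))))"
  assumes P: "prob_space M"
    (* i.i.d. innovations and an independent copy *)
    and iid: "prob_space.indep_vars M (\<lambda>_. borel) (case_sum \<epsilon> \<epsilon>s) UNIV"
    and ident: "\<forall>i. distr M borel (\<epsilon> i) = distr M borel (\<epsilon> 0) \<and> distr M borel (\<epsilon>s i) = distr M borel (\<epsilon> 0)"
    (* measurable kernels *)
    and meas_Gn: "\<forall>n. (\<lambda>(u, x). Gn n u x) \<in> borel_measurable (borel \<Otimes>\<^sub>M (\<Pi>\<^sub>M k\<in>(UNIV::nat set). borel))"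
    and meas_G: "(\<lambda>(u, x). G u x) \<in> borel_measurable (borel \<Otimes>\<^sub>M (\<Pi>\<^sub>M k\<in>(UNIV::nat set). borel))"
    (* parameters *)
    and q: "q > 4" and p: "1 \<le> p" "p < 4" and \<kappa>: "0 < \<kappa>" "\<kappa> \<le> 1/2"
    (* (A.1) *)
    and A1: "\<forall>e>0. eventually (\<lambda>n. \<forall>u\<in>{0..1}.
               Lq_le M q (\<lambda>\<omega>. Gn n u (eps_seq \<epsilon> 0 \<omega>) - G u (eps_seq \<epsilon> 0 \<omega>)) e) sequentially"
    (* (A.2) *)
    and A2_fin: "\<forall>n. \<forall>u\<in>{0..1}. Lq_moment M q (\<lambda>\<omega>. Gn n u (eps_seq \<epsilon> 0 \<omega>)) < \<infinity>"
    and A2: "\<forall>n n' w u m. w \<in> {0..1} \<longrightarrow> is_partition01 u m \<longrightarrow>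
               Lq_norm M q (\<lambda>\<omega>. Gn n w (eps_seq \<epsilon> 0 \<omega>)) +
               (\<Sum>i\<in>{1..m}. Lq_norm M q (\<lambda>\<omega>. Gn n' (u i) (eps_seq \<epsilon> 0 \<omega>)
                                              - Gn n' (u (i - 1)) (eps_seq \<epsilon> 0 \<omega>)) powr p) powr (1 / p)
               \<le> C\<^sub>G"
    (* (A.3) *)
    and A3: "\<exists>\<rho>. 0 < \<rho> \<and> \<rho> < 1 \<and> (\<forall>t j n. \<forall>u\<in>{0..1}.
               Lq_le M q (\<lambda>\<omega>. Gn n u (eps_seq \<epsilon> t \<omega>) - Gn n u (eps_tilde \<epsilon> \<epsilon>s t j \<omega>)) (C\<^sub>G * \<rho> ^ j))"
    (* (A.4) *)
    and \<delta>: "0 < \<delta>"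
    and f_diff: "\<forall>x. (f has_derivative (\<lambda>h. Df x \<bullet> h)) (at x)"
    and Df_diff: "\<forall>x. (Df has_derivative (\<lambda>h. D2f x *v h)) (at x)"
    and A4: "\<forall>x\<in>Mdelta. \<bar>f x\<bar> + norm (Df x) + norm (D2f x) \<le> C\<^sub>f"
    (* pilot estimators *)
    and muhat_meas: "\<forall>n t. int (\<tau> n) \<le> t \<and> t \<le> int n \<longrightarrow>
               muhat t n \<in> borel_measurable (past_sigma M \<epsilon> t)"
    and \<tau>_pos: "\<forall>n. 1 \<le> \<tau> n"
    and L_inf: "filterlim L at_top sequentially"
    and L_\<tau>: "(\<lambda>n. real (L n) / real (\<tau> n)) \<longlonglongrightarrow> 0"
    (* (C.5* ) *)
    and C5: "small_oP M (\<lambda>n \<omega>. \<Sum>t\<in>{int (\<tau> n)..int n}.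
               (norm (muhat t n \<omega> - mun n (real_of_int t / real n)))\<^sup>2)
             (\<lambda>n. real n powr (1 - \<kappa>))"
    (* (A.6) *)
    and A6: "(\<lambda>n. measure M {\<omega>\<in>space M. \<forall>t\<in>{int (\<tau> n)..int n}. muhat t n \<omega> \<in> Mdelta})
             \<longlonglongrightarrow> 1"
    (* further rate conditions *)
    and \<tau>_n: "(\<lambda>n. real (\<tau> n) / real n) \<longlonglongrightarrow> 0"
    and L_log: "\<exists>a. 0 < a \<and> a < 1 \<and> (\<lambda>n. ln (real n) powr (1 + a) / real (L n)) \<longlonglongrightarrow> 0"
    and L_r1: "(\<lambda>n. real (L n) / real n powr (1 / p - 1 / 4)) \<longlonglongrightarrow> 0"
    and L_r2: "(\<lambda>n. real (L n) / real n powr (1 / (2 * p))) \<longlonglongrightarrow> 0"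
    (* block length *)
    and b_inf: "filterlim b at_top sequentially"
    and b_r1: "(\<lambda>n. real (b n) / real n powr (2 / (3 * max p 2))) \<longlonglongrightarrow> 0"
    and b_r2: "(\<lambda>n. real (b n) / real n powr ((\<kappa> * q - 2) / (q + 2))) \<longlonglongrightarrow> 0"
  shows "\<forall>e>0. (\<lambda>n. measure M {\<omega>\<in>space M. \<exists>u\<in>{0..1}. \<bar>Qn n u \<omega> - Q u\<bar> > e}) \<longlonglongrightarrow> 0"
proof -
  interpret prob_space M by (rule P)
  interpret innovations M \<epsilon> \<epsilon>s
    using iid ident by unfold_locales
  obtain \<rho> where \<rho>: "0 < \<rho>" "\<rho> < 1" and A3': "\<forall>t j n. \<forall>u\<in>{0..1}.
      Lq_le M q (\<lambda>\<omega>. Gn n u (eps_seq \<epsilon> t \<omega>) - Gn n u (eps_tilde \<epsilon> \<epsilon>s t j \<omega>)) (C\<^sub>G * \<rho> ^ j)"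
    using A3 by blast
  define r where "r = max p 2"
  have r: "2 \<le> r" by (simp add: r_def)
  \<comment> \<open>As \<open>r \<ge> 2\<close>, this exponent satisfies
    \<open>3 * s \<le> 1\<close>, which yields the rate for the variance, and
    \<open>s \<le> 1 / r\<close>, which yields the one for the drift.\<close>
  define s where "s = 2 / (3 * r)"
  have s: "0 < s" "s \<le> 1 / 2" "3 * s = 2 / r" "3 * s \<le> 1" "s \<le> 1 / r"
    using r by (auto simp: s_def field_simps)
  have bs: "(\<lambda>n. real (b n) / real n powr s) \<longlonglongrightarrow> 0"
    using b_r1 by (simp add: s_def r_def)
  have p2: "1 / (2 * p) \<le> 1 / 2" using p by (simp add: field_simps)
  have Lh: "(\<lambda>n. real (L n) / real n powr (1 / 2)) \<longlonglongrightarrow> 0"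
    by (rule divide_powr_mono_tendsto_0[OF L_r2 p2])
  have bh: "(\<lambda>n. real (b n) / real n powr (1 / 2)) \<longlonglongrightarrow> 0"
    by (rule divide_powr_mono_tendsto_0[OF bs s(2)])
  have L_n: "(\<lambda>n. real (L n) / real n) \<longlonglongrightarrow> 0"
    using divide_powr_mono_tendsto_0[OF Lh, of 1] by simp
  \<comment> \<open>The given exponent is at most \<kappa>, since
    \<open>\<kappa> * q - 2 \<le> \<kappa> * (q + 2)\<close>.\<close>
  have b_\<kappa>: "(\<lambda>n. real (b n) / real n powr \<kappa>) \<longlonglongrightarrow> 0"
    by (rule divide_powr_mono_tendsto_0[OF b_r2]) (use q \<kappa> in \<open>simp add: divide_le_eq algebra_simps\<close>)
  have b3_n: "(\<lambda>n. real (b n) ^ 3 / real n) \<longlonglongrightarrow> 0"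
  proof (rule tendsto_0_le[where K = 1])
    show "(\<lambda>n. (real (b n) / real n powr s) ^ 3) \<longlonglongrightarrow> 0"
      using tendsto_power[OF bs, of 3] by simp
    show "eventually (\<lambda>n. norm (real (b n) ^ 3 / real n) \<le> norm ((real (b n) / real n powr s) ^ 3) * 1) sequentially"
      using eventually_ge_at_top[of 1]
    proof eventually_elim
      case (elim n)
      have "(real n powr s) ^ 3 = real n powr (3 * s)"
        using elim by (simp add: powr_powr mult.commute flip: powr_numeral)
      also have "\<dots> \<le> real n powr 1" using elim s by (intro powr_mono) auto
      finally have "(real n powr s) ^ 3 \<le> real n" by simp
      then show ?case using elim by (auto simp: power_divide intro!: divide_left_mono mult_pos_pos)
    qed
  qed
  \<comment> \<open>Eventually L + b is at most n^(1/2), so the base is at most n^(-1/2) and its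
    power \<open>2 / r\<close> at most n^(-1/r), which is dominated by n^(-s).\<close>
  have b_pvar: "(\<lambda>n. real (b n) * ((real (L n) + real (b n)) / real n) powr (2 / max p 2)) \<longlonglongrightarrow> 0"
  proof (rule tendsto_0_le[OF bs, where K = 1])
    have "(\<lambda>n. real (L n) / real n powr (1 / 2) + real (b n) / real n powr (1 / 2)) \<longlonglongrightarrow> 0 + 0"
      by (intro tendsto_add Lh bh)
    then have "eventually (\<lambda>n. real (L n) / real n powr (1 / 2) + real (b n) / real n powr (1 / 2) < 1) sequentially"
      by (intro order_tendstoD) auto
    then show "eventually (\<lambda>n. norm (real (b n) * ((real (L n) + real (b n)) / real n) powr (2 / max p 2))
        \<le> norm (real (b n) / real n powr s) * 1) sequentially"
      using eventually_ge_at_top[of 1]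
    proof eventually_elim
      case (elim n)
      have n: "1 \<le> real n" using elim by simp
      have "(real (L n) + real (b n)) / real n powr (1 / 2) < 1" using elim(1) by (simp add: add_divide_distrib)
      then have "real (L n) + real (b n) \<le> real n powr (1 / 2)" using n by (simp add: divide_less_eq split: if_splits)
      then have "(real (L n) + real (b n)) / real n \<le> real n powr (1 / 2) / real n powr 1"
        using n by (intro divide_mono) auto
      also have "\<dots> = real n powr (1 / 2 - 1)" by (rule powr_diff[symmetric])
      also have "\<dots> = real n powr (- 1 / 2)" by simp
      finally have "((real (L n) + real (b n)) / real n) powr (2 / r) \<le> (real n powr (- 1 / 2)) powr (2 / r)"
        using r by (intro powr_mono2) auto
      also have "\<dots> = real n powr (- (1 / r))" by (simp add: powr_powr)
      also have "\<dots> \<le> real n powr (- s)" using n s by (intro powr_mono) auto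
      finally have "real (b n) * ((real (L n) + real (b n)) / real n) powr (2 / r) \<le> real (b n) * real n powr (- s)"
        by (intro mult_left_mono) auto
      then show ?case by (simp add: r_def powr_minus divide_inverse)
    qed
  qed
  interpret B: block_pilot M \<epsilon> \<epsilon>s Gn G Df D2f q p C\<^sub>G C\<^sub>f \<rho> \<delta> mu mun Mdelta \<tau> L b muhat \<kappa>
  proof unfold_locales
    show "\<forall>x\<in>Mdelta. norm (Df x) + norm (D2f x) \<le> C\<^sub>f"
    proof
      fix x assume "x \<in> Mdelta"
      then have "\<bar>f x\<bar> + norm (Df x) + norm (D2f x) \<le> C\<^sub>f" using A4 by blast
      then show "norm (Df x) + norm (D2f x) \<le> C\<^sub>f" using abs_ge_zero[of "f x"] by linarith
    qed
    show "mu = (\<lambda>u. expectation (\<lambda>\<omega>. G u (eps_seq \<epsilon> 0 \<omega>)))" by (simp add: mu_def)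
    show "mun = (\<lambda>n u. expectation (\<lambda>\<omega>. Gn n u (eps_seq \<epsilon> 0 \<omega>)))" by (simp add: mun_def)
    show "Mdelta = {x. \<exists>y\<in>convex hull (mu ` {0..1}). ereal (dist x y) < \<delta>}" by (simp add: Mdelta_def)
  qed (rule meas_Gn meas_G q p A1 A2_fin A2 \<rho> A3' \<delta> Df_diff \<tau>_pos \<tau>_n L_n b_inf b3_n muhat_meas C5 A6 \<kappa> b_\<kappa> b_pvar)+
  have "B.Qn = Qn"
    by (simp add: fun_eq_iff B.Qn_def Qn_def B.I_def X_def)
  moreover have "B.Q = Q"
    by (simp add: fun_eq_iff B.Q_def Q_def B.lrv_def[abs_def] B.Sig_def Sig_def)
  ultimately show ?thesis
    using B.Qn_converges_uniformly by simp
qed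

end
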